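(* Let $E$ and $S$ be Polish spaces endowed with arbitrary filtrations $(\mathcal{B}_t(E))_{t\in I}$, $(\mathcal{B}_t(S))_{t\in I}$ of their Borel sigma-fields indexed by a same totally ordered set $I$. Let $c:E\times S\to\mathbb{R}\cup\{+\infty\}$ be a non-negative lower semi-continuous map, $\eta\in\mathcal{P}_E$ and $\nu\in\mathcal{P}_S$. Then $P_{\eta,\nu}=D_{\eta,\nu}$, where $$P_{\eta,\nu}:=\inf\left\{\int_{E\times S}c(x,y)\,d\gamma(x,y):\gamma\in\Pi_c(\eta,\nu)\right\}$$ and $$D_{\eta,\nu}:=\sup\left\{\int_S g(y)\,d\nu(y)\ :\ (g,h)\in C_b(S)\times\mathcal{H}_{\eta,\nu},\ g(y)+h(x,y)\le c(x,y)\ \ \forall (x,y)\in E\times S\right\}.$$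
   Context: A filtration $(\mathcal{B}_t(E))_{t\in I}$ of $\mathcal{B}(E)$ is a family of sigma-fields with $\mathcal{B}_s(E)\subset\mathcal{B}_t(E)\subset\mathcal{B}(E)$ for $s\le t$ (similarly on $S$). $\mathcal{P}_Z$ is the set of Borel probabilities on a Polish space $Z$. For a sigma-field $\mathcal{G}\subset\mathcal{B}(E)$, $\mathcal{G}^\eta$ is its $\eta$-completion (generated by $\mathcal{G}$ and the $\eta$-negligible sets). With $\pi,\widetilde\pi$ the projections of $E\times S$ onto $E$, $S$, $\Pi(\eta,\nu)=\{\gamma\in\mathcal{P}_{E\times S}:\pi_\star\gamma=\eta,\ \widetilde\pi_\star\gamma=\nu\}$. A kernel associated to $\gamma\in\Pi(\eta,\nu)$ is a map $\Theta_\gamma:E\times\mathcal{B}(S)\to\mathbb{R}$ with $\Theta^x_\gamma\in\mathcal{P}_S$ for all $x$, $x\mapsto\Theta^x_\gamma(B)$ Borel for all $B$, and $\gamma(A\times B)=\int_A\Theta^x_\gamma(B)\,d\eta(x)$ for all $A\in\mathcal{B}(E),B\in\mathcal{B}(S)$. For $t\in I$, $\mathcal{G}_t(\gamma)$ is the $\eta$-completion of the smallest sigma-field on $E$ making $x\mapsto\Theta^x_\gamma(C)$ measurable for every $C\in\mathcal{B}_t(S)$ with $\nu(\partial C)=0$. Causal transference plans: $\Pi_c(\eta,\nu)=\{\gamma\in\Pi(\eta,\nu):\mathcal{G}_t(\gamma)\subset\mathcal{B}_t(E)^\eta\ \text{for all }t\in I\}$. Definition of $\mathcal{H}_{\eta,\nu}$: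 add a symbol $t_0\notin I$ with $\mathcal{B}_{t_0}(S)=\{\emptyset,S\}$, $\mathcal{B}_{t_0}(E)=\{\emptyset,E\}$. $\mathcal{H}_{\eta,\nu}$ is the set of Borel maps $h:E\times S\to\mathbb{R}$ of the form $h(x,y)=\sum_{i=1}^N g_i(x)1_{A_i}(y)$ with $N\in\mathbb{N}$, such that for some $t_1,\dots,t_N\in I\cup\{t_0\}$ and all $i=1,\dots,N$: $A_i\in\mathcal{B}_{t_i}(S)$ and $\nu(\partial A_i)=0$; and $g_i:E\to\mathbb{R}$ is a bounded measurable map such that $g_i=X_i-E_\eta[X_i\mid\mathcal{B}_{t_i}(E)^\eta]$ $\eta$-a.s. for some $X_i\in L^\infty(\eta)$. *)

theory Defs
  imports "HOL-Probability.Probability"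
begin

text \<open>
  A sub-sigma-field of a Borel sigma-field is represented by a measure object of which only
  \<^const>\<open>sets\<close> matters.  The Borel probabilities on a space are the measure objects
  on its Borel sets that are probability measures.
\<close>

definition borel_probs :: "'z::topological_space measure set" where
  "borel_probs = {\<mu>. sets \<mu> = sets borel \<and> prob_space \<mu>}"

definition borel_filtration ::
    "'i::linorder set \<Rightarrow> ('i \<Rightarrow> 'z::topological_space measure) \<Rightarrow> bool" where
  "borel_filtration I F \<longleftrightarrow>
     (\<forall>t\<in>I. subalgebra borel (F t)) \<and>
     (\<forall>s\<in>I. \<forall>t\<in>I. s \<le> t \<longrightarrow> sets (F s) \<subseteq> sets (F t))"

definition lower_semicont :: "('z::topological_space \<Rightarrow> ereal) \<Rightarrow> bool" where
  "lower_semicont f \<longleftrightarrow> (\<forall>a. open {z. a < f z})"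

definition transference_plans ::
    "'e::topological_space measure \<Rightarrow> 's::topological_space measure \<Rightarrow> ('e \<times> 's) measure set" where
  "transference_plans \<eta> \<nu> =
     {\<gamma> \<in> borel_probs. distr \<gamma> borel fst = \<eta> \<and> distr \<gamma> borel snd = \<nu>}"

definition is_kernel ::
    "'e::topological_space measure \<Rightarrow> ('e \<times> 's::topological_space) measure \<Rightarrow> ('e \<Rightarrow> 's measure) \<Rightarrow> bool"
  where
  "is_kernel \<eta> \<gamma> \<Theta> \<longleftrightarrow>
     (\<forall>x. \<Theta> x \<in> borel_probs) \<and>
     (\<forall>B\<in>sets borel. (\<lambda>x. measure (\<Theta> x) B) \<in> borel_measurable borel) \<and>
     (\<forall>A\<in>sets borel. \<forall>B\<in>sets borel.
        measure \<gamma> (A \<times> B) = (LINT x:A|\<eta>. measure (\<Theta> x) B))"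

text \<open>
  The completion of a sub-sigma-field by all \<open>\<eta>\<close>-negligible sets, that is, by all subsets of
  Borel \<open>\<eta>\<close>-null sets; it is in general not contained in the Borel sigma-field, only
  in that of \<^term>\<open>completion \<eta>\<close>.
\<close>

definition completed :: "'z measure \<Rightarrow> 'z measure \<Rightarrow> 'z measure" where
  "completed \<eta> G = sigma (space \<eta>) (sets G \<union> null_sets (completion \<eta>))"

definition kernel_field ::
    "'e::topological_space measure \<Rightarrow> 's::topological_space measure \<Rightarrow> 's measure \<Rightarrow> ('e \<Rightarrow> 's measure) \<Rightarrow> 'e measure"
  where
  "kernel_field \<eta> \<nu> F \<Theta> =
     completed \<eta> (sigma UNIV
       {(\<lambda>x. measure (\<Theta> x) C) -` B | C B.
          C \<in> sets F \<and> emeasure \<nu> (frontier C) = 0 \<and> B \<in> sets borel})"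

text \<open>
  Kernels are unique up to \<open>\<eta>\<close>-null sets for each fixed Borel set, so the completed field
  does not depend on the chosen kernel (lemma \<open>kernel_field_unique\<close> below); the
  existential quantifier merely picks one.
\<close>

definition causal_plans ::
    "'i set \<Rightarrow> ('i \<Rightarrow> 'e::topological_space measure) \<Rightarrow> ('i \<Rightarrow> 's::topological_space measure) \<Rightarrow>
     'e measure \<Rightarrow> 's measure \<Rightarrow> ('e \<times> 's) measure set" where
  "causal_plans I BE BS \<eta> \<nu> =
     {\<gamma> \<in> transference_plans \<eta> \<nu>.
        \<exists>\<Theta>. is_kernel \<eta> \<gamma> \<Theta> \<and>
            (\<forall>t\<in>I. sets (kernel_field \<eta> \<nu> (BS t) \<Theta>) \<subseteq> sets (completed \<eta> (BE t)))}"

text \<open>The extra index \<open>t\<^sub>0\<close>, carrying the trivial sigma-field, is \<^term>\<open>None\<close>.\<close>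

definition extended_filtration :: "('i \<Rightarrow> 'z measure) \<Rightarrow> 'i option \<Rightarrow> 'z measure" where
  "extended_filtration F t = (case t of None \<Rightarrow> sigma UNIV {} | Some s \<Rightarrow> F s)"

definition causal_test_functions ::
    "'i set \<Rightarrow> ('i \<Rightarrow> 'e::topological_space measure) \<Rightarrow> ('i \<Rightarrow> 's::topological_space measure) \<Rightarrow>
     'e measure \<Rightarrow> 's measure \<Rightarrow> ('e \<times> 's \<Rightarrow> real) set" where
  "causal_test_functions I BE BS \<eta> \<nu> =
     {h \<in> borel_measurable borel.
        \<exists>(N::nat) (g :: nat \<Rightarrow> 'e \<Rightarrow> real) (A :: nat \<Rightarrow> 's set) (t :: nat \<Rightarrow> 'i option).
          (\<forall>x y. h (x, y) = (\<Sum>i=1..N. g i x * indicator (A i) y)) \<and>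
          (\<forall>i\<in>{1..N}.
             t i \<in> insert None (Some ` I) \<and>
             A i \<in> sets (extended_filtration BS (t i)) \<and>
             emeasure \<nu> (frontier (A i)) = 0 \<and>
             g i \<in> borel_measurable borel \<and> bounded (range (g i)) \<and>
             (\<exists>X \<in> borel_measurable borel. (\<exists>K. AE x in \<eta>. \<bar>X x\<bar> \<le> K) \<and>
                (AE x in \<eta>. g i x = X x -
                   real_cond_exp (completion \<eta>)
                     (completed \<eta> (extended_filtration BE (t i))) X x)))}"

definition causal_primal ::
    "'i set \<Rightarrow> ('i \<Rightarrow> 'e::topological_space measure) \<Rightarrow> ('i \<Rightarrow> 's::topological_space measure) \<Rightarrow>
     ('e \<times> 's \<Rightarrow> ereal) \<Rightarrow> 'e measure \<Rightarrow> 's measure \<Rightarrow> ereal" where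
  "causal_primal I BE BS c \<eta> \<nu> =
     (INF \<gamma>\<in>causal_plans I BE BS \<eta> \<nu>. enn2ereal (\<integral>\<^sup>+ z. e2ennreal (c z) \<partial>\<gamma>))"

definition causal_dual ::
    "'i set \<Rightarrow> ('i \<Rightarrow> 'e::topological_space measure) \<Rightarrow> ('i \<Rightarrow> 's::topological_space measure) \<Rightarrow>
     ('e \<times> 's \<Rightarrow> ereal) \<Rightarrow> 'e measure \<Rightarrow> 's measure \<Rightarrow> ereal" where
  "causal_dual I BE BS c \<eta> \<nu> =
     (SUP (g, h) \<in> {(g, h). g \<in> bcontfun \<and> h \<in> causal_test_functions I BE BS \<eta> \<nu> \<and>
                       (\<forall>x y. ereal (g y + h (x, y)) \<le> c (x, y))}.
        ereal (\<integral>y. g y \<partial>\<nu>))"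

lemma sets_completed: "sets (completed \<eta> G) = sigma_sets (space \<eta>) (sets G \<union> null_sets (completion \<eta>))"
  if "sets G \<subseteq> sets (completion \<eta>)"
proof -
  have "sets G \<union> null_sets (completion \<eta>) \<subseteq> Pow (space \<eta>)"
    using that sets.space_closed[of "completion \<eta>"] by auto
  then show ?thesis by (simp add: completed_def)
qed

lemma subalgebra_completed: "subalgebra (completion \<eta>) (completed \<eta> G)"
  if "sets G \<subseteq> sets (completion \<eta>)"
proof -
  have "sigma_sets (space (completion \<eta>)) (sets G \<union> null_sets (completion \<eta>)) \<subseteq> sets (completion \<eta>)"
    using that by (intro sets.sigma_sets_subset) auto
  moreover have "space (completed \<eta> G) = space \<eta>"
    using that sets.space_closed[of "completion \<eta>"]
    by (auto simp: completed_def space_measure_of_conv)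
  ultimately show ?thesis
    using sets_completed[OF that] by (simp add: subalgebra_def)
qed

lemma kernel_AE_unique:
  fixes \<eta> :: "'e::topological_space measure" and \<gamma> :: "('e \<times> 's::topological_space) measure"
  assumes \<eta>: "\<eta> \<in> borel_probs"
    and K: "is_kernel \<eta> \<gamma> \<Theta>" and K': "is_kernel \<eta> \<gamma> \<Theta>'" and C: "C \<in> sets borel"
  shows "AE x in \<eta>. measure (\<Theta> x) C = measure (\<Theta>' x) C"
proof -
  interpret prob_space \<eta> using \<eta> by (simp add: borel_probs_def)
  have s: "sets \<eta> = sets borel" using \<eta> by (simp add: borel_probs_def)
  have int: "integrable \<eta> (\<lambda>x. measure (\<Phi> x) C)" if "is_kernel \<eta> \<gamma> \<Phi>" for \<Phi>
  proof (rule integrable_const_bound[where B=1])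
    show "AE x in \<eta>. norm (measure (\<Phi> x) C) \<le> 1"
      using that by (auto simp: is_kernel_def borel_probs_def prob_space.prob_le_1)
    show "(\<lambda>x. measure (\<Phi> x) C) \<in> borel_measurable \<eta>"
      using that C measurable_cong_sets[OF s refl] by (auto simp: is_kernel_def)
  qed
  show ?thesis
  proof (rule density_unique_real[OF int[OF K] int[OF K']])
    fix A assume "A \<in> sets \<eta>"
    then show "(LINT x:A|\<eta>. measure (\<Theta> x) C) = (LINT x:A|\<eta>. measure (\<Theta>' x) C)"
      using K K' C s by (metis is_kernel_def)
  qed
qed

lemma kernel_field_subset:
  fixes \<eta> :: "'e::topological_space measure" and \<gamma> :: "('e \<times> 's::topological_space) measure"
  assumes \<eta>: "\<eta> \<in> borel_probs" and F: "subalgebra borel F"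
    and K: "is_kernel \<eta> \<gamma> \<Theta>" and K': "is_kernel \<eta> \<gamma> \<Theta>'"
  shows "sets (kernel_field \<eta> \<nu> F \<Theta>) \<subseteq> sets (kernel_field \<eta> \<nu> F \<Theta>')"
proof -
  have s: "sets \<eta> = sets borel" using \<eta> by (simp add: borel_probs_def)
  then have sp: "space \<eta> = UNIV" by (metis sets_eq_imp_space_eq space_borel)
  define gen where "gen \<Phi> = {(\<lambda>x. measure (\<Phi> x) C) -` B | C B.
      C \<in> sets F \<and> emeasure \<nu> (frontier C) = 0 \<and> B \<in> sets (borel :: real measure)}"
    for \<Phi> :: "'e \<Rightarrow> 's measure"
  have gen_borel: "gen \<Phi> \<subseteq> sets \<eta>" if "is_kernel \<eta> \<gamma> \<Phi>" for \<Phi>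
  proof
    fix D assume "D \<in> gen \<Phi>"
    then obtain C B where D: "D = (\<lambda>x. measure (\<Phi> x) C) -` B" "C \<in> sets F" "B \<in> sets borel"
      by (auto simp: gen_def)
    have "C \<in> sets borel" using D F by (auto simp: subalgebra_def)
    then have "(\<lambda>x. measure (\<Phi> x) C) \<in> borel_measurable borel"
      using that by (simp add: is_kernel_def)
    from measurable_sets[OF this D(3)] show "D \<in> sets \<eta>" by (simp add: D(1) s)
  qed
  have kf: "sets (kernel_field \<eta> \<nu> F \<Phi>)
      = sigma_sets UNIV (sigma_sets UNIV (gen \<Phi>) \<union> null_sets (completion \<eta>))"
    if "is_kernel \<eta> \<gamma> \<Phi>" for \<Phi>
  proof -
    have "sigma_sets UNIV (gen \<Phi>) \<subseteq> sets \<eta>"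
      using sets.sigma_sets_subset[OF gen_borel[OF that]] sp by simp
    then have "sets (sigma UNIV (gen \<Phi>)) \<subseteq> sets (completion \<eta>)"
      by (auto intro: sets_completionI_sets)
    from sets_completed[OF this] show ?thesis
      by (simp add: kernel_field_def gen_def sp)
  qed
  let ?S = "sigma_sets UNIV (sigma_sets UNIV (gen \<Theta>') \<union> null_sets (completion \<eta>))"
  interpret S: sigma_algebra UNIV ?S by (rule sigma_algebra_sigma_sets) auto
  have "gen \<Theta> \<subseteq> ?S"
  proof
    fix D assume "D \<in> gen \<Theta>"
    then obtain C B where D: "D = (\<lambda>x. measure (\<Theta> x) C) -` B" and CB: "C \<in> sets F"
        "emeasure \<nu> (frontier C) = 0" "B \<in> sets borel"
      by (auto simp: gen_def)
    define D' where "D' = (\<lambda>x. measure (\<Theta>' x) C) -` B"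
    have D': "D' \<in> ?S" using CB by (auto simp: D'_def gen_def)
    have "C \<in> sets borel" using CB F by (auto simp: subalgebra_def)
    from kernel_AE_unique[OF \<eta> K K' this]
    obtain N where N: "N \<in> null_sets \<eta>" "{x. measure (\<Theta> x) C \<noteq> measure (\<Theta>' x) C} \<subseteq> N"
      by (auto simp: eventually_ae_filter sp)
    have null: "M \<in> ?S" if "M \<subseteq> N" for M
    proof -
      have "M \<in> null_sets (completion \<eta>)"
        using that N null_sets_completion_subset null_sets_completionI by blast
      then show ?thesis by auto
    qed
    have "D = (D' - (D' - D)) \<union> (D - D')" by blast
    moreover have "D - D' \<subseteq> N" "D' - D \<subseteq> N" using N(2) by (auto simp: D D'_def)
    ultimately show "D \<in> ?S" using null D' by (metis S.Diff S.Un)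
  qed
  then have "sigma_sets UNIV (gen \<Theta>) \<subseteq> ?S" by (rule S.sigma_sets_subset)
  then have "sigma_sets UNIV (sigma_sets UNIV (gen \<Theta>) \<union> null_sets (completion \<eta>)) \<subseteq> ?S"
    by (intro S.sigma_sets_subset) auto
  then show ?thesis by (simp add: kf[OF K] kf[OF K'])
qed

lemma kernel_field_unique:
  fixes \<eta> :: "'e::topological_space measure" and \<gamma> :: "('e \<times> 's::topological_space) measure"
  assumes "\<eta> \<in> borel_probs" "subalgebra borel F" "is_kernel \<eta> \<gamma> \<Theta>" "is_kernel \<eta> \<gamma> \<Theta>'"
  shows "sets (kernel_field \<eta> \<nu> F \<Theta>) = sets (kernel_field \<eta> \<nu> F \<Theta>')"
  using assms by (intro equalityI kernel_field_subset) auto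

end

theory Submission
  imports Defs
begin

text \<open>
  Test functions integrate to zero against causal plans, which gives weak duality.  For the converse,
  let \<open>m\<close> be the value of the dual problem, assumed finite.  That no dual competitor exceeds \<open>m\<close> says that a convex cone of pairs
  (function on \<open>E \<times> S\<close>, price), generated by bounded functions of \<open>y\<close> at the price of their \<open>\<nu>\<close>-integral,
  by test functions at price \<open>0\<close> and by Lipschitz functions below \<open>c\<close> at price \<open>m\<close>, gives no nonnegative
  function a negative price.  By Hahn-Banach there is a positive linear functional \<open>L\<close> on all bounded
  functions that is dominated by these prices.  It is only finitely additive, but its marginals are \<open>\<eta>\<close>
  and \<open>\<nu>\<close>; so each \<open>f \<mapsto> L (f(x) 1\<^sub>A(y))\<close> has an \<open>\<eta>\<close>-density, and since \<open>\<nu>\<close> is tight these densities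
  assemble into a kernel.  The resulting plan annihilates the test functions, hence is causal, and
  its cost is at most \<open>m\<close> because \<open>c\<close> is a limit of Lipschitz functions from below.
\<close>

section \<open>Dominated linear functionals\<close>

text \<open>Test functions need not be continuous in either variable: \<open>g i\<close> is only
  Borel in \<open>x\<close> and \<open>A i\<close> enters through its indicator, so separation in a
  space of continuous functions does not see them directly. Working with all bounded functions
  removes topology from the separation step; the price is that countable additivity has to be
  recovered afterwards from the two marginals. The second marginal is built into the cone because
  bounded Borel potentials, not only continuous ones, are priced at their \<nu>-integral. Returning
  to continuous potentials costs nothing in value since the sets \<open>A i\<close> have \<nu>-null
  frontiers. The first marginal comes from the extra index: for the trivial sigma-field,
  \<open>f x\<close> minus its \<eta>-integral is a test function. Causality is recovered by testing
  with the residual of the kernel itself. Since the functional yields a plan of cost at most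
  \<open>m\<close>, the primal infimum is attained whenever the dual value is finite.\<close>

lemma minimal_sublinear_linear:
  fixes q :: "'v::real_vector \<Rightarrow> real"
  assumes sub: "\<And>u v. q (u + v) \<le> q u + q v" and hom: "\<And>a v. 0 \<le> a \<Longrightarrow> q (a *\<^sub>R v) = a * q v"
    and min: "\<And>q'. (\<And>u v. q' (u + v) \<le> q' u + q' v) \<Longrightarrow>
      (\<And>a v. 0 \<le> a \<Longrightarrow> q' (a *\<^sub>R v) = a * q' v) \<Longrightarrow> (\<And>v. q' v \<le> q v) \<Longrightarrow> q' = q"
  shows "linear q"
proof -
  have q0: "q 0 = 0" using hom[of 0 0] by simp
  have neg: "- q (- v) \<le> q v" for v using sub[of v "-v"] q0 by simp
  have ge: "q u + q v \<le> q (u + v)" for u v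
  proof -
    \<comment> \<open>The infimum of \<open>q (w + t *\<^sub>R v) - t * q v\<close> over
      \<open>t \<ge> 0\<close> is again sublinear and below \<open>q\<close>, so minimality makes it
      equal to \<open>q\<close>. Taking \<open>t = 1\<close> then gives superadditivity.\<close>
    define S where "S w = (\<lambda>t. q (w + t *\<^sub>R v) - t * q v) ` {0..}" for w
    define q' where "q' w = Inf (S w)" for w
    have low: "- q (- w) \<le> r" if r: "r \<in> S w" for w r
    proof -
      obtain t where t: "0 \<le> t" "r = q (w + t *\<^sub>R v) - t * q v" using r by (auto simp: S_def)
      have "t * q v \<le> q (w + t *\<^sub>R v) + q (- w)"
        using sub[of "w + t *\<^sub>R v" "-w"] hom[OF t(1)] by simp
      then show ?thesis using t by simp
    qed
    have bdd: "bdd_below (S w)" for w using low by (meson bdd_below.I)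
    have ne: "S w \<noteq> {}" for w by (auto simp: S_def)
    have lower: "q' w \<le> q (w + t *\<^sub>R v) - t * q v" if "0 \<le> t" for w t
      unfolding q'_def by (rule cInf_lower[OF _ bdd]) (use that in \<open>auto simp: S_def\<close>)
    have 1: "q' (a + b) \<le> q' a + q' b" for a b
    proof -
      have "q' (a + b) - r \<le> s" if r: "r \<in> S a" and s: "s \<in> S b" for r s
      proof -
        obtain t where t: "0 \<le> t" "r = q (a + t *\<^sub>R v) - t * q v" using r by (auto simp: S_def)
        obtain t' where t': "0 \<le> t'" "s = q (b + t' *\<^sub>R v) - t' * q v" using s by (auto simp: S_def)
        have "q' (a + b) \<le> q ((a + t *\<^sub>R v) + (b + t' *\<^sub>R v)) - (t + t') * q v"
          using lower[of "t + t'" "a + b"] t(1) t'(1) by (simp add: algebra_simps scaleR_add_left)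
        also have "\<dots> \<le> q (a + t *\<^sub>R v) + q (b + t' *\<^sub>R v) - (t + t') * q v"
          using sub by simp
        finally show ?thesis using t t' by (simp add: algebra_simps)
      qed
      then have "q' (a + b) - r \<le> q' b" if "r \<in> S a" for r
        using that unfolding q'_def[of b] by (intro cInf_greatest ne) auto
      then have "q' (a + b) - q' b \<le> q' a"
        unfolding q'_def[of a] by (intro cInf_greatest ne) (simp add: algebra_simps)
      then show ?thesis by simp
    qed
    \<comment> \<open>Only this half is read off from the infimum; the other half is the same
      inequality for \<open>1 / a\<close> and \<open>a *\<^sub>R w\<close>.\<close>
    have 2: "a * q' w \<le> q' (a *\<^sub>R w)" if a: "0 < a" for a w
      unfolding q'_def[of "a *\<^sub>R w"]
    proof (rule cInf_greatest[OF ne])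
      fix r assume "r \<in> S (a *\<^sub>R w)"
      then obtain t where t: "0 \<le> t" "r = q (a *\<^sub>R w + t *\<^sub>R v) - t * q v" by (auto simp: S_def)
      have "a *\<^sub>R w + t *\<^sub>R v = a *\<^sub>R (w + (t / a) *\<^sub>R v)"
        using a by (simp add: scaleR_add_right)
      then have "r = a * (q (w + (t / a) *\<^sub>R v) - (t / a) * q v)"
        using t(2) a hom[of a "w + (t / a) *\<^sub>R v"] by (simp add: algebra_simps)
      then show "a * q' w \<le> r" using lower[of "t / a" w] a t(1) by simp
    qed
    have q'0: "q' 0 = 0"
    proof (rule antisym)
      show "q' 0 \<le> 0" using lower[of 0 0] q0 by simp
      show "0 \<le> q' 0" unfolding q'_def by (intro cInf_greatest ne) (use low[of _ 0] q0 in auto)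
    qed
    have 3: "q' (a *\<^sub>R w) = a * q' w" if "0 \<le> a" for a w
    proof (cases "a = 0")
      case False
      then have a: "0 < a" using that by simp
      have "(1 / a) * q' (a *\<^sub>R w) \<le> q' w" using 2[of "1 / a" "a *\<^sub>R w"] a by simp
      then have "q' (a *\<^sub>R w) \<le> a * q' w" using a by (simp add: field_simps)
      then show ?thesis using 2[OF a, of w] by simp
    qed (simp add: q'0)
    have "q' = q" using lower[of 0] by (intro min 1 3) auto
    then show ?thesis using lower[of 1 u] by simp
  qed
  have add: "q (u + v) = q u + q v" for u v using ge sub by (simp add: antisym)
  show ?thesis
  proof (rule linearI[OF add])
    fix a v
    show "q (a *\<^sub>R v) = a *\<^sub>R q v"
    proof (cases "0 \<le> a")
      case False
      then have "q ((- a) *\<^sub>R v) = - a * q v" by (intro hom) simp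
      moreover have "q (a *\<^sub>R v) + q ((- a) *\<^sub>R v) = 0"
        by (simp add: add[symmetric] q0 flip: scaleR_add_left)
      ultimately show ?thesis by simp
    qed (simp add: hom)
  qed
qed

text \<open>Hahn-Banach without a subspace to extend from: a minimal sublinear functional below
  \<open>p\<close>, found by Zorn's lemma for the reversed order, is linear. Every competitor
  satisfies \<open>q v \<ge> - p (- v)\<close>, so infima of chains stay finite.\<close>

theorem sublinear_dominates_linear:
  fixes p :: "'v::real_vector \<Rightarrow> real"
  assumes sub: "\<And>u v. p (u + v) \<le> p u + p v" and hom: "\<And>a v. 0 \<le> a \<Longrightarrow> p (a *\<^sub>R v) = a * p v"
  obtains L where "linear L" "\<And>v. L v \<le> p v"
proof -
  define A where "A = {q. (\<forall>u v. q (u + v) \<le> q u + q v) \<and>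
    (\<forall>a v. 0 \<le> a \<longrightarrow> q (a *\<^sub>R v) = a * q v) \<and> (\<forall>v. q v \<le> p v)}"
  have pA: "p \<in> A" using sub hom by (auto simp: A_def)
  have low: "- p (- v) \<le> q v" if "q \<in> A" for q v
  proof -
    have "q (0 *\<^sub>R v) = 0 * q v" "q (v + - v) \<le> q v + q (- v)" "q (- v) \<le> p (- v)"
      using that unfolding A_def mem_Collect_eq by (blast intro: order_refl)+
    then show ?thesis by simp
  qed
  have "\<exists>m\<in>A. \<forall>a\<in>A. m \<ge> a \<longrightarrow> a = m"
  proof (rule predicate_Zorn)
    show "partial_order_on A (relation_of (\<lambda>x y. x \<ge> y) A)"
      by (auto simp: partial_order_on_def preorder_on_def refl_on_def trans_def antisym_def
          relation_of_def intro: order_trans)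
    fix C assume C: "C \<in> Chains (relation_of (\<lambda>x y. x \<ge> y) A)"
    have CA: "C \<subseteq> A" by (rule Chains_relation_of[OF C])
    have ch: "q \<le> q' \<or> q' \<le> q" if "q \<in> C" "q' \<in> C" for q q'
      using C that by (auto simp: Chains_def relation_of_def)
    show "\<exists>u\<in>A. \<forall>a\<in>C. a \<ge> u"
    proof (cases "C = {}")
      case False
      define u where "u v = (INF q\<in>C. q v)" for v
      have bdd: "bdd_below ((\<lambda>q. q v) ` C)" for v using low CA by (meson bdd_belowI2 subsetD)
      have lower: "u v \<le> q v" if "q \<in> C" for q v
        unfolding u_def using that bdd by (rule cINF_lower[rotated])
      have 1: "u (v + w) \<le> u v + u w" for v w
      proof -
        have "u (v + w) - q v \<le> q' w" if q: "q \<in> C" "q' \<in> C" for q q'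
        proof -
          \<comment> \<open>The infima at \<open>v\<close> and \<open>w\<close> may be approached by
            different members of the chain; the smaller of the two serves for both.\<close>
          obtain r where r: "r \<in> C" "r \<le> q" "r \<le> q'" using ch[OF q] q by blast
          have "r (v + w) \<le> r v + r w" using r(1) CA by (auto simp: A_def)
          then show ?thesis using lower[OF r(1), of "v + w"] r(2,3)[THEN le_funD]
            by (smt (verit))
        qed
        then have "u (v + w) - q v \<le> u w" if "q \<in> C" for q
          unfolding u_def[of w] using that False by (intro cINF_greatest) auto
        then have "u (v + w) - u w \<le> u v"
          unfolding u_def[of v] using False by (intro cINF_greatest) (auto simp: algebra_simps)
        then show ?thesis by simp
      qed
      have 2: "u (a *\<^sub>R v) = a * u v" if a: "0 \<le> a" for a v
      proof (cases "a = 0")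
        case True
        have "q 0 = 0" if "q \<in> C" for q
        proof -
          have "q (0 *\<^sub>R 0) = 0 * q 0" using that CA unfolding A_def by blast
          then show ?thesis by simp
        qed
        then have "u 0 = (INF q\<in>C. 0)" unfolding u_def by (intro INF_cong) auto
        then show ?thesis using True False by simp
      next
        case False': False
        have le: "b * u w \<le> u (b *\<^sub>R w)" if "0 \<le> b" for b w
          unfolding u_def[of "b *\<^sub>R w"]
        proof (rule cINF_greatest[OF False])
          fix q assume "q \<in> C"
          then have "q (b *\<^sub>R w) = b * q w" using CA that by (auto simp: A_def)
          then show "b * u w \<le> q (b *\<^sub>R w)" using lower[OF \<open>q \<in> C\<close>] that by (simp add: mult_left_mono)
        qed
        have "(1 / a) * u (a *\<^sub>R v) \<le> u v" using le[of "1 / a" "a *\<^sub>R v"] a False' by simp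
        then have "u (a *\<^sub>R v) \<le> a * u v" using a False' by (simp add: field_simps)
        then show ?thesis using le[OF a, of v] by simp
      qed
      obtain q where q: "q \<in> C" using False by blast
      have "q v \<le> p v" for v using q CA by (auto simp: A_def)
      then have "u v \<le> p v" for v using lower[OF q] order_trans by blast
      then have "u \<in> A" using 1 2 by (simp add: A_def)
      then show ?thesis using lower by (auto simp: le_fun_def)
    qed (use pA in auto)
  qed
  then obtain m where m: "m \<in> A" "\<And>a. a \<in> A \<Longrightarrow> a \<le> m \<Longrightarrow> a = m" by blast
  have mp: "m v \<le> p v" for v using m(1) by (auto simp: A_def)
  have "linear m"
  proof (rule minimal_sublinear_linear)
    fix q' assume *: "\<And>u v. q' (u + v) \<le> q' u + q' v"
      "\<And>a v. 0 \<le> a \<Longrightarrow> q' (a *\<^sub>R v) = a * q' v" "\<And>v. q' v \<le> m v"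
    have "q' v \<le> p v" for v using *(3) mp order_trans by blast
    then show "q' = m" using * by (intro m(2)) (auto simp: A_def le_fun_def)
  qed (use m(1) in \<open>auto simp: A_def\<close>)
  then show ?thesis using mp that by blast
qed

text \<open>Bounded functions are the bounded continuous functions for the discrete topology, which turns
  them into a vector space type.\<close>

theorem cone_positive_linear_functional:
  fixes Q :: "(('a \<Rightarrow> real) \<times> real) set"
  assumes Qadd: "\<And>v r w s. (v, r) \<in> Q \<Longrightarrow> (w, s) \<in> Q \<Longrightarrow> (\<lambda>z. v z + w z, r + s) \<in> Q"
    and Qscale: "\<And>a v r. 0 \<le> a \<Longrightarrow> (v, r) \<in> Q \<Longrightarrow> (\<lambda>z. a * v z, a * r) \<in> Q"
    and Qone: "(\<lambda>z. 1, 1) \<in> Q"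
    and Qpos: "\<And>v r. (v, r) \<in> Q \<Longrightarrow> (\<And>z. 0 \<le> v z) \<Longrightarrow> 0 \<le> r"
  obtains L :: "('a \<Rightarrow> real) \<Rightarrow> real"
  where "\<And>f g. bounded (range f) \<Longrightarrow> bounded (range g) \<Longrightarrow> L (\<lambda>z. f z + g z) = L f + L g"
    and "\<And>a f. bounded (range f) \<Longrightarrow> L (\<lambda>z. a * f z) = a * L f"
    and "\<And>f g. bounded (range f) \<Longrightarrow> bounded (range g) \<Longrightarrow> (\<And>z. f z \<le> g z) \<Longrightarrow> L f \<le> L g"
    and "\<And>w r. (w, r) \<in> Q \<Longrightarrow> bounded (range w) \<Longrightarrow> L w \<le> r"
proof -
  define F :: "('a discrete \<Rightarrow>\<^sub>C real) \<Rightarrow> 'a \<Rightarrow> real" where "F u z = apply_bcontfun u (discrete z)" for u z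
  define G :: "('a \<Rightarrow> real) \<Rightarrow> 'a discrete \<Rightarrow>\<^sub>C real" where "G f = Bcontfun (\<lambda>z. f (of_discrete z))" for f
  have G: "apply_bcontfun (G f) z = f (of_discrete z)" if "bounded (range f)" for f z
  proof -
    have "(\<lambda>z. f (of_discrete z)) \<in> bcontfun"
      unfolding bcontfun_def using that
      by (auto simp: continuous_on_open_vimage open_discrete intro: bounded_subset)
    then show ?thesis by (simp add: G_def Bcontfun_inverse)
  qed
  have FG: "F (G f) = f" if "bounded (range f)" for f
    using G[OF that] by (simp add: F_def fun_eq_iff discrete_inverse)
  \<comment> \<open>\<open>p u\<close> is a superhedging price: the infimum of the prices of cone
    elements above \<open>u\<close>. Constants, available through \<open>Qone\<close>, bound it from
    above, and \<open>Qpos\<close> bounds it from below.\<close>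
  define S where "S u = {r. \<exists>w. (w, r) \<in> Q \<and> (\<forall>z. F u z \<le> w z)}" for u
  define p where "p u = Inf (S u)" for u
  have const: "(\<lambda>z. b, b) \<in> Q" if "0 \<le> b" for b
    using Qscale[OF that Qone] by simp
  have bd: "\<exists>b\<ge>0. \<forall>z. \<bar>F u z\<bar> \<le> b" for u
  proof -
    obtain b where b: "\<forall>x\<in>range (apply_bcontfun u). norm x \<le> b" using bounded_apply_bcontfun[of u]
      unfolding bounded_iff by blast
    then have "\<bar>F u z\<bar> \<le> b" for z by (auto simp: F_def)
    moreover from this have "0 \<le> b" by (meson abs_ge_zero order_trans)
    ultimately show ?thesis by blast
  qed
  have ne: "S u \<noteq> {}" for u
  proof -
    obtain b where "b \<ge> 0" "\<forall>z. \<bar>F u z\<bar> \<le> b" using bd by blast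
    then have "b \<in> S u"
      using const[of b] by (auto simp: S_def abs_le_iff intro!: exI[of _ "\<lambda>z. b"])
    then show ?thesis by blast
  qed
  have bdd: "bdd_below (S u)" for u
  proof -
    obtain b where b: "b \<ge> 0" "\<forall>z. \<bar>F u z\<bar> \<le> b" using bd by blast
    have "-b \<le> r" if r: "r \<in> S u" for r
    proof -
      obtain w where w: "(w, r) \<in> Q" "\<forall>z. F u z \<le> w z" using r by (auto simp: S_def)
      have "0 \<le> w z + b" for z using w(2)[rule_format, of z] b(2)[rule_format, of z] by linarith
      then have "0 \<le> r + b" using Qpos[OF Qadd[OF w(1) const[OF b(1)]]] by simp
      then show ?thesis by simp
    qed
    then show ?thesis by (meson bdd_below.I)
  qed
  have lower: "p u \<le> r" if "r \<in> S u" for u r unfolding p_def by (rule cInf_lower[OF that bdd])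
  have Sadd: "r + s \<in> S (u + v)" if rs: "r \<in> S u" "s \<in> S v" for r s u v
  proof -
    obtain w w' where "(w, r) \<in> Q" "\<forall>z. F u z \<le> w z" "(w', s) \<in> Q" "\<forall>z. F v z \<le> w' z"
      using rs by (auto simp: S_def)
    then have "(\<lambda>z. w z + w' z, r + s) \<in> Q \<and> (\<forall>z. F (u + v) z \<le> w z + w' z)"
      using Qadd by (auto simp: F_def add_mono)
    then show ?thesis unfolding S_def by blast
  qed
  have Sscale: "a * r \<in> S (a *\<^sub>R u)" if ar: "0 \<le> a" "r \<in> S u" for a r u
  proof -
    obtain w where "(w, r) \<in> Q" "\<forall>z. F u z \<le> w z" using ar by (auto simp: S_def)
    then have "(\<lambda>z. a * w z, a * r) \<in> Q \<and> (\<forall>z. F (a *\<^sub>R u) z \<le> a * w z)"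
      using Qscale ar by (auto simp: F_def mult_left_mono)
    then show ?thesis unfolding S_def by blast
  qed
  have sub: "p (u + v) \<le> p u + p v" for u v
  proof -
    have "p (u + v) - r \<le> p v" if "r \<in> S u" for r
      unfolding p_def[of v]
    proof (rule cInf_greatest[OF ne])
      fix s assume "s \<in> S v"
      from lower[OF Sadd[OF that this]] show "p (u + v) - r \<le> s" by linarith
    qed
    then have "p (u + v) - p v \<le> p u"
      unfolding p_def[of u] by (intro cInf_greatest ne) (simp add: diff_le_eq add.commute)
    then show ?thesis by simp
  qed
  have hom1: "p (a *\<^sub>R u) \<le> a * p u" if a: "0 < a" for a u
  proof -
    have "p (a *\<^sub>R u) / a \<le> p u"
      unfolding p_def[of u] using lower[OF Sscale[of a _ u]] a
      by (intro cInf_greatest ne) (simp add: divide_le_eq mult.commute)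
    then show ?thesis using a by (simp add: divide_le_eq mult.commute)
  qed
  have p0: "p 0 = 0"
  proof (rule antisym)
    show "p 0 \<le> 0" using const[of 0] by (intro lower) (auto simp: S_def F_def)
    show "0 \<le> p 0" unfolding p_def
      by (intro cInf_greatest ne) (auto simp: S_def F_def intro: Qpos)
  qed
  have hom: "p (a *\<^sub>R u) = a * p u" if "0 \<le> a" for a u
  proof (cases "a = 0")
    case False
    then have a: "0 < a" using that by simp
    have "p u \<le> (1 / a) * p (a *\<^sub>R u)" using hom1[of "1 / a" "a *\<^sub>R u"] a by simp
    then have "a * p u \<le> p (a *\<^sub>R u)" using a by (simp add: field_simps)
    then show ?thesis using hom1[OF a, of u] by simp
  qed (simp add: p0)
  obtain L where L: "linear L" "\<And>v. L v \<le> p v" using sublinear_dominates_linear[of p, OF sub hom] by blast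
  have bw: "L (G w) \<le> r" if "(w, r) \<in> Q" "bounded (range w)" for w r
    using L(2)[of "G w"] lower[of r "G w"] that by (fastforce simp: S_def FG)
  have badd: "bounded (range (\<lambda>z. f z + g z))" if "bounded (range f)" "bounded (range g)" for f g :: "'a \<Rightarrow> real"
    using that by (rule bounded_plus_comp)
  have bscale: "bounded (range (\<lambda>z. a * f z))" if "bounded (range f)" for f :: "'a \<Rightarrow> real" and a
    using bounded_scaling[OF that, of a] by (simp add: image_image)
  have Ladd: "L (G (\<lambda>z. f z + g z)) = L (G f) + L (G g)" if "bounded (range f)" "bounded (range g)" for f g
  proof -
    have "G (\<lambda>z. f z + g z) = G f + G g"
      using that badd by (intro bcontfun_eqI) (simp add: G)
    then show ?thesis by (simp add: linear_add[OF L(1)])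
  qed
  have Lscale: "L (G (\<lambda>z. a * f z)) = a * L (G f)" if "bounded (range f)" for a f
  proof -
    have "G (\<lambda>z. a * f z) = a *\<^sub>R G f"
      using that bscale by (intro bcontfun_eqI) (simp add: G)
    then show ?thesis by (simp add: linear_cmul[OF L(1)])
  qed
  show ?thesis
  proof (rule that[of "\<lambda>f. L (G f)", OF Ladd Lscale _ bw])
    fix f g :: "'a \<Rightarrow> real" assume fg: "bounded (range f)" "bounded (range g)" "\<And>z. f z \<le> g z"
    have b: "bounded (range (\<lambda>z. - 1 * g z))" using bscale[OF fg(2)] .
    let ?d = "\<lambda>z. f z + - 1 * g z"
    have "L (G ?d) \<le> p (G ?d)" by (rule L(2))
    \<comment> \<open>The zero function at price 0 lies in \<open>Q\<close> and dominates
      \<open>f - g\<close>; this is where monotonicity comes from.\<close>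
    also have "\<dots> \<le> 0" using const[of 0] fg(3) badd[OF fg(1) b]
      by (intro lower) (auto simp: S_def FG intro!: exI[of _ "\<lambda>z. 0"])
    finally show "L (G f) \<le> L (G g)" using Ladd[OF fg(1) b] Lscale[OF fg(2), of "-1"] by simp
  qed
qed

section \<open>Densities and kernels\<close>

lemma borel_probs_D:
  assumes "\<mu> \<in> borel_probs"
  shows "prob_space \<mu>" "sets \<mu> = sets borel" "space \<mu> = UNIV"
    "f \<in> borel_measurable \<mu> \<longleftrightarrow> f \<in> borel_measurable borel"
  using assms measurable_cong_sets[of \<mu> borel borel borel]
  by (auto simp: borel_probs_def dest: sets_eq_imp_space_eq)

lemma integrable_bounded:
  fixes f :: "'a::topological_space \<Rightarrow> real"
  assumes \<mu>: "\<mu> \<in> borel_probs" and f: "f \<in> borel_measurable borel" "bounded (range f)"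
  shows "integrable \<mu> f"
proof -
  interpret prob_space \<mu> using \<mu> by (rule borel_probs_D)
  obtain K where K: "\<And>x. norm (f x) \<le> K" using f(2) by (auto simp: bounded_iff)
  show ?thesis
    by (rule integrable_const_bound[where B=K]) (use K f \<mu> in \<open>auto simp: borel_probs_D\<close>)
qed

lemma bounded_range_indicator: "bounded (range (indicator B :: 'a \<Rightarrow> real))"
  by (rule boundedI[of _ 1]) (auto simp: indicator_def)

text \<open>Domination by \<open>\<eta>\<close> makes a merely finitely additive functional countably additive, so that
  the Radon-Nikodym theorem applies.\<close>

lemma dominated_functional_density:
  fixes l :: "('e::topological_space \<Rightarrow> real) \<Rightarrow> real"
  assumes \<eta>: "\<eta> \<in> borel_probs"
    and add: "\<And>f g. f \<in> borel_measurable borel \<Longrightarrow> g \<in> borel_measurable borel \<Longrightarrow>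
      bounded (range f) \<Longrightarrow> bounded (range g) \<Longrightarrow> l (\<lambda>x. f x + g x) = l f + l g"
    and scale: "\<And>a f. f \<in> borel_measurable borel \<Longrightarrow> bounded (range f) \<Longrightarrow> l (\<lambda>x. a * f x) = a * l f"
    and pos: "\<And>f. f \<in> borel_measurable borel \<Longrightarrow> bounded (range f) \<Longrightarrow> (\<And>x. 0 \<le> f x) \<Longrightarrow> 0 \<le> l f"
    and dom: "\<And>f. f \<in> borel_measurable borel \<Longrightarrow> bounded (range f) \<Longrightarrow> (\<And>x. 0 \<le> f x) \<Longrightarrow> l f \<le> (\<integral>x. f x \<partial>\<eta>)"
  shows "\<exists>\<theta>\<in>borel_measurable borel. (\<forall>x. 0 \<le> \<theta> x) \<and> integrable \<eta> \<theta> \<and>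
    (\<forall>f\<in>borel_measurable borel. bounded (range f) \<longrightarrow>
      integrable \<eta> (\<lambda>x. f x * \<theta> x) \<and> l f = (\<integral>x. f x * \<theta> x \<partial>\<eta>))"
proof -
  interpret prob_space \<eta> using \<eta> by (rule borel_probs_D)
  note [simp] = borel_probs_D[OF \<eta>]
  have bind: "bounded (range (indicator B :: 'e \<Rightarrow> real))" for B by (rule bounded_range_indicator)
  have bplus: "bounded (range (\<lambda>z. f z + g z))" if "bounded (range f)" "bounded (range g)" for f g :: "'e \<Rightarrow> real"
    using that by (rule bounded_plus_comp)
  have bscale: "bounded (range (\<lambda>z. a * f z))" if "bounded (range f)" for f :: "'e \<Rightarrow> real" and a
    using bounded_scaling[OF that, of a] by (simp add: image_image)
  have diff: "l (\<lambda>x. f x - g x) = l f - l g"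
    if "f \<in> borel_measurable borel" "g \<in> borel_measurable borel" "bounded (range f)" "bounded (range g)" for f g
    using add[of f "\<lambda>x. - 1 * g x"] that scale[of g "-1"] bscale[of g "-1"] by simp
  define N where "N = measure_of UNIV (sets borel) (\<lambda>B. ennreal (l (indicator B)))"
  have nn: "0 \<le> l (indicator B)" if "B \<in> sets borel" for B
    using that by (intro pos bind) auto
  have l_le: "l (indicator B) \<le> prob B" if "B \<in> sets borel" for B
    using dom[of "indicator B"] that bind by simp
  have eN: "emeasure N B = ennreal (l (indicator B))" if "B \<in> sets borel" for B
    unfolding N_def
  proof (rule emeasure_measure_of_sigma)
    show "sigma_algebra UNIV (sets (borel :: 'e measure))"
      using sets.sigma_algebra_axioms[of "borel :: 'e measure"] by simp
    have "l (indicator {}) = 0" using scale[of "indicator {}" 0] bind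
      by (simp add: indicator_def[of "{}", abs_def])
    then show "positive (sets borel) (\<lambda>B. ennreal (l (indicator B)))" by (simp add: positive_def)
    have add': "l (indicator (A \<union> B)) = l (indicator A) + l (indicator B)"
      if "A \<in> sets borel" "B \<in> sets borel" "A \<inter> B = {}" for A B
      using add[of "indicator A" "indicator B"] that bind by (simp add: indicator_add)
    show "countably_additive (sets borel) (\<lambda>B. ennreal (l (indicator B)))"
    proof (rule sets.empty_continuous_imp_countably_additive[of borel, simplified])
      show "positive (sets borel) (\<lambda>B. ennreal (l (indicator B)))" by fact
      show "additive (sets borel) (\<lambda>B. ennreal (l (indicator B)))"
        by (auto simp: additive_def add' nn ennreal_plus)
      fix A :: "nat \<Rightarrow> 'e set" assume A: "range A \<subseteq> sets borel" "decseq A" "(\<Inter>i. A i) = {}"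
      have "(\<lambda>i. prob (A i)) \<longlonglongrightarrow> prob (\<Inter>i. A i)"
        using A by (intro finite_Lim_measure_decseq) auto
      then have "(\<lambda>i. prob (A i)) \<longlonglongrightarrow> 0" using A(3) by simp
      then have "(\<lambda>i. l (indicator (A i))) \<longlonglongrightarrow> 0"
        using A(1) by (intro tendsto_sandwich[of "\<lambda>_. 0" "\<lambda>i. l (indicator (A i))" _ "\<lambda>i. prob (A i)"])
          (auto intro!: always_eventually nn l_le)
      then show "(\<lambda>i. ennreal (l (indicator (A i)))) \<longlonglongrightarrow> 0" by (simp flip: ennreal_0)
    qed auto
    show "B \<in> sets borel" by fact
  qed
  have sN: "sets N = sets \<eta>" unfolding N_def using sets.sigma_sets_eq[of "borel :: 'e measure"] by simp
  have "absolutely_continuous \<eta> N"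
  proof -
    have "emeasure N B = 0" if "B \<in> null_sets \<eta>" for B
    proof -
      have "B \<in> sets borel" "prob B = 0" using that by (auto simp: measure_eq_0_null_sets)
      then show ?thesis using l_le[of B] by (simp add: eN ennreal_neg)
    qed
    then show ?thesis unfolding absolutely_continuous_def using sN by (auto simp: null_sets_def)
  qed
  from Radon_Nikodym[OF this sN] obtain t where t: "t \<in> borel_measurable \<eta>" "density \<eta> t = N" by blast
  have NB: "emeasure N UNIV \<le> 1" using l_le[of UNIV] prob_le_1[of UNIV] by (simp add: eN del: prob_le_1)
  have it: "(\<integral>\<^sup>+x. t x \<partial>\<eta>) \<le> 1"
    using NB emeasure_density[of t \<eta> UNIV] t by simp
  have fin: "AE x in \<eta>. t x \<noteq> \<infinity>"
    using it t(1) by (intro nn_integral_PInf_AE) (auto simp: top_unique)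
  define \<theta> where "\<theta> x = enn2real (t x)" for x
  have tm: "\<theta> \<in> borel_measurable borel" using t(1) unfolding \<theta>_def by simp
  have t\<theta>: "AE x in \<eta>. t x = ennreal (\<theta> x)"
    using fin by eventually_elim (simp add: \<theta>_def less_top)
  have dens: "density \<eta> \<theta> = N" using t t\<theta> tm by (subst t(2)[symmetric]) (rule density_cong, auto)
  have i\<theta>: "integrable \<eta> \<theta>"
  proof (rule integrableI_nonneg)
    have "(\<integral>\<^sup>+x. ennreal (\<theta> x) \<partial>\<eta>) = (\<integral>\<^sup>+x. t x \<partial>\<eta>)" using t\<theta> by (intro nn_integral_cong_AE) auto
    also have "\<dots> < \<infinity>" using it by (metis ennreal_one_less_top infinity_ennreal_def le_less_trans)
    finally show "(\<integral>\<^sup>+x. ennreal (\<theta> x) \<partial>\<eta>) < \<infinity>" .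
  qed (use tm in \<open>auto simp: \<theta>_def\<close>)
  have int: "integrable \<eta> (\<lambda>x. f x * \<theta> x)"
    if f: "f \<in> borel_measurable borel" "bounded (range f)" for f
  proof -
    obtain K where K: "\<And>x. \<bar>f x\<bar> \<le> K" using f(2) by (auto simp: bounded_iff)
    show ?thesis
    proof (rule Bochner_Integration.integrable_bound)
      show "integrable \<eta> (\<lambda>x. K * \<theta> x)" using i\<theta> by simp
      show "AE x in \<eta>. norm (f x * \<theta> x) \<le> norm (K * \<theta> x)"
        using K by (auto simp: abs_mult intro!: mult_right_mono intro: order_trans[OF K abs_ge_self])
    qed (use f tm in auto)
  qed
  have posf: "bounded (range f) \<longrightarrow> l f = (\<integral>x. f x * \<theta> x \<partial>\<eta>)"
    if "f \<in> borel_measurable borel" "\<And>x. 0 \<le> f x" for f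
    using that
  proof (induct rule: borel_measurable_induct_real)
    case (set B)
    have "ennreal (l (indicator B)) = (\<integral>\<^sup>+x. ennreal (\<theta> x) * indicator B x \<partial>\<eta>)"
      using set tm by (simp add: eN[symmetric] dens[symmetric] emeasure_density)
    also have "\<dots> = (\<integral>\<^sup>+x. ennreal (indicator B x * \<theta> x) \<partial>\<eta>)"
      by (intro nn_integral_cong) (auto simp: indicator_def)
    also have "\<dots> = ennreal (\<integral>x. indicator B x * \<theta> x \<partial>\<eta>)"
      using int[of "indicator B"] set bind by (intro nn_integral_eq_integral) (auto simp: \<theta>_def)
    finally show ?case
      using nn set by (subst (asm) ennreal_inj) (auto intro!: integral_nonneg_AE simp: \<theta>_def)
  next
    case (mult u c)
    show ?case
    proof
      assume b: "bounded (range (\<lambda>x. c * u x))"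
      show "l (\<lambda>x. c * u x) = (\<integral>x. c * u x * \<theta> x \<partial>\<eta>)"
      \<comment> \<open>For \<open>c = 0\<close> boundedness of \<open>c * u\<close> says nothing
        about \<open>u\<close>, so the induction hypothesis cannot be applied.\<close>
      proof (cases "c = 0")
        case True
        then show ?thesis using scale[of "\<lambda>x. 0" 0] by simp
      next
        case False
        then have "bounded (range u)" using bscale[OF b, of "1 / c"] by simp
        then show ?thesis using mult scale by (simp add: mult.assoc)
      qed
    qed
  next
    case (add u v)
    show ?case
    proof
      assume b: "bounded (range (\<lambda>x. v x + u x))"
      then obtain K where K: "\<And>x. \<bar>v x + u x\<bar> \<le> K" by (auto simp: bounded_iff)
      then have "\<bar>v x\<bar> \<le> K" "\<bar>u x\<bar> \<le> K" for x using add(2,5)[of x] K[of x] by linarith+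
      then have bu: "bounded (range u)" "bounded (range v)" by (auto simp: bounded_iff)
      then show "l (\<lambda>x. v x + u x) = (\<integral>x. (v x + u x) * \<theta> x \<partial>\<eta>)"
        using add assms(2)[of v u] int[of u] int[of v] by (simp add: distrib_right)
    qed
  next
    case (seq U)
    show ?case
    proof
      assume b: "bounded (range f)"
      have Uu: "U i x \<le> f x" for i x
        using seq(4,5) by (intro incseq_le) (auto simp: incseq_def le_fun_def)
      have bU: "bounded (range (U i))" for i
      proof -
        obtain K where "\<And>x. \<bar>f x\<bar> \<le> K" using b by (auto simp: bounded_iff)
        then have "\<bar>U i x\<bar> \<le> K" for x using Uu[of i x] seq(2)[of i x] by (smt (verit))
        then show ?thesis by (auto simp: bounded_iff)
      qed
      have lim: "(\<lambda>i. U i x) \<longlonglongrightarrow> f x" for x using seq(5) by simp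
      have um: "f \<in> borel_measurable borel" using seq(1) lim by (rule borel_measurable_LIMSEQ_real[rotated])
      have "(\<lambda>i. \<integral>x. U i x * \<theta> x \<partial>\<eta>) \<longlonglongrightarrow> (\<integral>x. f x * \<theta> x \<partial>\<eta>)"
      proof (rule integral_dominated_convergence[where w="\<lambda>x. f x * \<theta> x"])
        show "AE x in \<eta>. (\<lambda>i. U i x * \<theta> x) \<longlonglongrightarrow> f x * \<theta> x" by (intro AE_I2 tendsto_mult_right lim)
        show "AE x in \<eta>. norm (U i x * \<theta> x) \<le> f x * \<theta> x" for i
          using Uu seq(2) by (auto simp: abs_mult \<theta>_def intro!: AE_I2 mult_right_mono)
      qed (use um seq(1) tm int[OF um b] in \<open>simp_all add: borel_measurable_times\<close>)
      \<comment> \<open>Monotone convergence for \<open>l\<close>, which is assumed only finitely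
        additive: \<open>l (f - U i)\<close> lies between 0 and the \<eta>-integral of
        \<open>f - U i\<close>.\<close>
      moreover have "(\<lambda>i. l (U i)) \<longlonglongrightarrow> l f"
      proof -
        have "(\<lambda>i. \<integral>x. U i x \<partial>\<eta>) \<longlonglongrightarrow> (\<integral>x. f x \<partial>\<eta>)"
        proof (rule integral_dominated_convergence[where w=f])
          show "AE x in \<eta>. norm (U i x) \<le> f x" for i using Uu seq(2) by auto
        qed (use um seq(1) lim integrable_bounded[OF \<eta> um b] in simp_all)
        from tendsto_diff[OF tendsto_const[of "\<integral>x. f x \<partial>\<eta>"] this]
        have "(\<lambda>i. (\<integral>x. f x \<partial>\<eta>) - (\<integral>x. U i x \<partial>\<eta>)) \<longlonglongrightarrow> 0" by simp
        moreover have "0 \<le> l f - l (U i)" "l f - l (U i) \<le> (\<integral>x. f x \<partial>\<eta>) - (\<integral>x. U i x \<partial>\<eta>)" for i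
        proof -
          have bd: "bounded (range (\<lambda>x. f x - U i x))"
            using bplus[OF b bscale[OF bU, of "-1"]] by simp
          have m: "(\<lambda>x. f x - U i x) \<in> borel_measurable borel" using um seq(1) by simp
          show "0 \<le> l f - l (U i)"
            using pos[OF m bd] Uu[of i] diff[OF um seq(1) b bU, of i] by simp
          show "l f - l (U i) \<le> (\<integral>x. f x \<partial>\<eta>) - (\<integral>x. U i x \<partial>\<eta>)"
            using dom[OF m bd] Uu[of i] diff[OF um seq(1) b bU, of i]
              integrable_bounded[OF \<eta> um b] integrable_bounded[OF \<eta> seq(1) bU, of i] by simp
        qed
        ultimately have "(\<lambda>i. l f - l (U i)) \<longlonglongrightarrow> 0"
          by (intro tendsto_sandwich[of "\<lambda>_. 0" "\<lambda>i. l f - l (U i)"]) auto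
        then have "(\<lambda>i. l f - (l f - l (U i))) \<longlonglongrightarrow> l f - 0" by (rule tendsto_diff[OF tendsto_const])
        then show ?thesis by simp
      qed
      ultimately show "l f = (\<integral>x. f x * \<theta> x \<partial>\<eta>)"
        using seq(3)[rule_format, OF bU] by (simp add: LIMSEQ_unique)
    qed
  qed
  \<comment> \<open>A bounded function becomes nonnegative after adding its bound \<open>K\<close>;
    the constant is then subtracted again by additivity.\<close>
  have gen: "l f = (\<integral>x. f x * \<theta> x \<partial>\<eta>)" if f: "f \<in> borel_measurable borel" "bounded (range f)" for f
  proof -
    obtain K where K: "\<And>x. \<bar>f x\<bar> \<le> K" using f(2) by (auto simp: bounded_iff)
    have c: "bounded (range (\<lambda>x::'e. K))" by simp
    have fK: "0 \<le> f x + K" for x using K[of x] by linarith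
    have "0 \<le> K" using K[of undefined] by linarith
    then have "l (\<lambda>x. f x + K) = (\<integral>x. (f x + K) * \<theta> x \<partial>\<eta>)" "l (\<lambda>x. K) = (\<integral>x. K * \<theta> x \<partial>\<eta>)"
      using posf[of "\<lambda>x. f x + K"] posf[of "\<lambda>x. K"] f fK bplus[OF f(2) c] by auto
    then show ?thesis
      using add[OF f(1) _ f(2) c] int[OF f] int[OF _ c] by (simp add: distrib_right)
  qed
  have "\<forall>x. 0 \<le> \<theta> x" by (simp add: \<theta>_def)
  then show ?thesis using tm i\<theta> int gen by (intro bexI[of _ \<theta>]) simp_all
qed

section \<open>Compact approximation and regular conditional distributions\<close>

lemma compact_inner_approx:
  fixes \<nu> :: "'s::polish_space measure"
  assumes \<nu>: "\<nu> \<in> borel_probs" and A: "A \<in> sets borel" and e: "0 < e"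
  obtains K where "compact K" "K \<subseteq> A" "measure \<nu> A - measure \<nu> K < e"
proof -
  interpret prob_space \<nu> using \<nu> by (rule borel_probs_D)
  have "emeasure \<nu> (space \<nu>) \<noteq> \<infinity>" by (simp add: emeasure_space_1)
  then have reg: "emeasure \<nu> A = (SUP K\<in>{K. K \<subseteq> A \<and> compact K}. emeasure \<nu> K)"
    using A \<nu> by (intro inner_regular) (auto simp: borel_probs_D)
  show ?thesis
  \<comment> \<open>The split keeps \<open>prob A - e\<close> nonnegative in the second case, where
    \<open>ennreal\<close> would otherwise truncate it to 0.\<close>
  proof (cases "prob A < e")
    case True
    then show ?thesis by (intro that[of "{}"]) auto
  next
    case False
    then have "ennreal (prob A - e) < emeasure \<nu> A"
      using e by (simp add: emeasure_eq_measure ennreal_less_iff)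
    then obtain K where "K \<subseteq> A" "compact K" "ennreal (prob A - e) < emeasure \<nu> K"
      unfolding reg less_SUP_iff by blast
    then show ?thesis using False
      by (intro that[of K]) (auto simp: emeasure_eq_measure ennreal_less_iff)
  qed
qed

text \<open>\<open>\<A> n\<close> consists of the sets decided by the first \<open>n\<close> basis
  sets, encoded by the trace \<open>T n y\<close>. Boolean operations become operations on the
  family \<open>F\<close> of traces, and \<open>\<A> n\<close> is finite because the traces lie in
  \<open>Pow {..<n}\<close>.\<close>

lemma countable_generating_algebra:
  obtains \<A> :: "'s::second_countable_topology set set"
  where "countable \<A>" "algebra UNIV \<A>" "sigma_sets UNIV \<A> = sets borel"
proof -
  obtain B :: "'s set set" where "countable B \<and> topological_basis B"
    using ex_countable_basis ..
  then have B: "countable B" "topological_basis B" by simp_all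
  have Bne: "B \<noteq> {}"
    using topological_basisE[OF B(2) open_UNIV UNIV_I] by (metis empty_iff)
  define U where "U = from_nat_into B"
  have rU: "range U = B" unfolding U_def using B Bne by simp
  define T where "T n y = {i. i < n \<and> y \<in> U i}" for n :: nat and y
  define \<A> where "\<A> n = range (\<lambda>F. {y. T n y \<in> F})" for n
  have A_I: "{y. T n y \<in> F} \<in> \<A> n" for n F by (auto simp: \<A>_def)
  have lift: "A \<in> \<A> m" if A: "A \<in> \<A> n" and "n \<le> m" for A n m
  proof -
    obtain F where F: "A = {y. T n y \<in> F}" using A by (auto simp: \<A>_def)
    have "T m y \<inter> {..<n} = T n y" for y using \<open>n \<le> m\<close> by (auto simp: T_def)
    then have "A = {y. T m y \<in> {J. J \<inter> {..<n} \<in> F}}" by (simp add: F)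
    then show ?thesis using A_I by metis
  qed
  have fin: "finite (\<A> n)" for n
  proof (rule finite_subset)
    have "{y. T n y \<in> F} = {y. T n y \<in> F \<inter> Pow {..<n}}" for F by (auto simp: T_def)
    then show "\<A> n \<subseteq> (\<lambda>F. {y. T n y \<in> F}) ` Pow (Pow {..<n})" unfolding \<A>_def by blast
  qed simp
  have Ub: "U i \<in> sets borel" for i
  proof -
    have "U i \<in> B" using rU by blast
    then show ?thesis using topological_basis_open[OF B(2)] by simp
  qed
  have borel: "A \<in> sets borel" if A: "A \<in> \<A> n" for A n
  proof -
    obtain F where F: "A = {y. T n y \<in> F}" using A by (auto simp: \<A>_def)
    \<comment> \<open>A finite union over the possible traces \<open>J\<close> of their atoms, each
      a finite intersection of basis sets and complements.\<close>
    have "A = (\<Union>J\<in>F \<inter> Pow {..<n}. \<Inter>i\<in>{..<n}. if i \<in> J then U i else - U i)" (is "_ = ?R")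
    proof (intro equalityI subsetI)
      fix y assume "y \<in> A"
      then show "y \<in> ?R" by (intro UN_I[of "T n y"]) (auto simp: F T_def)
    next
      fix y assume "y \<in> ?R"
      then obtain J where J: "J \<in> F" "J \<subseteq> {..<n}" "\<And>i. i < n \<Longrightarrow> y \<in> (if i \<in> J then U i else - U i)"
        by auto
      then have "T n y = J" by (fastforce simp: T_def split: if_splits)
      then show "y \<in> A" using J by (simp add: F)
    qed
    moreover have "(if i \<in> J then U i else - U i) \<in> sets borel" for i J
      using Ub[of i] sets.compl_sets[OF Ub[of i]] by (simp add: Compl_eq_Diff_UNIV)
    then have "?R \<in> sets borel" by (intro sets.finite_UN sets.countable_INT'') auto
    ultimately show ?thesis by simp
  qed
  have "algebra UNIV (\<Union>n. \<A> n)"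
    unfolding algebra_iff_Un
  proof (intro conjI ballI)
    show "{} \<in> (\<Union>n. \<A> n)" using A_I[of 0 "{}"] by auto
    fix a assume "a \<in> (\<Union>n. \<A> n)"
    then obtain n F where F: "a = {y. T n y \<in> F}" by (auto simp: \<A>_def)
    then have "UNIV - a = {y. T n y \<in> - F}" by auto
    then show "UNIV - a \<in> (\<Union>n. \<A> n)" using A_I by (metis UN_I UNIV_I)
    fix b assume "b \<in> (\<Union>n. \<A> n)"
    then obtain m where m: "b \<in> \<A> m" by blast
    have "a \<in> \<A> (max n m)" using lift[OF A_I] F by simp
    moreover have "b \<in> \<A> (max n m)" using lift[OF m] by simp
    ultimately obtain F G where "a = {y. T (max n m) y \<in> F}" "b = {y. T (max n m) y \<in> G}"
      by (auto simp: \<A>_def)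
    then have "a \<union> b = {y. T (max n m) y \<in> F \<union> G}" by auto
    then show "a \<union> b \<in> (\<Union>n. \<A> n)" using A_I by (metis UN_I UNIV_I)
  qed auto
  moreover have "sigma_sets UNIV (\<Union>n. \<A> n) = sets borel"
  proof
    show "sigma_sets UNIV (\<Union>n. \<A> n) \<subseteq> sets borel"
      using sets.sigma_sets_subset[of "\<Union>n. \<A> n" borel] borel by auto
    have "B \<subseteq> (\<Union>n. \<A> n)"
    proof
      fix b assume "b \<in> B"
      then obtain i where "b = U i" using rU by auto
      \<comment> \<open>The trace must run up to \<open>Suc i\<close> to record membership in
        \<open>U i\<close>.\<close>
      then have "b = {y. T (Suc i) y \<in> {J. i \<in> J}}" by (auto simp: T_def)
      then show "b \<in> (\<Union>n. \<A> n)" using A_I by (metis UN_I UNIV_I)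
    qed
    then show "sets borel \<subseteq> sigma_sets UNIV (\<Union>n. \<A> n)"
      unfolding borel_eq_countable_basis[OF B] by (simp add: sigma_sets_mono')
  qed
  moreover have "countable (\<Union>n. \<A> n)" using fin by (simp add: countable_finite)
  ultimately show ?thesis by (intro that)
qed

text \<open>Compactness turns finite additivity into continuity at the empty set. The compacts
  \<open>K A k\<close> need not belong to the algebra, so \<open>f\<close> merely has values there,
  which only \<open>inner\<close> and \<open>subadd\<close> link to the values on the
  algebra.\<close>

lemma compact_approximable_charge_extends:
  fixes f :: "'s::t2_space set \<Rightarrow> real"
  assumes alg: "algebra UNIV \<A>" and gen: "sigma_sets UNIV \<A> = sets borel"
    and nonneg: "\<And>A. A \<in> \<A> \<Longrightarrow> 0 \<le> f A" and one: "f UNIV = 1"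
    and add: "\<And>A B. A \<in> \<A> \<Longrightarrow> B \<in> \<A> \<Longrightarrow> A \<inter> B = {} \<Longrightarrow> f (A \<union> B) = f A + f B"
    and K: "\<And>A k. A \<in> \<A> \<Longrightarrow> compact (K A k)" "\<And>A k. A \<in> \<A> \<Longrightarrow> K A k \<subseteq> A"
    and inner: "\<And>A e. A \<in> \<A> \<Longrightarrow> 0 < e \<Longrightarrow> \<exists>k. f A - f (K A k) < e"
    and subadd: "\<And>T A. finite T \<Longrightarrow> T \<subseteq> UNIV \<times> \<A> \<times> UNIV \<Longrightarrow> A \<in> \<A> \<Longrightarrow> A \<subseteq> (\<Union>(j::nat, C, k::nat)\<in>T. C - K C k)
      \<Longrightarrow> f A \<le> (\<Sum>(j, C, k)\<in>T. f C - f (K C k))"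
  shows "\<exists>M\<in>borel_probs. \<forall>A\<in>\<A>. measure M A = f A"
proof -
  interpret algebra UNIV \<A> by (rule alg)
  have f0: "f {} = 0" using add[of "{}" "{}"] by simp
  have mono: "f A \<le> f B" if "A \<in> \<A>" "B \<in> \<A>" "A \<subseteq> B" for A B
  proof -
    have "f (A \<union> (B - A)) = f A + f (B - A)" using that by (intro add) auto
    moreover have "A \<union> (B - A) = B" using that by auto
    moreover have "B - A \<in> \<A>" using that by (intro Diff)
    ultimately show ?thesis using nonneg[of "B - A"] by simp
  qed
  have "\<exists>\<mu>. (\<forall>s\<in>\<A>. \<mu> s = ennreal (f s)) \<and> measure_space UNIV (sigma_sets UNIV \<A>) \<mu>"
  proof (rule caratheodory_empty_continuous)
    show "positive \<A> (\<lambda>A. ennreal (f A))" by (simp add: positive_def f0)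
    show "additive \<A> (\<lambda>A. ennreal (f A))" by (simp add: additive_def add nonneg)
    fix A :: "nat \<Rightarrow> 's set" assume A: "range A \<subseteq> \<A>" "decseq A" "(\<Inter>i. A i) = {}"
    have A': "A i \<in> \<A>" for i using A by auto
    have small: "\<exists>n. f (A n) < e" if e: "0 < e" for e
    proof -
      \<comment> \<open>Summable tolerances: their total stays below \<open>e / 2\<close>, which
        leaves room for a strict bound by \<open>e\<close>.\<close>
      define d where "d j = e / 2 * (1 / 2) ^ Suc j" for j :: nat
      have "\<exists>k. f (A j) - f (K (A j) k) < d j" for j using e by (intro inner A') (simp add: d_def)
      then obtain k where k: "\<And>j. f (A j) - f (K (A j) (k j)) < d j" by metis
      define C where "C j = K (A j) (k j)" for j
      have C: "compact (C j)" "C j \<subseteq> A j" for j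
        using K(1)[OF A'] K(2)[OF A'] by (simp_all only: C_def)
      \<comment> \<open>The compacts \<open>C j\<close> sit inside the sets \<open>A j\<close> and
        so have empty intersection; finitely many of them already do. A point of \<open>A n\<close>
        then misses some \<open>C j\<close> with \<open>j \<le> n\<close>, and it lies in
        \<open>A j\<close> since the sequence decreases.\<close>
      have "\<exists>I'. finite I' \<and> C 0 \<inter> (\<Inter>j\<in>I'. C j) = {}"
      proof (rule ccontr)
        assume *: "\<nexists>I'. finite I' \<and> C 0 \<inter> (\<Inter>j\<in>I'. C j) = {}"
        have "C 0 \<inter> (\<Inter>j\<in>UNIV. C j) \<noteq> {}"
        proof (rule compact_imp_fip_image)
          show "compact (C 0)" by (rule C(1))
          show "closed (C i)" for i using C(1) by (rule compact_imp_closed)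
          show "C 0 \<inter> (\<Inter>j\<in>I'. C j) \<noteq> {}" if "finite I'" for I' using * that by blast
        qed
        then obtain y where "\<And>j. y \<in> C j" by auto
        then have "y \<in> (\<Inter>i. A i)" using C(2) by (intro INT_I) (rule subsetD)
        then show False using A(3) by simp
      qed
      then obtain I' where I': "finite I'" "C 0 \<inter> (\<Inter>j\<in>I'. C j) = {}" by blast
      define n where "n = Max (insert 0 I')"
      have n: "j \<le> n" if "j \<in> insert 0 I'" for j unfolding n_def using that I'(1) by (intro Max_ge) simp_all
      \<comment> \<open>The index \<open>j\<close> is kept in the triples so that a set repeated in
        the sequence is counted once for each \<open>j\<close>.\<close>
      define T where "T = (\<lambda>j. (j, A j, k j)) ` {..n}"
      have "A n \<subseteq> (\<Union>(j, D, k)\<in>T. D - K D k)"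
      proof
        fix y assume y: "y \<in> A n"
        obtain j where j: "j \<in> insert 0 I'" "y \<notin> C j" using I'(2) by blast
        then have "y \<in> A j" using y n[OF j(1)] A(2) by (auto simp: decseq_def)
        then show "y \<in> (\<Union>(j, D, k)\<in>T. D - K D k)" using j n[OF j(1)] by (auto simp: T_def C_def)
      qed
      then have "f (A n) \<le> (\<Sum>(j, D, k)\<in>T. f D - f (K D k))"
        using A' by (intro subadd) (auto simp: T_def)
      also have "\<dots> = (\<Sum>j\<le>n. f (A j) - f (C j))"
        unfolding T_def by (subst sum.reindex) (auto simp: inj_on_def C_def)
      also have "\<dots> \<le> (\<Sum>j\<le>n. d j)" using k by (intro sum_mono) (simp add: C_def less_imp_le)
      also have "\<dots> = e / 2 * (1 - (1 / 2) ^ Suc n)"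
        unfolding d_def by (induction n) (auto simp: algebra_simps)
      also have "\<dots> \<le> e / 2 * 1" using e by (intro mult_left_mono) auto
      also have "\<dots> < e" using e by simp
      finally show ?thesis by blast
    qed
    have "(\<lambda>i. f (A i)) \<longlonglongrightarrow> 0"
    proof (rule LIMSEQ_I)
      fix e :: real assume "0 < e"
      then obtain n where n: "f (A n) < e" using small by blast
      have "norm (f (A i) - 0) < e" if "n \<le> i" for i
        using mono[of "A i" "A n"] A' nonneg[of "A i"] n A(2) that by (auto simp: decseq_def)
      then show "\<exists>n. \<forall>i\<ge>n. norm (f (A i) - 0) < e" by blast
    qed
    then show "(\<lambda>i. ennreal (f (A i))) \<longlonglongrightarrow> 0" by (simp flip: ennreal_0)
  qed simp
  then obtain \<mu> where \<mu>: "\<And>A. A \<in> \<A> \<Longrightarrow> \<mu> A = ennreal (f A)" "measure_space UNIV (sets borel) \<mu>"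
    by (auto simp: gen)
  define M where "M = measure_of UNIV (sets borel) \<mu>"
  have sM: "sets M = sets borel" "space M = UNIV"
    unfolding M_def using sets.sigma_sets_eq[of "borel :: 's measure"] by simp_all
  have eM: "emeasure M A = \<mu> A" if "A \<in> sets borel" for A
    unfolding M_def using \<mu>(2) that by (intro emeasure_measure_of_sigma) (auto simp: measure_space_def)
  have Ab: "A \<in> sets borel" if "A \<in> \<A>" for A using that gen by blast
  have "prob_space M" by (rule prob_spaceI) (simp add: sM eM \<mu> one)
  then have "M \<in> borel_probs" by (simp add: borel_probs_def sM)
  moreover have "measure M A = f A" if "A \<in> \<A>" for A
    using that by (simp add: measure_def eM Ab \<mu> nonneg)
  ultimately show ?thesis by blast
qed

text \<open>Each identity between densities holds only almost everywhere, with its own null set.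
  Those concerning a countable algebra and countably many chosen compacts hold off a single null
  set, and they suffice for an extension to a measure at each remaining point; the other Borel sets
  are regained by induction.\<close>

lemma kernel_of_densities:
  fixes \<theta> :: "'s::polish_space set \<Rightarrow> 'e::topological_space \<Rightarrow> real"
  assumes \<eta>: "\<eta> \<in> borel_probs" and \<nu>: "\<nu> \<in> borel_probs"
    and meas: "\<And>A. A \<in> sets borel \<Longrightarrow> \<theta> A \<in> borel_measurable borel"
    and int: "\<And>A. A \<in> sets borel \<Longrightarrow> integrable \<eta> (\<theta> A)"
    and nonneg: "\<And>A. A \<in> sets borel \<Longrightarrow> AE x in \<eta>. 0 \<le> \<theta> A x"
    and add: "\<And>A B. A \<in> sets borel \<Longrightarrow> B \<in> sets borel \<Longrightarrow> A \<inter> B = {} \<Longrightarrow>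
      AE x in \<eta>. \<theta> (A \<union> B) x = \<theta> A x + \<theta> B x"
    and one: "AE x in \<eta>. \<theta> UNIV x = 1"
    and total: "\<And>A. A \<in> sets borel \<Longrightarrow> (\<integral>x. \<theta> A x \<partial>\<eta>) = measure \<nu> A"
  obtains \<Theta> where "\<And>x. \<Theta> x \<in> borel_probs" "\<Theta> \<in> borel \<rightarrow>\<^sub>M prob_algebra borel"
    "\<And>A. A \<in> sets borel \<Longrightarrow> AE x in \<eta>. measure (\<Theta> x) A = \<theta> A x"
proof -
  interpret E: prob_space \<eta> using \<eta> by (rule borel_probs_D)
  interpret S: prob_space \<nu> using \<nu> by (rule borel_probs_D)
  have diff: "AE x in \<eta>. \<theta> (A - B) x = \<theta> A x - \<theta> B x"
    if "A \<in> sets borel" "B \<in> sets borel" "B \<subseteq> A" for A B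
  proof -
    have "AE x in \<eta>. \<theta> (B \<union> (A - B)) x = \<theta> B x + \<theta> (A - B) x" using that by (intro add) auto
    moreover have "B \<union> (A - B) = A" using that by blast
    ultimately have "AE x in \<eta>. \<theta> A x = \<theta> B x + \<theta> (A - B) x" by simp
    then show ?thesis by eventually_elim simp
  qed
  have mono: "AE x in \<eta>. \<theta> B x \<le> \<theta> A x" if "A \<in> sets borel" "B \<in> sets borel" "B \<subseteq> A" for A B
    using diff[OF that] nonneg[OF sets.Diff[OF that(1,2)]] by eventually_elim simp
  have zero: "AE x in \<eta>. \<theta> {} x = 0" using add[of "{}" "{}"] by auto
  have subadd: "AE x in \<eta>. \<theta> (\<Union>j\<in>T. D j) x \<le> (\<Sum>j\<in>T. \<theta> (D j) x)"
    if "finite T" "\<And>j. j \<in> T \<Longrightarrow> D j \<in> sets borel" for T :: "'t set" and D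
    using that
  proof (induction T)
    case empty
    from zero show ?case by eventually_elim simp
  next
    case (insert j T)
    let ?V = "\<Union>j\<in>T. D j"
    have V: "?V \<in> sets borel" "D j \<in> sets borel" using insert by (auto intro!: sets.finite_UN)
    have "AE x in \<eta>. \<theta> (D j \<union> (?V - D j)) x = \<theta> (D j) x + \<theta> (?V - D j) x"
      using V by (intro add) auto
    moreover have "AE x in \<eta>. \<theta> (?V - D j) x \<le> \<theta> ?V x" using V by (intro mono) auto
    moreover have "AE x in \<eta>. \<theta> ?V x \<le> (\<Sum>j\<in>T. \<theta> (D j) x)" using insert by auto
    ultimately show ?case by eventually_elim (use insert(1,2) in simp)
  qed
  have finadd: "AE x in \<eta>. \<theta> (\<Union>j<n. D j) x = (\<Sum>j<n. \<theta> (D j) x)"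
    if D: "disjoint_family D" "\<And>j. D j \<in> sets borel" for n :: nat and D
  proof (induction n)
    case 0
    from zero show ?case by eventually_elim simp
  next
    case (Suc n)
    have "AE x in \<eta>. \<theta> ((\<Union>j<n. D j) \<union> D n) x = \<theta> (\<Union>j<n. D j) x + \<theta> (D n) x"
    proof (intro add)
      have "D j \<inter> D n = {}" if "j < n" for j
        using disjoint_family_onD[OF D(1), of j n] that by simp
      then show "(\<Union>j<n. D j) \<inter> D n = {}" by auto
    qed (use D(2) in auto)
    then show ?case using Suc
      by eventually_elim (simp add: lessThan_Suc Un_commute add.commute)
  qed
  obtain \<A> :: "'s set set" where \<A>: "countable \<A>" "algebra UNIV \<A>" "sigma_sets UNIV \<A> = sets borel"
    by (rule countable_generating_algebra)
  interpret algebra UNIV \<A> by (rule \<A>)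
  have Ab: "A \<in> sets borel" if "A \<in> \<A>" for A using that \<A>(3) by blast
  have "\<exists>K. compact K \<and> K \<subseteq> A \<and> measure \<nu> A - measure \<nu> K < (1 / 2) ^ k" if "A \<in> \<A>" for A and k :: nat
    using compact_inner_approx[OF \<nu> Ab[OF that], of "(1 / 2) ^ k"] by (metis zero_less_power half_gt_zero_iff zero_less_one)
  then obtain K where K: "\<And>A k. A \<in> \<A> \<Longrightarrow> compact (K A k)" "\<And>A k. A \<in> \<A> \<Longrightarrow> K A k \<subseteq> A"
    "\<And>A k. A \<in> \<A> \<Longrightarrow> measure \<nu> A - measure \<nu> (K A k) < (1 / 2) ^ k"
    by metis
  have Kb: "K A k \<in> sets borel" if "A \<in> \<A>" for A k using K(1)[OF that] by (simp add: borel_compact)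
  \<comment> \<open>The defects have \<eta>-integral below \<open>(1 / 2) ^ k\<close>, so by
    Markov's inequality the set where all of them are at least \<open>e\<close> has probability at
    most \<open>(1 / 2) ^ k / e\<close>, for every \<open>k\<close>.\<close>
  have inner: "AE x in \<eta>. \<forall>j::nat. \<exists>k. \<theta> A x - \<theta> (K A k) x < inverse (real (Suc j))" if A: "A \<in> \<A>" for A
    unfolding AE_all_countable
  proof
    fix j :: nat
    define e where "e = inverse (real (Suc j))"
    have e: "0 < e" by (simp add: e_def)
    define d where "d k x = \<theta> A x - \<theta> (K A k) x" for k x
    have di: "integrable \<eta> (d k)" for k
      using int[OF Ab[OF A]] int[OF Kb[OF A, of k]] by (simp add: d_def[abs_def])
    note dm = borel_measurable_integrable[OF di] di
    define Z where "Z = {x\<in>space \<eta>. \<forall>k. e \<le> d k x}"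
    have Z: "Z \<in> sets \<eta>" unfolding Z_def using dm by measurable
    have "E.prob Z \<le> (1 / 2) ^ k / e" for k
    proof -
      have nn: "AE x in \<eta>. 0 \<le> d k x" using mono[OF Ab[OF A] Kb[OF A] K(2)[OF A]] by (simp add: d_def)
      have "E.prob Z \<le> E.prob {x\<in>space \<eta>. e \<le> d k x}"
        using dm by (intro E.finite_measure_mono) (auto simp: Z_def)
      also have "\<dots> \<le> (\<integral>x. d k x \<partial>\<eta>) / e" using dm nn e by (intro integral_Markov_inequality_measure[where A="{}"]) auto
      also have "(\<integral>x. d k x \<partial>\<eta>) = measure \<nu> A - measure \<nu> (K A k)"
        unfolding d_def using int[OF Ab[OF A]] int[OF Kb[OF A, of k]] total[OF Ab[OF A]] total[OF Kb[OF A, of k]] by simp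
      finally show ?thesis using K(3)[OF A, of k] e by (smt (verit) divide_right_mono)
    qed
    moreover have "(\<lambda>k. (1 / 2) ^ k / e) \<longlonglongrightarrow> 0 / e" by (intro tendsto_intros LIMSEQ_power_zero) (use e in auto)
    ultimately have "E.prob Z \<le> 0 / e" by (intro LIMSEQ_le_const) auto
    then have "Z \<in> null_sets \<eta>" using Z by (auto simp: measure_le_0_iff E.emeasure_eq_measure)
    then have "AE x in \<eta>. x \<notin> Z" by (rule AE_not_in)
    then show "AE x in \<eta>. \<exists>k. \<theta> A x - \<theta> (K A k) x < inverse (real (Suc j))"
      by (auto simp: Z_def d_def e_def not_le elim!: eventually_rev_mp)
  qed
  \<comment> \<open>There are only countably many finite families of triples, so all their
    subadditivity bounds can share one null set.\<close>
  define TT where "TT = {T. finite T \<and> T \<subseteq> (UNIV::nat set) \<times> \<A> \<times> (UNIV::nat set)}"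
  have cTT: "countable TT"
    unfolding TT_def using \<A>(1) by (intro countable_Collect_finite_subset) auto
  have sub': "AE x in \<eta>. A \<subseteq> (\<Union>(j, C, k)\<in>T. C - K C k) \<longrightarrow> \<theta> A x \<le> (\<Sum>(j, C, k)\<in>T. \<theta> C x - \<theta> (K C k) x)"
    if T: "T \<in> TT" and A: "A \<in> \<A>" for T A
  proof (cases "A \<subseteq> (\<Union>(j, C, k)\<in>T. C - K C k)")
    case True
    define D where "D = (\<lambda>(j::nat, C, k). C - K C k)"
    have T': "finite T" "\<And>j C k. (j, C, k) \<in> T \<Longrightarrow> C \<in> \<A>" using T by (auto simp: TT_def)
    have Db: "D t \<in> sets borel" if "t \<in> T" for t
      using that T'(2) Ab Kb by (auto simp: D_def split: prod.splits)
    have "AE x in \<eta>. \<theta> A x \<le> \<theta> (\<Union>t\<in>T. D t) x"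
      using True T' Db Ab[OF A] by (intro mono sets.finite_UN) (auto simp: D_def)
    moreover have "AE x in \<eta>. \<theta> (\<Union>t\<in>T. D t) x \<le> (\<Sum>t\<in>T. \<theta> (D t) x)"
      using T' Db by (intro subadd) auto
    moreover have "AE x in \<eta>. \<forall>t\<in>T. \<theta> (D t) x = (case t of (j, C, k) \<Rightarrow> \<theta> C x - \<theta> (K C k) x)"
    proof (intro AE_finite_allI T'(1))
      fix t assume t: "t \<in> T"
      obtain j C k where jCk: "t = (j, C, k)" by (cases t)
      have C: "C \<in> \<A>" using T'(2) t jCk by blast
      show "AE x in \<eta>. \<theta> (D t) x = (case t of (j, C, k) \<Rightarrow> \<theta> C x - \<theta> (K C k) x)"
        using diff[OF Ab[OF C] Kb[OF C] K(2)[OF C]] by (simp add: D_def jCk)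
    qed
    ultimately show ?thesis by eventually_elim (auto intro: order_trans)
  qed auto
  define good where "good x \<longleftrightarrow> (\<forall>A\<in>\<A>. 0 \<le> \<theta> A x) \<and> \<theta> UNIV x = 1 \<and>
    (\<forall>A\<in>\<A>. \<forall>B\<in>\<A>. A \<inter> B = {} \<longrightarrow> \<theta> (A \<union> B) x = \<theta> A x + \<theta> B x) \<and>
    (\<forall>A\<in>\<A>. \<forall>j::nat. \<exists>k. \<theta> A x - \<theta> (K A k) x < inverse (real (Suc j))) \<and>
    (\<forall>T\<in>TT. \<forall>A\<in>\<A>. A \<subseteq> (\<Union>(j, C, k)\<in>T. C - K C k) \<longrightarrow> \<theta> A x \<le> (\<Sum>(j, C, k)\<in>T. \<theta> C x - \<theta> (K C k) x))" for x
  have "AE x in \<eta>. good x"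
    unfolding good_def AE_conj_iff AE_ball_countable[OF \<A>(1)] AE_ball_countable[OF cTT]
    using nonneg Ab one inner sub' add by (auto intro: AE_I2)
  then obtain N where N: "{x\<in>space \<eta>. \<not> good x} \<subseteq> N" "N \<in> null_sets \<eta>"
    by (auto simp: eventually_ae_filter)
  have ex: "\<exists>M\<in>borel_probs. \<forall>A\<in>\<A>. measure M A = \<theta> A x" if "x \<notin> N" for x
  proof (rule compact_approximable_charge_extends[OF \<A>(2,3), of _ K])
    have g: "good x" using that N \<eta> by (auto simp: borel_probs_D)
    fix A assume A: "A \<in> \<A>"
    show "0 \<le> \<theta> A x" using g A by (auto simp: good_def)
    show "\<theta> (A \<union> B) x = \<theta> A x + \<theta> B x" if "B \<in> \<A>" "A \<inter> B = {}" for B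
      using g A that by (auto simp: good_def)
    show "\<exists>k. \<theta> A x - \<theta> (K A k) x < e" if e: "0 < e" for e
    proof -
      obtain j where "inverse (real (Suc j)) < e" using reals_Archimedean[OF e] by auto
      then show ?thesis using g A unfolding good_def by (meson less_trans)
    qed
    show "\<theta> A x \<le> (\<Sum>(j, C, k)\<in>T. \<theta> C x - \<theta> (K C k) x)"
      if "finite T" "T \<subseteq> UNIV \<times> \<A> \<times> UNIV" "A \<subseteq> (\<Union>(j::nat, C, k::nat)\<in>T. C - K C k)" for T
      using g A that unfolding good_def TT_def by blast
  next
    show "\<theta> UNIV x = 1" using that N \<eta> by (auto simp: borel_probs_D good_def)
  qed (use K in auto)
  \<comment> \<open>On the null set any fixed Borel probability serves; the constant value
    \<open>\<nu>\<close> keeps the kernel measurable.\<close>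
  define \<Theta> where "\<Theta> x = (if x \<in> N then \<nu> else SOME M. M \<in> borel_probs \<and> (\<forall>A\<in>\<A>. measure M A = \<theta> A x))" for x
  have \<Theta>: "\<Theta> x \<in> borel_probs \<and> (x \<notin> N \<longrightarrow> (\<forall>A\<in>\<A>. measure (\<Theta> x) A = \<theta> A x))" for x
  proof (cases "x \<in> N")
    case False
    from ex[OF this] have "\<exists>M. M \<in> borel_probs \<and> (\<forall>A\<in>\<A>. measure M A = \<theta> A x)" by blast
    from someI_ex[OF this] show ?thesis using False by (simp add: \<Theta>_def)
  qed (simp add: \<Theta>_def \<nu>)
  have P: "prob_space (\<Theta> x)" and sP: "sets (\<Theta> x) = sets borel" "space (\<Theta> x) = UNIV" for x
    using \<Theta>[of x] by (auto simp: borel_probs_D)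
  have Nb: "N \<in> sets borel" using N(2) \<eta> by (auto simp: borel_probs_D)
  have NAE: "AE x in \<eta>. x \<notin> N" using N(2) by (rule AE_not_in)
  have istable: "Int_stable \<A>" by (auto simp: Int_stable_def)
  have kern: "\<Theta> \<in> borel \<rightarrow>\<^sub>M prob_algebra borel"
  proof (rule measurable_prob_algebra_generated[OF _ istable])
    show "sets borel = sigma_sets UNIV \<A>" by (simp add: \<A>(3))
    fix A assume A: "A \<in> \<A>"
    have "emeasure (\<Theta> x) A = ennreal (if x \<in> N then measure \<nu> A else \<theta> A x)" for x
    proof -
      interpret prob_space "\<Theta> x" by (rule P)
      have "x \<in> N \<Longrightarrow> \<Theta> x = \<nu>" by (simp add: \<Theta>_def)
      moreover have "x \<notin> N \<Longrightarrow> measure (\<Theta> x) A = \<theta> A x" using \<Theta>[of x] A by blast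
      ultimately show ?thesis by (simp add: emeasure_eq_measure S.emeasure_eq_measure)
    qed
    moreover have "(\<lambda>x. ennreal (if x \<in> N then measure \<nu> A else \<theta> A x)) \<in> borel_measurable borel"
      using Nb meas[OF Ab[OF A]] by measurable
    ultimately show "(\<lambda>x. emeasure (\<Theta> x) A) \<in> borel_measurable borel" by simp
  qed (use P sP in auto)
  have km: "(\<lambda>x. measure (\<Theta> x) A) \<in> borel_measurable borel" if "A \<in> sets borel" for A
  proof -
    have "(\<lambda>x. emeasure (\<Theta> x) A) \<in> borel_measurable borel"
      using measurable_emeasure_kernel[OF measurable_prob_algebraD[OF kern] that] .
    then show ?thesis unfolding measure_def by simp
  qed
  have kint: "integrable \<eta> (\<lambda>x. measure (\<Theta> x) A)" if "A \<in> sets borel" for A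
    using P prob_space.prob_le_1 by (intro integrable_bounded[OF \<eta> km[OF that]]) (force simp: bounded_iff)
  have subset_Pow_UNIV: "\<A> \<subseteq> Pow UNIV" by simp
  have "AE x in \<eta>. measure (\<Theta> x) A = \<theta> A x" if "A \<in> sets borel" for A
    using istable subset_Pow_UNIV that[folded \<A>(3)]
  proof (induct rule: sigma_sets_induct_disjoint)
    show "AE x in \<eta>. measure (\<Theta> x) A = \<theta> A x" if "A \<in> \<A>" for A using NAE \<Theta> that by auto
    show "AE x in \<eta>. measure (\<Theta> x) {} = \<theta> {} x" using zero by simp
    show "AE x in \<eta>. measure (\<Theta> x) (UNIV - A) = \<theta> (UNIV - A) x"
      if A: "A \<in> sigma_sets UNIV \<A>" and IH: "AE x in \<eta>. measure (\<Theta> x) A = \<theta> A x" for A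
    proof -
      have "measure (\<Theta> x) (UNIV - A) = 1 - measure (\<Theta> x) A" for x
        using prob_space.prob_compl[OF P[of x], of A] A by (simp add: sP \<A>(3))
      then show ?thesis
        using IH diff[of UNIV A] one A by (auto simp: \<A>(3) elim!: eventually_rev_mp)
    qed
    fix D :: "nat \<Rightarrow> 's set"
    assume D: "disjoint_family D" "range D \<subseteq> sigma_sets UNIV \<A>"
      and IH: "\<And>i. AE x in \<eta>. measure (\<Theta> x) (D i) = \<theta> (D i) x"
    have Db: "D i \<in> sets borel" for i using D by (auto simp: \<A>(3))
    define V where "V = (\<Union>i. D i)"
    have Vb: "V \<in> sets borel" using Db by (auto simp: V_def)
    have le: "AE x in \<eta>. (\<Sum>i<n. measure (\<Theta> x) (D i)) \<le> \<theta> V x" for n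
    proof -
      have "AE x in \<eta>. \<theta> (\<Union>j<n. D j) x \<le> \<theta> V x" using Db Vb by (intro mono) (auto simp: V_def)
      moreover have "AE x in \<eta>. \<forall>i\<in>{..<n}. measure (\<Theta> x) (D i) = \<theta> (D i) x"
        using IH by (intro AE_finite_allI) auto
      ultimately show ?thesis using finadd[OF D(1) Db, of n] by eventually_elim simp
    qed
    have sums: "(\<lambda>i. measure M (D i)) sums measure M V" if "M \<in> borel_probs" for M
    proof -
      interpret prob_space M using that by (rule borel_probs_D)
      show ?thesis unfolding V_def using D(1) Db that
        by (intro finite_measure_UNION) (auto simp: borel_probs_D)
    qed
    \<comment> \<open>For a countable union, finite additivity of the densities gives only
      \<open>\<le>\<close> at almost every point. Equality follows because the difference integrates
      to 0, by countable additivity of \<open>\<nu>\<close>.\<close>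
    have "AE x in \<eta>. \<forall>n. (\<Sum>i<n. measure (\<Theta> x) (D i)) \<le> \<theta> V x" using le by (simp add: AE_all_countable)
    then have nn: "AE x in \<eta>. 0 \<le> \<theta> V x - measure (\<Theta> x) V"
    proof eventually_elim
      case (elim x)
      have "measure (\<Theta> x) V \<le> \<theta> V x"
        using sums[of "\<Theta> x"] \<Theta>[of x] elim unfolding sums_def by (intro LIMSEQ_le_const2) auto
      then show ?case by simp
    qed
    have "(\<integral>x. \<theta> V x - measure (\<Theta> x) V \<partial>\<eta>) \<le> measure \<nu> V - (\<Sum>i<n. measure \<nu> (D i))" for n
    proof -
      have "(\<integral>x. \<theta> V x - measure (\<Theta> x) V \<partial>\<eta>) \<le> (\<integral>x. \<theta> V x - (\<Sum>i<n. measure (\<Theta> x) (D i)) \<partial>\<eta>)"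
      proof (rule integral_mono_AE)
        have "(\<Sum>i<n. measure (\<Theta> x) (D i)) \<le> measure (\<Theta> x) V" for x
          using sums[of "\<Theta> x"] \<Theta>[of x] sum_le_suminf[of "\<lambda>i. measure (\<Theta> x) (D i)" "{..<n}"]
          by (simp add: sums_iff)
        then show "AE x in \<eta>. \<theta> V x - measure (\<Theta> x) V \<le> \<theta> V x - (\<Sum>i<n. measure (\<Theta> x) (D i))" by auto
      qed (use int[OF Vb] kint[OF Vb] kint[OF Db] in auto)
      also have "\<dots> = measure \<nu> V - (\<Sum>i<n. (\<integral>x. measure (\<Theta> x) (D i) \<partial>\<eta>))"
        using int[OF Vb] kint[OF Db] total[OF Vb] by simp
      also have "(\<lambda>i. \<integral>x. measure (\<Theta> x) (D i) \<partial>\<eta>) = (\<lambda>i. measure \<nu> (D i))"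
        using integral_cong_AE[OF _ _ IH] km[OF Db] meas[OF Db] total[OF Db] \<eta> by (simp add: borel_probs_D)
      finally show ?thesis .
    qed
    moreover have "(\<lambda>n. measure \<nu> V - (\<Sum>i<n. measure \<nu> (D i))) \<longlonglongrightarrow> measure \<nu> V - measure \<nu> V"
      using sums[OF \<nu>] unfolding sums_def by (intro tendsto_intros)
    ultimately have "(\<integral>x. \<theta> V x - measure (\<Theta> x) V \<partial>\<eta>) \<le> measure \<nu> V - measure \<nu> V"
      by (intro LIMSEQ_le_const) auto
    then have "(\<integral>x. \<theta> V x - measure (\<Theta> x) V \<partial>\<eta>) = 0"
      using integral_nonneg_AE[OF nn] by simp
    then have "AE x in \<eta>. \<theta> V x - measure (\<Theta> x) V = 0"
      using integral_nonneg_eq_0_iff_AE[OF _ nn] int[OF Vb] kint[OF Vb] by simp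
    then show "AE x in \<eta>. measure (\<Theta> x) (\<Union>i. D i) = \<theta> (\<Union>i. D i) x"
      by (auto simp: V_def elim!: eventually_rev_mp)
  qed
  then show ?thesis by (intro that[of \<Theta>] kern) (simp_all add: \<Theta>)
qed

section \<open>Causal test functions\<close>

text \<open>The inf-convolution with \<open>k * dist\<close> is the largest \<open>k\<close>-Lipschitz minorant.\<close>

definition lipschitz_minorant :: "('a::metric_space \<Rightarrow> real) \<Rightarrow> real \<Rightarrow> 'a \<Rightarrow> real" where
  "lipschitz_minorant f k y = (INF z. f z + k * dist y z)"

context
  fixes f :: "'a::metric_space \<Rightarrow> real" and k b :: real
  assumes k: "0 \<le> k" and lower: "\<And>z. - b \<le> f z"
begin

lemma lipschitz_minorant_bdd: "bdd_below (range (\<lambda>z. f z + k * dist y z))"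
proof (rule bdd_belowI2)
  show "- b \<le> f z + k * dist y z" for z
    using lower[of z] mult_nonneg_nonneg[OF k zero_le_dist[of y z]] by linarith
qed

lemma lipschitz_minorant_le_dist: "lipschitz_minorant f k y \<le> f z + k * dist y z"
  unfolding lipschitz_minorant_def by (rule cINF_lower[OF lipschitz_minorant_bdd]) simp

lemma lipschitz_minorant_le: "lipschitz_minorant f k y \<le> f y"
  using lipschitz_minorant_le_dist[of y y] by simp

text \<open>Points within distance \<open>r\<close> are covered by \<open>near\<close>; beyond it
  the penalty, at least \<open>k * r\<close>, makes up for \<open>f\<close> being as low as
  \<open>- b\<close>.\<close>

lemma lipschitz_minorant_ge:
  assumes near: "\<And>z. dist y z < r \<Longrightarrow> a \<le> f z + k * dist y z" and far: "a + b \<le> k * r"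
  shows "a \<le> lipschitz_minorant f k y"
  unfolding lipschitz_minorant_def
proof (rule cINF_greatest)
  fix z
  show "a \<le> f z + k * dist y z"
  proof (cases "dist y z < r")
    case False
    then have "k * r \<le> k * dist y z" using k by (intro mult_left_mono) auto
    then show ?thesis using far lower[of z] by linarith
  qed (rule near)
qed simp

lemma lipschitz_minorant_lower: "- b \<le> lipschitz_minorant f k y"
  \<comment> \<open>With radius 0 no point is near, and only the global lower bound of
    \<open>f\<close> is used.\<close>
  by (rule lipschitz_minorant_ge[of y 0]) simp_all

lemma lipschitz_minorant_lipschitz: "\<bar>lipschitz_minorant f k y - lipschitz_minorant f k z\<bar> \<le> k * dist y z"
proof -
  have *: "lipschitz_minorant f k y - k * dist y z \<le> lipschitz_minorant f k z" for y z
  proof -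
    have "lipschitz_minorant f k y - k * dist y z \<le> f w + k * dist z w" for w
      using lipschitz_minorant_le_dist[of y w] mult_left_mono[OF dist_triangle[of y w z] k]
      by (simp add: algebra_simps)
    then show ?thesis unfolding lipschitz_minorant_def[of f k z] by (intro cINF_greatest) auto
  qed
  show ?thesis using *[of y z] *[of z y] by (auto simp: abs_le_iff dist_commute)
qed

lemma lipschitz_minorant_continuous: "continuous_on UNIV (lipschitz_minorant f k)"
proof (rule lipschitz_on_continuous_on)
  show "k-lipschitz_on UNIV (lipschitz_minorant f k)"
    using lipschitz_minorant_lipschitz k by (intro lipschitz_onI) (auto simp: dist_real_def)
qed

end

section \<open>Integrals of rectangle functions under plans and kernels\<close>

lemma bounded_indicator_times:
  fixes f :: "'a \<Rightarrow> real"
  assumes "bounded (range f)"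
  shows "bounded (range (\<lambda>z. f (u z) * indicator A (v z)))"
proof -
  obtain K where K: "\<And>x. \<bar>f x\<bar> \<le> K" using assms by (auto simp: bounded_iff)
  have "\<bar>f (u z) * indicator A (v z)\<bar> \<le> K" for z
    using K[of "u z"] order_trans[OF abs_ge_zero K] by (simp add: indicator_def)
  then show ?thesis by (intro boundedI[of _ K]) auto
qed

lemma bounded_compose: "bounded (range f) \<Longrightarrow> bounded (range (\<lambda>x. f (g x)))"
  by (erule bounded_subset) auto

lemma borel_measurable_fst: "fst \<in> borel_measurable (borel :: ('a::topological_space \<times> 'b::topological_space) measure)"
  by (intro borel_measurable_continuous_onI continuous_on_fst continuous_on_id)

lemma borel_measurable_snd: "snd \<in> borel_measurable (borel :: ('a::topological_space \<times> 'b::topological_space) measure)"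
  by (intro borel_measurable_continuous_onI continuous_on_snd continuous_on_id)

lemma borel_measurable_rectangle:
  fixes f :: "'e::topological_space \<Rightarrow> real"
  assumes "f \<in> borel_measurable borel" "A \<in> sets borel"
  shows "(\<lambda>z. f (fst z) * indicator A (snd z)) \<in> borel_measurable (borel :: ('e \<times> 's::topological_space) measure)"
  using measurable_compose[OF borel_measurable_fst assms(1)]
    measurable_compose[OF borel_measurable_snd borel_measurable_indicator[OF assms(2)]]
  by (rule borel_measurable_times)

lemma transference_plans_D:
  fixes f :: "'e::topological_space \<Rightarrow> real" and g :: "'s::topological_space \<Rightarrow> real"
  assumes "\<gamma> \<in> transference_plans \<eta> \<nu>"
  shows "\<gamma> \<in> borel_probs"
    and "f \<in> borel_measurable borel \<Longrightarrow> (\<integral>z. f (fst z) \<partial>\<gamma>) = (\<integral>x. f x \<partial>\<eta>)"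
    and "g \<in> borel_measurable borel \<Longrightarrow> (\<integral>z. g (snd z) \<partial>\<gamma>) = (\<integral>y. g y \<partial>\<nu>)"
proof -
  show \<gamma>: "\<gamma> \<in> borel_probs" using assms by (simp add: transference_plans_def)
  have d: "distr \<gamma> borel fst = \<eta>" "distr \<gamma> borel snd = \<nu>" using assms by (auto simp: transference_plans_def)
  have m: "fst \<in> \<gamma> \<rightarrow>\<^sub>M borel" "snd \<in> \<gamma> \<rightarrow>\<^sub>M borel"
    using borel_measurable_fst borel_measurable_snd borel_probs_D(2)[OF \<gamma>] measurable_cong_sets by blast+
  show "(\<integral>z. f (fst z) \<partial>\<gamma>) = (\<integral>x. f x \<partial>\<eta>)" if "f \<in> borel_measurable borel"
    unfolding d(1)[symmetric] using m(1) that by (rule integral_distr[symmetric])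
  show "(\<integral>z. g (snd z) \<partial>\<gamma>) = (\<integral>y. g y \<partial>\<nu>)" if "g \<in> borel_measurable borel"
    unfolding d(2)[symmetric] using m(2) that by (rule integral_distr[symmetric])
qed

text \<open>\<open>is_kernel\<close> tests only rectangles. The left-hand side has an \<eta>-density
  in \<open>f\<close> by \<open>dominated_functional_density\<close>; comparing set integrals
  identifies this density with the kernel, and the passage from sets to functions is not
  repeated.\<close>

lemma integral_kernel:
  fixes f :: "'e::topological_space \<Rightarrow> real" and \<gamma> :: "('e \<times> 's::topological_space) measure"
  assumes \<eta>: "\<eta> \<in> borel_probs" and \<gamma>: "\<gamma> \<in> transference_plans \<eta> \<nu>" and K: "is_kernel \<eta> \<gamma> \<Theta>"
    and f: "f \<in> borel_measurable borel" "bounded (range f)" and A: "A \<in> sets borel"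
  shows "(\<integral>z. f (fst z) * indicator A (snd z) \<partial>\<gamma>) = (\<integral>x. f x * measure (\<Theta> x) A \<partial>\<eta>)"
proof -
  have \<gamma>': "\<gamma> \<in> borel_probs" using \<gamma> by (rule transference_plans_D)
  define l where "l f = (\<integral>z. f (fst z) * indicator A (snd z) \<partial>\<gamma>)" for f :: "'e \<Rightarrow> real"
  have int: "integrable \<gamma> (\<lambda>z. f (fst z) * indicator A (snd z))"
    if "f \<in> borel_measurable borel" "bounded (range f)" for f :: "'e \<Rightarrow> real"
    using borel_measurable_rectangle[OF that(1) A] bounded_indicator_times[OF that(2)]
    by (rule integrable_bounded[OF \<gamma>'])
  have l_add: "l (\<lambda>x. f x + g x) = l f + l g"
    if "f \<in> borel_measurable borel" "g \<in> borel_measurable borel" "bounded (range f)" "bounded (range g)" for f g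
    using int[OF that(1,3)] int[OF that(2,4)] by (simp add: l_def distrib_right)
  have l_scale: "l (\<lambda>x. a * f x) = a * l f" for a f by (simp add: l_def mult.assoc)
  have l_pos: "0 \<le> l f" if "\<And>x. 0 \<le> f x" for f using that by (simp add: l_def)
  have l_dom: "l f \<le> (\<integral>x. f x \<partial>\<eta>)"
    if f: "f \<in> borel_measurable borel" "bounded (range f)" and pos: "\<And>x. 0 \<le> f x" for f
  proof -
    have "l f \<le> (\<integral>z. f (fst z) \<partial>\<gamma>)"
      unfolding l_def using int[OF f] integrable_bounded[OF \<gamma>' measurable_compose[OF borel_measurable_fst f(1)] bounded_compose[OF f(2)]]
      by (rule integral_mono) (simp add: pos indicator_def)
    then show ?thesis using transference_plans_D(2)[OF \<gamma> f(1)] by simp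
  qed
  have "\<exists>\<theta>\<in>borel_measurable borel. (\<forall>x. 0 \<le> \<theta> x) \<and> integrable \<eta> \<theta> \<and>
    (\<forall>f\<in>borel_measurable borel. bounded (range f) \<longrightarrow>
      integrable \<eta> (\<lambda>x. f x * \<theta> x) \<and> l f = (\<integral>x. f x * \<theta> x \<partial>\<eta>))"
    by (intro dominated_functional_density \<eta> l_add l_scale l_pos l_dom) simp_all
  then obtain \<theta> where \<theta>: "\<theta> \<in> borel_measurable borel" "integrable \<eta> \<theta>"
    "\<forall>f\<in>borel_measurable borel. bounded (range f) \<longrightarrow>
      integrable \<eta> (\<lambda>x. f x * \<theta> x) \<and> l f = (\<integral>x. f x * \<theta> x \<partial>\<eta>)"
    by (elim bexE conjE)
  have km: "(\<lambda>x. measure (\<Theta> x) A) \<in> borel_measurable borel" using K A by (simp add: is_kernel_def)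
  have kb: "bounded (range (\<lambda>x. measure (\<Theta> x) A))"
    using K by (intro boundedI[of _ 1]) (auto simp: is_kernel_def borel_probs_def prob_space.prob_le_1)
  have "AE x in \<eta>. \<theta> x = measure (\<Theta> x) A"
  proof (rule density_unique_real[OF \<theta>(2) integrable_bounded[OF \<eta> km kb]])
    fix B assume "B \<in> sets \<eta>"
    then have B: "B \<in> sets borel" using \<eta> by (simp add: borel_probs_D)
    have "(LINT x:B|\<eta>. \<theta> x) = l (indicator B)"
      using \<theta>(3)[rule_format, OF borel_measurable_indicator[OF B] bounded_range_indicator]
      by (simp add: set_lebesgue_integral_def)
    also have "\<dots> = (\<integral>z. indicator (B \<times> A) z \<partial>\<gamma>)"
      unfolding l_def by (intro Bochner_Integration.integral_cong) (auto simp: indicator_def)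
    also have "\<dots> = measure \<gamma> (B \<times> A)" using \<gamma>' by (simp add: borel_probs_D)
    also have "\<dots> = (LINT x:B|\<eta>. measure (\<Theta> x) A)" using K A B by (simp add: is_kernel_def)
    finally show "(LINT x:B|\<eta>. \<theta> x) = (LINT x:B|\<eta>. measure (\<Theta> x) A)" .
  qed
  then have "(\<integral>x. f x * \<theta> x \<partial>\<eta>) = (\<integral>x. f x * measure (\<Theta> x) A \<partial>\<eta>)"
    using \<eta> f(1) \<theta>(1) km by (intro integral_cong_AE) (auto simp: borel_probs_D)
  then show ?thesis using \<theta>(3) f by (simp add: l_def)
qed

section \<open>Residuals of conditional expectations on completed fields\<close>

lemma sigma_finite_subalgebra_completed:
  assumes \<eta>: "\<eta> \<in> borel_probs" and G: "subalgebra borel G"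
  shows "sigma_finite_subalgebra (completion \<eta>) (completed \<eta> G)"
proof -
  interpret prob_space \<eta> using \<eta> by (rule borel_probs_D)
  have "subalgebra (completion \<eta>) (completed \<eta> G)"
    using G \<eta> by (intro subalgebra_completed) (auto simp: subalgebra_def borel_probs_D)
  moreover have "prob_space (completion \<eta>)" by (rule prob_space_completion)
  ultimately interpret finite_measure_subalgebra "completion \<eta>" "completed \<eta> G"
    by (simp add: finite_measure_subalgebra_def finite_measure_subalgebra_axioms_def prob_space.finite_measure)
  show ?thesis by unfold_locales
qed

lemma integrable_completion_bounded:
  fixes f :: "'a::topological_space \<Rightarrow> real"
  assumes \<eta>: "\<eta> \<in> borel_probs" and f: "f \<in> borel_measurable (completion \<eta>)" "AE x in \<eta>. \<bar>f x\<bar> \<le> K"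
  shows "integrable (completion \<eta>) f"
proof -
  interpret prob_space \<eta> using \<eta> by (rule borel_probs_D)
  interpret C: prob_space "completion \<eta>" by (rule prob_space_completion)
  show ?thesis
    by (rule C.integrable_const_bound[where B=K]) (use f in \<open>auto simp: AE_completion_iff\<close>)
qed

text \<open>Pull-out property: a bounded factor measurable for the completed field has the same
  integral against \<open>X\<close> as against its conditional expectation. With \<theta> the mass
  that a causal kernel gives to a set, this makes test functions integrate to zero.\<close>

lemma cond_exp_residual_orthogonal:
  fixes \<theta> :: "'e::topological_space \<Rightarrow> real"
  assumes \<eta>: "\<eta> \<in> borel_probs" and G: "subalgebra borel G"
    and X: "X \<in> borel_measurable borel" "AE x in \<eta>. \<bar>X x\<bar> \<le> K"
    and g: "g \<in> borel_measurable borel"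
      "AE x in \<eta>. g x = X x - real_cond_exp (completion \<eta>) (completed \<eta> G) X x"
    and \<theta>: "\<theta> \<in> borel_measurable (completed \<eta> G)" "\<theta> \<in> borel_measurable borel" "bounded (range \<theta>)"
  shows "(\<integral>x. g x * \<theta> x \<partial>\<eta>) = 0"
proof -
  interpret sigma_finite_subalgebra "completion \<eta>" "completed \<eta> G"
    using \<eta> G by (rule sigma_finite_subalgebra_completed)
  have bm: "f \<in> borel_measurable (completion \<eta>)" if "f \<in> borel_measurable borel" for f :: "'e \<Rightarrow> real"
    using that \<eta> by (intro measurable_completion) (simp add: borel_probs_D)
  let ?E = "real_cond_exp (completion \<eta>) (completed \<eta> G) X"
  obtain K' where K': "\<And>x. \<bar>\<theta> x\<bar> \<le> K'" using \<theta>(3) by (auto simp: bounded_iff)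
  have i: "integrable (completion \<eta>) (\<lambda>x. \<theta> x * X x)"
  proof (rule integrable_completion_bounded[OF \<eta>])
    show "AE x in \<eta>. \<bar>\<theta> x * X x\<bar> \<le> K' * K"
      using X(2) by eventually_elim (use K' in \<open>auto simp: abs_mult intro!: mult_mono order_trans[OF abs_ge_zero K']\<close>)
  qed (use bm[OF \<theta>(2)] bm[OF X(1)] in simp)
  have "(\<integral>x. g x * \<theta> x \<partial>\<eta>) = (\<integral>x. g x * \<theta> x \<partial>completion \<eta>)"
    using g(1) \<theta>(2) \<eta> by (intro integral_completion[symmetric]) (auto simp: borel_probs_D)
  also have "\<dots> = (\<integral>x. \<theta> x * X x - \<theta> x * ?E x \<partial>completion \<eta>)"
  proof (rule integral_cong_AE)
    show "AE x in completion \<eta>. g x * \<theta> x = \<theta> x * X x - \<theta> x * ?E x"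
      using AE_completion[OF g(2)] by eventually_elim (simp add: right_diff_distrib mult.commute)
  qed (use bm[OF g(1)] bm[OF \<theta>(2)] bm[OF X(1)] in simp_all)
  also have "\<dots> = (\<integral>x. \<theta> x * X x \<partial>completion \<eta>) - (\<integral>x. \<theta> x * ?E x \<partial>completion \<eta>)"
    using real_cond_exp_intg(1)[OF i \<theta>(1) bm[OF X(1)]] i by simp
  also have "\<dots> = 0" using real_cond_exp_intg(2)[OF i \<theta>(1) bm[OF X(1)]] by simp
  finally show ?thesis .
qed

text \<open>The conditional expectation is measurable only for the completion and bounded only
  almost everywhere, whereas test functions require bounded Borel factors. A Borel version truncated
  to \<open>[-K, K]\<close> repairs both.\<close>

lemma cond_exp_residual_exists:
  fixes X :: "'e::topological_space \<Rightarrow> real"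
  assumes \<eta>: "\<eta> \<in> borel_probs" and G: "subalgebra borel G"
    and X: "X \<in> borel_measurable borel" "bounded (range X)"
  obtains g where "g \<in> borel_measurable borel" "bounded (range g)"
    "AE x in \<eta>. g x = X x - real_cond_exp (completion \<eta>) (completed \<eta> G) X x"
proof -
  interpret sigma_finite_subalgebra "completion \<eta>" "completed \<eta> G"
    using \<eta> G by (rule sigma_finite_subalgebra_completed)
  let ?E = "real_cond_exp (completion \<eta>) (completed \<eta> G) X"
  obtain K where K: "\<And>x. \<bar>X x\<bar> \<le> K" using X(2) by (auto simp: bounded_iff)
  have Xm: "X \<in> borel_measurable (completion \<eta>)"
    using X(1) \<eta> by (intro measurable_completion) (simp add: borel_probs_D)
  have iX: "integrable (completion \<eta>) X"
    using K by (intro integrable_completion_bounded[OF \<eta> Xm, of K]) auto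
  have b: "AE x in \<eta>. ?E x \<le> K" "AE x in \<eta>. - K \<le> ?E x"
    using real_cond_exp_le_c[OF iX, of K] real_cond_exp_ge_c[OF iX, of "-K"] K
    by (auto simp: AE_completion_iff abs_le_iff minus_le_iff)
  obtain e where e: "e \<in> borel_measurable \<eta>" "AE x in \<eta>. ?E x = e x"
    using completion_ex_borel_measurable_real[of ?E \<eta>] by auto
  define g where "g x = X x - max (- K) (min K (e x))" for x
  have "g \<in> borel_measurable borel" using X(1) e(1) \<eta> by (simp add: g_def[abs_def] borel_probs_D)
  moreover have "bounded (range g)"
  proof (rule boundedI)
    fix y assume "y \<in> range g"
    then obtain x where "y = g x" by auto
    then show "norm y \<le> 2 * K" using K[of x] by (auto simp: g_def)
  qed
  moreover have "AE x in \<eta>. g x = X x - ?E x" using b e(2) by eventually_elim (auto simp: g_def)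
  ultimately show ?thesis by (rule that)
qed

section \<open>The vector space of test functions\<close>

locale causal_problem =
  fixes I :: "'i::linorder set"
    and BE :: "'i \<Rightarrow> 'e::polish_space measure"
    and BS :: "'i \<Rightarrow> 's::polish_space measure"
    and c :: "'e \<times> 's \<Rightarrow> ereal"
    and \<eta> :: "'e measure" and \<nu> :: "'s measure"
  assumes BE: "borel_filtration I BE" and BS: "borel_filtration I BS"
    and c_nonneg: "\<And>z. 0 \<le> c z" and c_lsc: "lower_semicont c"
    and \<eta>: "\<eta> \<in> borel_probs" and \<nu>: "\<nu> \<in> borel_probs"
begin

text \<open>The condition on a single summand of a test function, with the time index hidden under
  the quantifier. Sums and multiples of test functions can then be formed without carrying a family
  of indices.\<close>

definition causal_pair :: "('e \<Rightarrow> real) \<Rightarrow> 's set \<Rightarrow> bool" where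
  "causal_pair g A \<longleftrightarrow> (\<exists>t \<in> insert None (Some ` I).
     A \<in> sets (extended_filtration BS t) \<and> emeasure \<nu> (frontier A) = 0 \<and>
     g \<in> borel_measurable borel \<and> bounded (range g) \<and>
     (\<exists>X \<in> borel_measurable borel. (\<exists>K. AE x in \<eta>. \<bar>X x\<bar> \<le> K) \<and>
        (AE x in \<eta>. g x = X x -
           real_cond_exp (completion \<eta>) (completed \<eta> (extended_filtration BE t)) X x)))"

abbreviation test_functions :: "('e \<times> 's \<Rightarrow> real) set" where
  "test_functions \<equiv> causal_test_functions I BE BS \<eta> \<nu>"

lemma subalgebra_extended:
  assumes "t \<in> insert None (Some ` I)"
  shows "subalgebra borel (extended_filtration BE t)" "subalgebra borel (extended_filtration BS t)"
proof -
  have "subalgebra borel (extended_filtration F t)" if "borel_filtration I F" for F :: "'i \<Rightarrow> 'z::topological_space measure"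
  proof (cases t)
    case None
    then show ?thesis by (auto simp: extended_filtration_def subalgebra_def sigma_sets_empty_eq)
  next
    case (Some s)
    then have "s \<in> I" using assms by auto
    then show ?thesis using that Some by (simp add: extended_filtration_def borel_filtration_def)
  qed
  from this[OF BE] this[OF BS]
  show "subalgebra borel (extended_filtration BE t)" "subalgebra borel (extended_filtration BS t)" .
qed

lemma causal_pair_D:
  assumes "causal_pair g A"
  shows "A \<in> sets borel" "emeasure \<nu> (frontier A) = 0" "g \<in> borel_measurable borel" "bounded (range g)"
  using assms subalgebra_extended(2) unfolding causal_pair_def subalgebra_def by blast+

lemma causal_pair_scale:
  assumes "causal_pair g A"
  shows "causal_pair (\<lambda>x. a * g x) A"
proof -
  obtain t X K where t: "t \<in> insert None (Some ` I)" "A \<in> sets (extended_filtration BS t)"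
    and X: "X \<in> borel_measurable borel" "AE x in \<eta>. \<bar>X x\<bar> \<le> K"
    and g: "AE x in \<eta>. g x = X x - real_cond_exp (completion \<eta>) (completed \<eta> (extended_filtration BE t)) X x"
    using assms unfolding causal_pair_def by auto
  interpret sigma_finite_subalgebra "completion \<eta>" "completed \<eta> (extended_filtration BE t)"
    using \<eta> subalgebra_extended(1)[OF t(1)] by (rule sigma_finite_subalgebra_completed)
  have iX: "integrable (completion \<eta>) X"
    using X \<eta> by (intro integrable_completion_bounded[OF \<eta>] measurable_completion) (auto simp: borel_probs_D)
  have "AE x in \<eta>. real_cond_exp (completion \<eta>) (completed \<eta> (extended_filtration BE t)) (\<lambda>x. a * X x) x =
      a * real_cond_exp (completion \<eta>) (completed \<eta> (extended_filtration BE t)) X x"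
    using real_cond_exp_cmult[OF iX, of a] by (simp add: AE_completion_iff)
  with g have g': "AE x in \<eta>. a * g x = a * X x -
      real_cond_exp (completion \<eta>) (completed \<eta> (extended_filtration BE t)) (\<lambda>x. a * X x) x"
    by eventually_elim (simp add: right_diff_distrib)
  have X': "AE x in \<eta>. \<bar>a * X x\<bar> \<le> \<bar>a\<bar> * K"
    using X(2) by eventually_elim (simp add: abs_mult mult_left_mono)
  have "bounded (range (\<lambda>x. a * g x))"
    using bounded_scaling[OF causal_pair_D(4)[OF assms], of a] by (simp add: image_image)
  moreover have "(\<lambda>x. a * g x) \<in> borel_measurable borel" "(\<lambda>x. a * X x) \<in> borel_measurable borel"
    using causal_pair_D(3)[OF assms] X(1) by auto
  ultimately show ?thesis
    unfolding causal_pair_def using t X' g' causal_pair_D(2)[OF assms]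
    by (intro bexI[of _ t] conjI bexI[of _ "\<lambda>x. a * X x"] exI[of _ "\<bar>a\<bar> * K"])
qed

lemma test_functions_iff:
  "h \<in> test_functions \<longleftrightarrow>
    (\<exists>N (g :: nat \<Rightarrow> 'e \<Rightarrow> real) A. (\<forall>x y. h (x, y) = (\<Sum>i=1..N. g i x * indicator (A i) y)) \<and>
      (\<forall>i\<in>{1..N}. causal_pair (g i) (A i)))"  (is "_ \<longleftrightarrow> ?R")
proof
  assume "h \<in> test_functions"
  then obtain N :: nat and g A t where "\<forall>x y. h (x, y) = (\<Sum>i=1..N. g i x * indicator (A i) y)"
    "\<forall>i\<in>{1..N}. t i \<in> insert None (Some ` I) \<and>
             A i \<in> sets (extended_filtration BS (t i)) \<and>
             emeasure \<nu> (frontier (A i)) = 0 \<and>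
             g i \<in> borel_measurable borel \<and> bounded (range (g i)) \<and>
             (\<exists>X \<in> borel_measurable borel. (\<exists>K. AE x in \<eta>. \<bar>X x\<bar> \<le> K) \<and>
                (AE x in \<eta>. g i x = X x -
                   real_cond_exp (completion \<eta>)
                     (completed \<eta> (extended_filtration BE (t i))) X x))"
    unfolding causal_test_functions_def mem_Collect_eq by (elim conjE exE)
  then have "(\<forall>x y. h (x, y) = (\<Sum>i=1..N. g i x * indicator (A i) y)) \<and>
      (\<forall>i\<in>{1..N}. causal_pair (g i) (A i))"
    unfolding causal_pair_def by blast
  then show ?R by blast
next
  assume ?R
  then obtain N :: nat and g A where h: "\<And>x y. h (x, y) = (\<Sum>i=1..N. g i x * indicator (A i) y)"
    and p: "\<And>i. i \<in> {1..N} \<Longrightarrow> causal_pair (g i) (A i)" by blast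
  have "\<exists>t. \<forall>i\<in>{1..N}. t i \<in> insert None (Some ` I) \<and>
             A i \<in> sets (extended_filtration BS (t i)) \<and>
             emeasure \<nu> (frontier (A i)) = 0 \<and>
             g i \<in> borel_measurable borel \<and> bounded (range (g i)) \<and>
             (\<exists>X \<in> borel_measurable borel. (\<exists>K. AE x in \<eta>. \<bar>X x\<bar> \<le> K) \<and>
                (AE x in \<eta>. g i x = X x -
                   real_cond_exp (completion \<eta>)
                     (completed \<eta> (extended_filtration BE (t i))) X x))"
    using p unfolding causal_pair_def by (intro bchoice) blast
  moreover have "h \<in> borel_measurable borel"
  proof -
    have "(\<lambda>z. \<Sum>i=1..N. g i (fst z) * indicator (A i) (snd z)) \<in> borel_measurable borel"
      using causal_pair_D(1,3)[OF p] by (intro borel_measurable_sum borel_measurable_rectangle)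
    also have "(\<lambda>z. \<Sum>i=1..N. g i (fst z) * indicator (A i) (snd z)) = h"
      using h by auto
    finally show ?thesis .
  qed
  ultimately show "h \<in> test_functions"
    unfolding causal_test_functions_def mem_Collect_eq using h by blast
qed

lemma test_functions_pair:
  assumes "causal_pair g A"
  shows "(\<lambda>z. g (fst z) * indicator A (snd z)) \<in> test_functions"
  unfolding test_functions_iff
  using assms by (intro exI[of _ "1::nat"] exI[of _ "\<lambda>_. g"] exI[of _ "\<lambda>_. A"]) simp

lemma test_functions_zero: "(\<lambda>z. 0) \<in> test_functions"
  unfolding test_functions_iff by (intro exI[of _ "0::nat"]) simp

text \<open>Negative factors are included; this symmetry turns the one-sided price bound on the
  separating functional into \<open>L h = 0\<close>.\<close>

lemma test_functions_scale:
  assumes "h \<in> test_functions"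
  shows "(\<lambda>z. a * h z) \<in> test_functions"
proof -
  obtain N :: nat and g A where h: "\<And>x y. h (x, y) = (\<Sum>i=1..N. g i x * indicator (A i) y)"
    and p: "\<And>i. i \<in> {1..N} \<Longrightarrow> causal_pair (g i) (A i)" using assms unfolding test_functions_iff by blast
  have "a * h (x, y) = (\<Sum>i=1..N. a * g i x * indicator (A i) y)" for x y
    unfolding h sum_distrib_left by (simp only: mult.assoc)
  then show ?thesis unfolding test_functions_iff
    using causal_pair_scale[OF p] by (intro exI[of _ N] exI[of _ "\<lambda>i x. a * g i x"] exI[of _ A] conjI allI ballI)
qed

lemma test_functions_add:
  assumes "h \<in> test_functions" "h' \<in> test_functions"
  shows "(\<lambda>z. h z + h' z) \<in> test_functions"
proof -
  obtain N :: nat and g A where h: "\<And>x y. h (x, y) = (\<Sum>i=1..N. g i x * indicator (A i) y)"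
    and p: "\<And>i. i \<in> {1..N} \<Longrightarrow> causal_pair (g i) (A i)" using assms(1) unfolding test_functions_iff by blast
  obtain N' :: nat and g' A' where h': "\<And>x y. h' (x, y) = (\<Sum>i=1..N'. g' i x * indicator (A' i) y)"
    and p': "\<And>i. i \<in> {1..N'} \<Longrightarrow> causal_pair (g' i) (A' i)" using assms(2) unfolding test_functions_iff by blast
  \<comment> \<open>Concatenation of the two lists of summands: subtracting \<open>N\<close> moves
    the indices \<open>N + 1..N + N'\<close> onto \<open>1..N'\<close>.\<close>
  define G where "G i = (if i \<le> N then g i else g' (i - N))" for i
  define B where "B i = (if i \<le> N then A i else A' (i - N))" for i
  have "h (x, y) + h' (x, y) = (\<Sum>i=1..N + N'. G i x * indicator (B i) y)" for x y
  proof -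
    have "(\<Sum>i=1..N + N'. G i x * indicator (B i) y) =
      (\<Sum>i=1..N. G i x * indicator (B i) y) + (\<Sum>i=N + 1..N + N'. G i x * indicator (B i) y)"
      by (rule sum.ub_add_nat) simp
    also have "(\<Sum>i=1..N. G i x * indicator (B i) y) = h (x, y)"
      unfolding h by (rule sum.cong) (simp_all add: G_def B_def)
    also have "(\<Sum>i=N + 1..N + N'. G i x * indicator (B i) y) = (\<Sum>i=1..N'. G (i + N) x * indicator (B (i + N)) y)"
      using sum.shift_bounds_cl_nat_ivl[of "\<lambda>i. G i x * indicator (B i) y" 1 N N'] by (simp add: add.commute)
    also have "\<dots> = h' (x, y)"
      unfolding h' by (rule sum.cong) (simp_all add: G_def B_def)
    finally show ?thesis by simp
  qed
  moreover have "causal_pair (G i) (B i)" if "i \<in> {1..N + N'}" for i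
  proof (cases "i \<le> N")
    case True
    then show ?thesis using p[of i] that by (simp add: G_def B_def)
  next
    case False
    then have "i - N \<in> {1..N'}" using that by auto
    then show ?thesis using p'[of "i - N"] False by (simp add: G_def B_def)
  qed
  ultimately show ?thesis unfolding test_functions_iff by blast
qed

lemma test_functions_bounded:
  assumes "h \<in> test_functions"
  shows "h \<in> borel_measurable borel" "bounded (range h)"
proof -
  show "h \<in> borel_measurable borel" using assms by (simp add: causal_test_functions_def)
  obtain N :: nat and g A where h: "\<And>x y. h (x, y) = (\<Sum>i=1..N. g i x * indicator (A i) y)"
    and p: "\<And>i. i \<in> {1..N} \<Longrightarrow> causal_pair (g i) (A i)" using assms unfolding test_functions_iff by blast
  have "\<exists>K. \<forall>x. \<bar>g i x\<bar> \<le> K" if i: "i \<in> {1..N}" for i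
    using causal_pair_D(4)[OF p[OF i]] by (auto simp: bounded_iff)
  then obtain K where K: "\<And>i x. i \<in> {1..N} \<Longrightarrow> \<bar>g i x\<bar> \<le> K i" by metis
  have "\<bar>h (x, y)\<bar> \<le> (\<Sum>i=1..N. K i)" for x y
    unfolding h using K order_trans[OF abs_ge_zero K]
    by (intro order_trans[OF sum_abs] sum_mono) (auto simp: indicator_def)
  then show "bounded (range h)" by (intro boundedI[of _ "\<Sum>i=1..N. K i"]) auto
qed

end

section \<open>Plans from functionals\<close>

lemma sets_completed_UNIV:
  assumes "space \<eta> = UNIV"
  shows "sets (completed \<eta> G) = sigma_sets UNIV (sets G \<union> null_sets (completion \<eta>))"
    and "space (completed \<eta> G) = UNIV"
  using assms by (simp_all add: completed_def)

lemma kernel_bounded: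
  assumes "is_kernel \<eta> \<gamma> \<Theta>"
  shows "bounded (range (\<lambda>x. measure (\<Theta> x) A))"
  using assms by (intro boundedI[of _ 1]) (auto simp: is_kernel_def borel_probs_def prob_space.prob_le_1)

text \<open>The working form of causality: each kernel mass is measurable for the completed field.
  The completion inside \<open>kernel_field\<close> adds only null sets, which
  \<open>completed \<eta> G\<close> contains anyway.\<close>

lemma kernel_field_subset_iff:
  assumes \<eta>: "\<eta> \<in> borel_probs"
  shows "sets (kernel_field \<eta> \<nu> F \<Theta>) \<subseteq> sets (completed \<eta> G) \<longleftrightarrow>
    (\<forall>C\<in>sets F. emeasure \<nu> (frontier C) = 0 \<longrightarrow>
      (\<lambda>x. measure (\<Theta> x) C) \<in> borel_measurable (completed \<eta> G))" (is "?L \<longleftrightarrow> ?R")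
proof -
  note sp = borel_probs_D(3)[OF \<eta>]
  note sc = sets_completed_UNIV[OF sp]
  define gen where "gen = {(\<lambda>x. measure (\<Theta> x) C) -` B | C B.
    C \<in> sets F \<and> emeasure \<nu> (frontier C) = 0 \<and> B \<in> sets (borel :: real measure)}"
  have kf: "sets (kernel_field \<eta> \<nu> F \<Theta>) = sigma_sets UNIV (sigma_sets UNIV gen \<union> null_sets (completion \<eta>))"
    unfolding kernel_field_def gen_def[symmetric] sc(1) by simp
  interpret G: sigma_algebra UNIV "sets (completed \<eta> G)"
    using sets.sigma_algebra_axioms[of "completed \<eta> G"] by (simp add: sc(2))
  show ?thesis
  proof
    assume L: ?L
    show ?R
    proof (intro ballI impI measurableI)
      fix C B assume "C \<in> sets F" "emeasure \<nu> (frontier C) = 0" "B \<in> sets (borel :: real measure)"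
      then have "(\<lambda>x. measure (\<Theta> x) C) -` B \<in> gen" unfolding gen_def by blast
      then have "(\<lambda>x. measure (\<Theta> x) C) -` B \<in> sets (kernel_field \<eta> \<nu> F \<Theta>)"
        unfolding kf by (intro sigma_sets.Basic UnI1)
      then show "(\<lambda>x. measure (\<Theta> x) C) -` B \<inter> space (completed \<eta> G) \<in> sets (completed \<eta> G)"
        using L by (simp add: sc(2) subset_iff)
    qed simp
  next
    assume R: ?R
    have "gen \<subseteq> sets (completed \<eta> G)"
    proof
      fix D assume "D \<in> gen"
      then obtain C B where "D = (\<lambda>x. measure (\<Theta> x) C) -` B" "C \<in> sets F" "emeasure \<nu> (frontier C) = 0"
        "B \<in> sets (borel :: real measure)" unfolding gen_def by blast
      then show "D \<in> sets (completed \<eta> G)"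
        using measurable_sets[of "\<lambda>x. measure (\<Theta> x) C" "completed \<eta> G" borel B] R by (simp add: sc(2))
    qed
    then have "sigma_sets UNIV gen \<subseteq> sets (completed \<eta> G)" by (rule G.sigma_sets_subset)
    moreover have "null_sets (completion \<eta>) \<subseteq> sets (completed \<eta> G)" unfolding sc(1) by auto
    ultimately show ?L unfolding kf by (intro G.sigma_sets_subset) simp
  qed
qed

text \<open>Preimages under \<open>f\<close> and \<open>g\<close> differ by subsets of a null set,
  and the completed field contains all such subsets.\<close>

lemma measurable_completed_AE:
  assumes \<eta>: "\<eta> \<in> borel_probs" and f: "f \<in> borel_measurable (completed \<eta> G)"
    and eq: "AE x in \<eta>. g x = f x"
  shows "g \<in> borel_measurable (completed \<eta> G)"
proof (rule measurableI)
  note sp = borel_probs_D(3)[OF \<eta>]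
  note sc = sets_completed_UNIV[OF sp]
  fix B :: "'b set" assume B: "B \<in> sets borel"
  obtain N where N: "N \<in> null_sets \<eta>" "{x. g x \<noteq> f x} \<subseteq> N"
    using eq by (auto simp: eventually_ae_filter sp)
  have null: "M \<in> sets (completed \<eta> G)" if "M \<subseteq> N" for M
  proof -
    have "M \<in> null_sets (completion \<eta>)"
      using that N(1) null_sets_completion_subset null_sets_completionI by blast
    then show ?thesis unfolding sc(1) by (intro sigma_sets.Basic UnI2)
  qed
  have "f -` B \<in> sets (completed \<eta> G)" using measurable_sets[OF f B] by (simp add: sc(2))
  moreover have "g -` B = (f -` B - (f -` B - g -` B)) \<union> (g -` B - f -` B)" by blast
  moreover have "f -` B - g -` B \<subseteq> N" "g -` B - f -` B \<subseteq> N" using N(2) by auto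
  ultimately have "g -` B \<in> sets (completed \<eta> G)" using null by (metis sets.Diff sets.Un)
  then show "g -` B \<inter> space (completed \<eta> G) \<in> sets (completed \<eta> G)" by (simp add: sc(2))
qed simp

text \<open>If the residual \<open>X - E[X | G]\<close> is orthogonal to \<open>X\<close>, its square has integral 0.\<close>

lemma cond_exp_residual_self_orthogonal:
  fixes X :: "'e::topological_space \<Rightarrow> real"
  assumes \<eta>: "\<eta> \<in> borel_probs" and G: "subalgebra borel G"
    and X: "X \<in> borel_measurable borel" "bounded (range X)"
    and g: "g \<in> borel_measurable borel" "bounded (range g)"
      "AE x in \<eta>. g x = X x - real_cond_exp (completion \<eta>) (completed \<eta> G) X x"
    and orth: "(\<integral>x. g x * X x \<partial>\<eta>) = 0"
  shows "X \<in> borel_measurable (completed \<eta> G)"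
proof -
  interpret sigma_finite_subalgebra "completion \<eta>" "completed \<eta> G"
    using \<eta> G by (rule sigma_finite_subalgebra_completed)
  have bm: "f \<in> borel_measurable (completion \<eta>)" if "f \<in> borel_measurable borel" for f :: "'e \<Rightarrow> real"
    using that \<eta> by (intro measurable_completion) (simp add: borel_probs_D)
  have ic: "(\<integral>x. f x \<partial>completion \<eta>) = (\<integral>x. f x \<partial>\<eta>)" if "f \<in> borel_measurable borel" for f :: "'e \<Rightarrow> real"
    using that \<eta> by (intro integral_completion) (simp add: borel_probs_D)
  let ?E = "real_cond_exp (completion \<eta>) (completed \<eta> G) X"
  have Em: "?E \<in> borel_measurable (completion \<eta>)" "?E \<in> borel_measurable (completed \<eta> G)" by simp_all
  obtain K where K: "\<And>x. \<bar>X x\<bar> \<le> K" using X(2) by (auto simp: bounded_iff)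
  obtain K' where K': "\<And>x. \<bar>g x\<bar> \<le> K'" using g(2) by (auto simp: bounded_iff)
  have "0 \<le> K" "0 \<le> K'" using K[of undefined] K'[of undefined] by linarith+
  have g': "AE x in completion \<eta>. g x = X x - ?E x" using g(3) by (rule AE_completion)
  \<comment> \<open>The bound is read off from the residual: the conditional expectation equals
    \<open>X - g\<close> almost everywhere.\<close>
  have bE: "AE x in \<eta>. \<bar>?E x\<bar> \<le> K + K'"
    using g(3) by eventually_elim (use K K' in \<open>smt (verit)\<close>)
  have iEX: "integrable (completion \<eta>) (\<lambda>x. ?E x * X x)"
  proof (rule integrable_completion_bounded[OF \<eta>])
    show "AE x in \<eta>. \<bar>?E x * X x\<bar> \<le> (K + K') * K"
      using bE by eventually_elim (use K \<open>0 \<le> K\<close> \<open>0 \<le> K'\<close> in \<open>simp add: abs_mult mult_mono\<close>)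
  qed (use Em bm[OF X(1)] in simp)
  have igX: "integrable (completion \<eta>) (\<lambda>x. g x * X x)"
  proof (rule integrable_completion_bounded[OF \<eta>])
    show "AE x in \<eta>. \<bar>g x * X x\<bar> \<le> K' * K"
      using K K' \<open>0 \<le> K'\<close> by (intro AE_I2) (simp add: abs_mult mult_mono)
  qed (use bm[OF g(1)] bm[OF X(1)] in simp)
  note E2 = real_cond_exp_intg[OF iEX Em(2) bm[OF X(1)]]
  \<comment> \<open>Writing \<open>E\<close> for the conditional expectation, expand
    \<open>g * g = g * X - (E * X - E * E)\<close>. The first term integrates to zero by
    \<open>orth\<close>, the bracket by the pull-out property applied to \<open>E\<close>.\<close>
  have "(\<integral>x. g x * g x \<partial>completion \<eta>) = (\<integral>x. g x * X x - (?E x * X x - ?E x * ?E x) \<partial>completion \<eta>)"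
  proof (rule integral_cong_AE)
    show "AE x in completion \<eta>. g x * g x = g x * X x - (?E x * X x - ?E x * ?E x)"
      using g' by eventually_elim (simp add: left_diff_distrib right_diff_distrib mult.commute)
  qed (use bm[OF g(1)] bm[OF X(1)] Em in simp_all)
  also have "\<dots> = (\<integral>x. g x * X x \<partial>completion \<eta>) - ((\<integral>x. ?E x * X x \<partial>completion \<eta>) - (\<integral>x. ?E x * ?E x \<partial>completion \<eta>))"
    using igX iEX E2(1) by simp
  also have "\<dots> = 0" using E2(2) orth ic[of "\<lambda>x. g x * X x"] g(1) X(1) by simp
  finally have "(\<integral>x. g x * g x \<partial>\<eta>) = 0" using ic[of "\<lambda>x. g x * g x"] g(1) by simp
  moreover have "integrable \<eta> (\<lambda>x. g x * g x)"
  proof (rule integrable_bounded[OF \<eta>])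
    have "norm (g x * g x) \<le> K' * K'" for x
      using mult_mono[OF K' K' \<open>0 \<le> K'\<close> abs_ge_zero] by (simp only: real_norm_def abs_mult)
    then show "bounded (range (\<lambda>x. g x * g x))" by (intro boundedI) auto
  qed (use g(1) in simp)
  ultimately have "AE x in \<eta>. g x * g x = 0"
    using integral_nonneg_eq_0_iff_AE[of \<eta> "\<lambda>x. g x * g x"] by simp
  with g(3) have "AE x in \<eta>. X x = ?E x" by eventually_elim simp
  then show ?thesis by (rule measurable_completed_AE[OF \<eta> Em(2)])
qed

text \<open>Agreement is claimed only on rectangle functions: \<open>L\<close> need not be countably
  additive, so on other bounded functions it may differ from integration. The first marginal gives
  the domination that produces densities, the second the total masses \<open>measure \<nu> A\<close>
  that make their compact approximation possible.\<close>

lemma plan_of_functional: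
  fixes L :: "('e::{topological_space, second_countable_topology} \<times> 's::polish_space \<Rightarrow> real) \<Rightarrow> real"
  assumes \<eta>: "\<eta> \<in> borel_probs" and \<nu>: "\<nu> \<in> borel_probs"
    and Ladd: "\<And>f g. bounded (range f) \<Longrightarrow> bounded (range g) \<Longrightarrow> L (\<lambda>z. f z + g z) = L f + L g"
    and Lscale: "\<And>a f. bounded (range f) \<Longrightarrow> L (\<lambda>z. a * f z) = a * L f"
    and Lmono: "\<And>f g. bounded (range f) \<Longrightarrow> bounded (range g) \<Longrightarrow> (\<And>z. f z \<le> g z) \<Longrightarrow> L f \<le> L g"
    and Lfst: "\<And>f. f \<in> borel_measurable borel \<Longrightarrow> bounded (range f) \<Longrightarrow> L (\<lambda>z. f (fst z)) = (\<integral>x. f x \<partial>\<eta>)"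
    and Lsnd: "\<And>u. u \<in> borel_measurable borel \<Longrightarrow> bounded (range u) \<Longrightarrow> L (\<lambda>z. u (snd z)) = (\<integral>y. u y \<partial>\<nu>)"
  shows "\<exists>\<gamma>\<in>transference_plans \<eta> \<nu>. \<exists>\<Theta>. is_kernel \<eta> \<gamma> \<Theta> \<and>
    (\<forall>f\<in>borel_measurable borel. bounded (range f) \<longrightarrow> (\<forall>A\<in>sets borel.
      L (\<lambda>z. f (fst z) * indicator A (snd z)) = (\<integral>z. f (fst z) * indicator A (snd z) \<partial>\<gamma>)))"
proof -
  interpret E: prob_space \<eta> using \<eta> by (rule borel_probs_D)
  interpret S: prob_space \<nu> using \<nu> by (rule borel_probs_D)
  note [simp] = borel_probs_D(2-)[OF \<eta>] borel_probs_D(2-)[OF \<nu>]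
  define l where "l A f = L (\<lambda>z. f (fst z) * indicator A (snd z))" for A :: "'s set" and f :: "'e \<Rightarrow> real"
  have "\<exists>\<theta>\<in>borel_measurable borel. (\<forall>x. 0 \<le> \<theta> x) \<and> integrable \<eta> \<theta> \<and>
      (\<forall>f\<in>borel_measurable borel. bounded (range f) \<longrightarrow>
        integrable \<eta> (\<lambda>x. f x * \<theta> x) \<and> l A f = (\<integral>x. f x * \<theta> x \<partial>\<eta>))" if A: "A \<in> sets borel" for A
  proof (rule dominated_functional_density[OF \<eta>])
    fix f :: "'e \<Rightarrow> real" assume f: "f \<in> borel_measurable borel" "bounded (range f)"
    note bf = bounded_indicator_times[OF f(2), of fst A snd]
    show "l A (\<lambda>x. f x + g x) = l A f + l A g"
      if "g \<in> borel_measurable borel" "bounded (range g)" for g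
      using Ladd[OF bf bounded_indicator_times[OF that(2), of fst A snd]] by (simp add: l_def distrib_right)
    show "l A (\<lambda>x. a * f x) = a * l A f" for a
      using Lscale[OF bf, of a] by (simp add: l_def mult.assoc)
    assume pos: "\<And>x. 0 \<le> f x"
    have "L (\<lambda>z. 0 * (f (fst z) * indicator A (snd z))) \<le> l A f"
      unfolding l_def using bf pos by (intro Lmono) auto
    then show "0 \<le> l A f" using Lscale[OF bf, of 0] by simp
    have "l A f \<le> L (\<lambda>z. f (fst z))"
      unfolding l_def using pos by (intro Lmono bf bounded_compose[OF f(2)]) (auto simp: indicator_def)
    then show "l A f \<le> (\<integral>x. f x \<partial>\<eta>)" using Lfst[OF f] by simp
  qed
  then have "\<forall>A\<in>sets borel. \<exists>\<theta>. \<theta> \<in> borel_measurable borel \<and> (\<forall>x. 0 \<le> \<theta> x) \<and> integrable \<eta> \<theta> \<and>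
      (\<forall>f\<in>borel_measurable borel. bounded (range f) \<longrightarrow>
        integrable \<eta> (\<lambda>x. f x * \<theta> x) \<and> l A f = (\<integral>x. f x * \<theta> x \<partial>\<eta>))"
    unfolding Bex_def by (intro ballI)
  from bchoice[OF this] obtain \<theta> where \<theta>': "\<forall>A\<in>sets borel. \<theta> A \<in> borel_measurable borel \<and> (\<forall>x. 0 \<le> \<theta> A x) \<and>
      integrable \<eta> (\<theta> A) \<and> (\<forall>f\<in>borel_measurable borel. bounded (range f) \<longrightarrow>
        integrable \<eta> (\<lambda>x. f x * \<theta> A x) \<and> l A f = (\<integral>x. f x * \<theta> A x \<partial>\<eta>))" ..
  have \<theta>: "\<theta> A \<in> borel_measurable borel" "0 \<le> \<theta> A x" "integrable \<eta> (\<theta> A)"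
    "f \<in> borel_measurable borel \<Longrightarrow> bounded (range f) \<Longrightarrow> l A f = (\<integral>x. f x * \<theta> A x \<partial>\<eta>)"
    if "A \<in> sets borel" for A x f
    using bspec[OF \<theta>' that] by simp_all
  have set_int: "(LINT x:D|\<eta>. \<theta> A x) = l A (indicator D)" if "A \<in> sets borel" "D \<in> sets borel" for A D
    using \<theta>(4)[OF that(1) borel_measurable_indicator[OF that(2)] bounded_range_indicator]
    by (simp add: set_lebesgue_integral_def)
  have b1: "bounded (range (\<lambda>z. indicator D (fst z) * indicator A (snd z) :: real))"
    for D :: "'e set" and A :: "'s set"
    by (rule bounded_indicator_times[OF bounded_range_indicator])
  have tot: "(\<integral>x. \<theta> A x \<partial>\<eta>) = measure \<nu> A" if A: "A \<in> sets borel" for A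
  proof -
    have "(\<integral>x. \<theta> A x \<partial>\<eta>) = l A (\<lambda>x. 1)" using \<theta>(4)[OF A, of "\<lambda>x. 1"] by simp
    also have "\<dots> = (\<integral>y. indicator A y \<partial>\<nu>)"
      unfolding l_def using Lsnd[OF borel_measurable_indicator[OF A] bounded_range_indicator] by simp
    finally show ?thesis using A by simp
  qed
  obtain \<Theta> where \<Theta>: "\<And>x. \<Theta> x \<in> borel_probs" "\<Theta> \<in> borel \<rightarrow>\<^sub>M prob_algebra borel"
    and \<Theta>\<theta>: "\<And>A. A \<in> sets borel \<Longrightarrow> AE x in \<eta>. measure (\<Theta> x) A = \<theta> A x"
  proof (rule kernel_of_densities[OF \<eta> \<nu>, of \<theta>])
    fix A assume A: "A \<in> sets (borel :: 's measure)"
    show "\<theta> A \<in> borel_measurable borel" "integrable \<eta> (\<theta> A)" "AE x in \<eta>. 0 \<le> \<theta> A x"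
      using \<theta>(1-3)[OF A] by auto
    show "(\<integral>x. \<theta> A x \<partial>\<eta>) = measure \<nu> A" using A by (rule tot)
    fix B assume B: "B \<in> sets (borel :: 's measure)" "A \<inter> B = {}"
    \<comment> \<open>Densities are unique almost everywhere, so finite additivity of
      \<open>L\<close> passes to them.\<close>
    show "AE x in \<eta>. \<theta> (A \<union> B) x = \<theta> A x + \<theta> B x"
    proof (rule density_unique_real)
      show "integrable \<eta> (\<theta> (A \<union> B))" "integrable \<eta> (\<lambda>x. \<theta> A x + \<theta> B x)"
        using \<theta>(3) A B by simp_all
      fix D assume "D \<in> sets \<eta>"
      then have D: "D \<in> sets borel" by simp
      have "l (A \<union> B) (indicator D) = l A (indicator D) + l B (indicator D)"
        unfolding l_def using Ladd[OF b1[of D A] b1[of D B]] B(2) by (simp add: indicator_add[symmetric] distrib_left)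
      moreover have "set_integrable \<eta> D (\<theta> C)" if "C \<in> sets borel" for C
        unfolding set_integrable_def using D \<theta>(3)[OF that] by (intro integrable_mult_indicator) simp_all
      ultimately show "(LINT x:D|\<eta>. \<theta> (A \<union> B) x) = (LINT x:D|\<eta>. \<theta> A x + \<theta> B x)"
        using set_int[OF _ D] A B by (simp add: set_integral_add)
    qed
  next
    show "AE x in \<eta>. \<theta> UNIV x = 1"
    proof (rule density_unique_real)
      fix D assume "D \<in> sets \<eta>"
      then have D: "D \<in> sets borel" by simp
      have "l UNIV (indicator D) = (\<integral>x. indicator D x \<partial>\<eta>)"
        unfolding l_def using Lfst[OF borel_measurable_indicator[OF D] bounded_range_indicator] by simp
      then show "(LINT x:D|\<eta>. \<theta> UNIV x) = (LINT x:D|\<eta>. 1)"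
        using set_int[OF _ D, of UNIV] by (simp add: set_lebesgue_integral_def)
    qed (use \<theta>(3) in simp_all)
  qed (rule that)
  have P: "prob_space (\<Theta> x)" and sP: "sets (\<Theta> x) = sets borel" "space (\<Theta> x) = UNIV" for x
    using \<Theta>(1)[of x] by (auto simp: borel_probs_D)
  have km: "(\<lambda>x. emeasure (\<Theta> x) A) \<in> borel_measurable borel" if "A \<in> sets borel" for A
    using measurable_emeasure_kernel[OF measurable_prob_algebraD[OF \<Theta>(2)] that] .
  have kmr: "(\<lambda>x. measure (\<Theta> x) A) \<in> borel_measurable borel" if "A \<in> sets borel" for A
    using km[OF that] unfolding measure_def by simp
  have eP: "emeasure (\<Theta> x) A = ennreal (measure (\<Theta> x) A)" for x A
    using P[of x] by (simp add: prob_space_def finite_measure.emeasure_eq_measure)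
  have kb: "bounded (range (\<lambda>x. measure (\<Theta> x) A))" for A
    using P by (intro boundedI[of _ 1]) (auto simp: prob_space.prob_le_1)
  \<comment> \<open>\<open>k x\<close> is \<open>\<Theta> x\<close> placed on the fibre over
    \<open>x\<close>; the plan is the \<eta>-average of these measures.\<close>
  define k where "k x = distr (\<Theta> x) borel (Pair x)" for x
  have Pm: "Pair x \<in> \<Theta> x \<rightarrow>\<^sub>M borel" for x
    unfolding measurable_cong_sets[OF sP(1) refl]
    by (intro borel_measurable_continuous_onI continuous_on_Pair continuous_on_const continuous_on_id)
  have km': "k \<in> \<eta> \<rightarrow>\<^sub>M prob_algebra borel"
  proof -
    have "(\<lambda>(x, y). (x, y)) \<in> borel \<Otimes>\<^sub>M borel \<rightarrow>\<^sub>M (borel :: ('e \<times> 's) measure)"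
      unfolding borel_prod by (simp add: case_prod_beta')
    from measurable_distr_prob_space2[OF \<Theta>(2) this] have "k \<in> borel \<rightarrow>\<^sub>M prob_algebra borel"
      unfolding k_def[abs_def] by simp
    then show ?thesis by (simp cong: measurable_cong_sets)
  qed
  define \<gamma> where "\<gamma> = \<eta> \<bind> k"
  have kpa: "\<eta> \<in> space (prob_algebra \<eta>)" by (simp add: space_prob_algebra E.prob_space_axioms)
  have \<gamma>W: "emeasure \<gamma> (B \<times> A) = (\<integral>\<^sup>+x. indicator B x * emeasure (\<Theta> x) A \<partial>\<eta>)"
    if "B \<in> sets borel" "A \<in> sets borel" for A B
  proof -
    have "B \<times> A \<in> sets borel" using that by (simp add: borel_Times)
    then have "emeasure \<gamma> (B \<times> A) = (\<integral>\<^sup>+x. emeasure (k x) (B \<times> A) \<partial>\<eta>)"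
      unfolding \<gamma>_def by (rule emeasure_bind_prob_algebra[OF kpa km'])
    also have "(\<lambda>x. emeasure (k x) (B \<times> A)) = (\<lambda>x. indicator B x * emeasure (\<Theta> x) A)"
      unfolding k_def using \<open>B \<times> A \<in> sets borel\<close>
      by (intro ext) (subst emeasure_distr[OF Pm], auto simp: sP indicator_def vimage_def)
    finally show ?thesis .
  qed
  have s\<gamma>: "sets \<gamma> = sets borel"
    unfolding \<gamma>_def by (rule sets_bind[where N=borel]) (auto simp: k_def)
  have p\<gamma>: "prob_space \<gamma>"
  proof (rule prob_spaceI)
    have "space \<gamma> = UNIV \<times> UNIV" using sets_eq_imp_space_eq[OF s\<gamma>] by simp
    then show "emeasure \<gamma> (space \<gamma>) = 1"
      using \<gamma>W[of UNIV UNIV] prob_space.emeasure_space_1[OF P] sP by (simp add: E.emeasure_space_1[simplified])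
  qed
  have fm: "fst \<in> \<gamma> \<rightarrow>\<^sub>M borel" "snd \<in> \<gamma> \<rightarrow>\<^sub>M borel"
    using borel_measurable_fst borel_measurable_snd s\<gamma> measurable_cong_sets by blast+
  have d1: "distr \<gamma> borel fst = \<eta>"
  proof (rule measure_eqI)
    fix B assume "B \<in> sets (distr \<gamma> borel fst)"
    then have B: "B \<in> sets borel" by simp
    have "fst -` B \<inter> space \<gamma> = B \<times> UNIV" using sets_eq_imp_space_eq[OF s\<gamma>] by auto
    then have "emeasure (distr \<gamma> borel fst) B = emeasure \<gamma> (B \<times> UNIV)"
      using B fm by (simp add: emeasure_distr)
    also have "\<dots> = emeasure \<eta> B"
      using \<gamma>W[OF B, of UNIV] prob_space.emeasure_space_1[OF P] B by (simp add: sP)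
    finally show "emeasure (distr \<gamma> borel fst) B = emeasure \<eta> B" .
  qed simp
  have d2: "distr \<gamma> borel snd = \<nu>"
  proof (rule measure_eqI)
    fix A assume "A \<in> sets (distr \<gamma> borel snd)"
    then have A: "A \<in> sets borel" by simp
    have "snd -` A \<inter> space \<gamma> = UNIV \<times> A" using sets_eq_imp_space_eq[OF s\<gamma>] by auto
    then have "emeasure (distr \<gamma> borel snd) A = emeasure \<gamma> (UNIV \<times> A)"
      using A fm by (simp add: emeasure_distr)
    also have "\<dots> = (\<integral>\<^sup>+x. ennreal (measure (\<Theta> x) A) \<partial>\<eta>)" using \<gamma>W[OF _ A, of UNIV] by (simp add: eP)
    also have "\<dots> = ennreal (\<integral>x. measure (\<Theta> x) A \<partial>\<eta>)"
      using integrable_bounded[OF \<eta> kmr[OF A] kb] by (intro nn_integral_eq_integral) auto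
    also have "(\<integral>x. measure (\<Theta> x) A \<partial>\<eta>) = (\<integral>x. \<theta> A x \<partial>\<eta>)"
      using \<Theta>\<theta>[OF A] kmr[OF A] \<theta>(1)[OF A] by (intro integral_cong_AE) auto
    also have "\<dots> = measure \<nu> A" using A by (rule tot)
    finally show "emeasure (distr \<gamma> borel snd) A = emeasure \<nu> A" by (simp add: S.emeasure_eq_measure)
  qed simp
  have \<gamma>: "\<gamma> \<in> transference_plans \<eta> \<nu>"
    using p\<gamma> s\<gamma> d1 d2 by (simp add: transference_plans_def borel_probs_def)
  have K: "is_kernel \<eta> \<gamma> \<Theta>"
    unfolding is_kernel_def
  proof (intro conjI allI ballI)
    fix B :: "'e set" and A :: "'s set" assume B: "B \<in> sets borel" and A: "A \<in> sets borel"
    interpret G: prob_space \<gamma> by (rule p\<gamma>)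
    have "ennreal (measure \<gamma> (B \<times> A)) = (\<integral>\<^sup>+x. ennreal (indicator B x * measure (\<Theta> x) A) \<partial>\<eta>)"
      unfolding G.emeasure_eq_measure[symmetric] \<gamma>W[OF B A] eP
      by (intro nn_integral_cong) (auto simp: indicator_def)
    also have "\<dots> = ennreal (\<integral>x. indicator B x * measure (\<Theta> x) A \<partial>\<eta>)"
      using integrable_mult_indicator[of B \<eta>, OF _ integrable_bounded[OF \<eta> kmr[OF A] kb]] B
      by (intro nn_integral_eq_integral) auto
    finally show "measure \<gamma> (B \<times> A) = (LINT x:B|\<eta>. measure (\<Theta> x) A)"
      by (subst (asm) ennreal_inj) (auto simp: set_lebesgue_integral_def intro!: integral_nonneg_AE)
  qed (use \<Theta>(1) kmr in auto)
  have "L (\<lambda>z. f (fst z) * indicator A (snd z)) = (\<integral>z. f (fst z) * indicator A (snd z) \<partial>\<gamma>)"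
    if f: "f \<in> borel_measurable borel" "bounded (range f)" and A: "A \<in> sets borel" for f A
  proof -
    have "L (\<lambda>z. f (fst z) * indicator A (snd z)) = (\<integral>x. f x * \<theta> A x \<partial>\<eta>)"
      using \<theta>(4)[OF A f] by (simp add: l_def)
    also have "\<dots> = (\<integral>x. f x * measure (\<Theta> x) A \<partial>\<eta>)"
      using \<Theta>\<theta>[OF A] kmr[OF A] \<theta>(1)[OF A] f(1) by (intro integral_cong_AE) auto
    also have "\<dots> = (\<integral>z. f (fst z) * indicator A (snd z) \<partial>\<gamma>)"
      using integral_kernel[OF \<eta> \<gamma> K f A] by simp
    finally show ?thesis .
  qed
  then show ?thesis using \<gamma> K by blast
qed

section \<open>Weak duality\<close>

text \<open>The alternative between null and full measure survives complements and countable unions,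
  so it passes from the generators to the whole field.\<close>

lemma trivial_completed_zero_one:
  assumes \<eta>: "\<eta> \<in> borel_probs" and A: "A \<in> sets (completed \<eta> (sigma UNIV {}))"
  shows "(AE x in \<eta>. x \<notin> A) \<or> (AE x in \<eta>. x \<in> A)"
proof -
  have "A \<in> sigma_sets UNIV ({{}, UNIV} \<union> null_sets (completion \<eta>))"
    using A by (simp add: sets_completed_UNIV(1)[OF borel_probs_D(3)[OF \<eta>]] sigma_sets_empty_eq)
  then show ?thesis
  proof induct
    case (Basic A)
    then consider "A = {}" | "A = UNIV" | "A \<in> null_sets (completion \<eta>)" by blast
    then show ?case
    proof cases
      case 3
      then have "AE x in completion \<eta>. x \<notin> A" by (rule AE_not_in)
      then show ?thesis by (simp add: AE_completion_iff)
    qed simp_all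
  next
    case (Compl A)
    then show ?case by auto
  next
    case (Union A)
    show ?case
    proof (cases "\<exists>i. AE x in \<eta>. x \<in> A i")
      case True
      then obtain i where "AE x in \<eta>. x \<in> A i" ..
      then have "AE x in \<eta>. x \<in> (\<Union>i. A i)" by eventually_elim blast
      then show ?thesis ..
    next
      case False
      then have "AE x in \<eta>. \<forall>i. x \<notin> A i" using Union(2) unfolding AE_all_countable by blast
      then have "AE x in \<eta>. x \<notin> (\<Union>i. A i)" by eventually_elim blast
      then show ?thesis ..
    qed
  qed simp
qed

lemma cond_exp_trivial:
  fixes f :: "'e::topological_space \<Rightarrow> real"
  assumes \<eta>: "\<eta> \<in> borel_probs" and f: "f \<in> borel_measurable borel" "bounded (range f)"
  shows "AE x in \<eta>. real_cond_exp (completion \<eta>) (completed \<eta> (sigma UNIV {})) f x = (\<integral>x. f x \<partial>\<eta>)"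
proof -
  have sub: "subalgebra borel (sigma UNIV {})" by (auto simp: subalgebra_def sigma_sets_empty_eq)
  interpret sigma_finite_subalgebra "completion \<eta>" "completed \<eta> (sigma UNIV {})"
    using \<eta> sub by (rule sigma_finite_subalgebra_completed)
  interpret E: prob_space \<eta> using \<eta> by (rule borel_probs_D)
  interpret C: prob_space "completion \<eta>" by (rule E.prob_space_completion)
  have fm: "f \<in> borel_measurable \<eta>" using f \<eta> by (simp add: borel_probs_D)
  obtain K where "\<And>x. \<bar>f x\<bar> \<le> K" using f(2) by (auto simp: bounded_iff)
  then have fi: "integrable (completion \<eta>) f"
    using measurable_completion[OF fm] by (intro integrable_completion_bounded[OF \<eta>, of f K]) auto
  define k where "k = (\<integral>x. f x \<partial>\<eta>)"
  have k: "(\<integral>x. f x \<partial>completion \<eta>) = k" unfolding k_def using fm by (rule integral_completion)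
  have "AE x in completion \<eta>. real_cond_exp (completion \<eta>) (completed \<eta> (sigma UNIV {})) f x = k"
  proof (rule real_cond_exp_charact)
    fix A assume A: "A \<in> sets (completed \<eta> (sigma UNIV {}))"
    then have Ac: "A \<in> sets (completion \<eta>)" using subalg by (auto simp: subalgebra_def)
    \<comment> \<open>Over such a set an integral is either 0 or the full integral, and the constant
      \<open>k\<close> matches \<open>f\<close> in both cases.\<close>
    consider "AE x in completion \<eta>. x \<notin> A" | "AE x in completion \<eta>. x \<in> A"
      using trivial_completed_zero_one[OF \<eta> A] by (auto simp: AE_completion_iff)
    then show "(LINT x:A|completion \<eta>. f x) = (LINT x:A|completion \<eta>. k)"
    proof cases
      case 1
      then have "(LINT x:A|completion \<eta>. u x) = (LINT x|completion \<eta>. 0)"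
        if "u \<in> borel_measurable (completion \<eta>)" for u :: "'e \<Rightarrow> real"
        unfolding set_lebesgue_integral_def using that Ac by (intro integral_cong_AE) auto
      from this[of f] this[of "\<lambda>x. k"] show ?thesis using fi by simp
    next
      case 2
      then have "(LINT x:A|completion \<eta>. u x) = (LINT x|completion \<eta>. u x)"
        if "u \<in> borel_measurable (completion \<eta>)" for u :: "'e \<Rightarrow> real"
        unfolding set_lebesgue_integral_def using that Ac by (intro integral_cong_AE) auto
      from this[of f] this[of "\<lambda>x. k"] show ?thesis using fi k C.prob_space by simp
    qed
  qed (use fi in auto)
  then show ?thesis by (simp add: AE_completion_iff k_def)
qed

text \<open>Off the frontier a point is interior to \<open>A\<close> or to its complement. Test
  functions are therefore locally constant in the second variable outside a \<nu>-null set.\<close>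

lemma eventually_indicator_eq:
  assumes "y \<notin> frontier A"
  shows "\<forall>\<^sub>F z in nhds y. z \<in> A \<longleftrightarrow> y \<in> A"
proof (cases "y \<in> A")
  case True
  then have "y \<in> interior A" using assms closure_subset by (auto simp: frontier_def)
  then have "\<forall>\<^sub>F z in nhds y. z \<in> interior A" by (intro eventually_nhds_in_open) auto
  then show ?thesis using True interior_subset by (auto elim!: eventually_mono)
next
  case False
  then have "y \<in> - closure A" using assms interior_subset by (auto simp: frontier_def)
  then have "\<forall>\<^sub>F z in nhds y. z \<in> - closure A" by (intro eventually_nhds_in_open) auto
  then show ?thesis using False closure_subset by (auto elim!: eventually_mono)
qed

context causal_problem
begin

lemma extended_None: "extended_filtration F None = sigma UNIV {}"
  by (simp add: extended_filtration_def)

text \<open>This is what the extra index is for: a normalized functional that vanishes on all these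
  test functions has first marginal \<eta>.\<close>

lemma causal_pair_UNIV:
  assumes f: "f \<in> borel_measurable borel" "bounded (range f)"
  shows "causal_pair (\<lambda>x. f x - (\<integral>x. f x \<partial>\<eta>)) UNIV"
  unfolding causal_pair_def
proof (intro bexI[of _ None] bexI[of _ f] conjI)
  show "AE x in \<eta>. f x - (\<integral>x. f x \<partial>\<eta>) =
      f x - real_cond_exp (completion \<eta>) (completed \<eta> (extended_filtration BE None)) f x"
    unfolding extended_None using cond_exp_trivial[OF \<eta> f] by eventually_elim simp
  obtain K where "\<And>x. \<bar>f x\<bar> \<le> K" using f(2) by (auto simp: bounded_iff)
  then show "\<exists>K. AE x in \<eta>. \<bar>f x\<bar> \<le> K" by (intro exI[of _ K] AE_I2)
  show "bounded (range (\<lambda>x. f x - (\<integral>x. f x \<partial>\<eta>)))"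
    using bounded_minus_comp[OF f(2), of "\<lambda>_. \<integral>x. f x \<partial>\<eta>"] by simp
qed (use f in \<open>auto simp: extended_None sigma_sets_empty_eq\<close>)

text \<open>After disintegration each summand pairs a residual \<open>g\<close> with the kernel mass
  of \<open>A\<close>. Causality makes that mass measurable for the very field to which
  \<open>g\<close> is orthogonal.\<close>

lemma causal_plan_integral_zero:
  assumes \<gamma>: "\<gamma> \<in> causal_plans I BE BS \<eta> \<nu>" and h: "h \<in> test_functions"
  shows "(\<integral>z. h z \<partial>\<gamma>) = 0"
proof -
  obtain \<Theta> where \<gamma>t: "\<gamma> \<in> transference_plans \<eta> \<nu>" and K: "is_kernel \<eta> \<gamma> \<Theta>"
    and caus: "\<And>t. t \<in> I \<Longrightarrow> sets (kernel_field \<eta> \<nu> (BS t) \<Theta>) \<subseteq> sets (completed \<eta> (BE t))"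
    using \<gamma> unfolding causal_plans_def by blast
  have \<gamma>b: "\<gamma> \<in> borel_probs" using \<gamma>t by (rule transference_plans_D)
  have zero: "(\<integral>z. g (fst z) * indicator A (snd z) \<partial>\<gamma>) = 0" if p: "causal_pair g A" for g A
  proof -
    note pD = causal_pair_D[OF p]
    obtain t X k where t: "t \<in> insert None (Some ` I)" "A \<in> sets (extended_filtration BS t)"
      and X: "X \<in> borel_measurable borel" "AE x in \<eta>. \<bar>X x\<bar> \<le> k"
      and g: "AE x in \<eta>. g x = X x - real_cond_exp (completion \<eta>) (completed \<eta> (extended_filtration BE t)) X x"
      using p unfolding causal_pair_def by auto
    have "(\<lambda>x. measure (\<Theta> x) A) \<in> borel_measurable (completed \<eta> (extended_filtration BE t))"
    proof (cases t)
      \<comment> \<open>The trivial field contains only the empty set and the whole space, whose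
        kernel masses are the constants 0 and 1.\<close>
      case None
      then have "A = {} \<or> A = UNIV" using t(2) by (simp add: extended_None sigma_sets_empty_eq)
      moreover have "measure (\<Theta> x) UNIV = 1" for x
        using K prob_space.prob_space[of "\<Theta> x"] borel_probs_D(1,3)[of "\<Theta> x"] by (simp add: is_kernel_def)
      ultimately show ?thesis by auto
    next
      case (Some s)
      then have "s \<in> I" "A \<in> sets (BS s)" using t by (auto simp: extended_filtration_def)
      then show ?thesis
        using caus[OF \<open>s \<in> I\<close>] pD(2) unfolding kernel_field_subset_iff[OF \<eta>]
        by (simp add: Some extended_filtration_def)
    qed
    moreover have "(\<lambda>x. measure (\<Theta> x) A) \<in> borel_measurable borel" using K pD(1) by (simp add: is_kernel_def)
    ultimately have "(\<integral>x. g x * measure (\<Theta> x) A \<partial>\<eta>) = 0"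
      using kernel_bounded[OF K]
      by (rule cond_exp_residual_orthogonal[OF \<eta> subalgebra_extended(1)[OF t(1)] X pD(3) g])
    then show ?thesis using integral_kernel[OF \<eta> \<gamma>t K pD(3,4,1)] by simp
  qed
  obtain N :: nat and g A where h: "\<And>x y. h (x, y) = (\<Sum>i=1..N. g i x * indicator (A i) y)"
    and p: "\<And>i. i \<in> {1..N} \<Longrightarrow> causal_pair (g i) (A i)" using h unfolding test_functions_iff by blast
  have "(\<integral>z. h z \<partial>\<gamma>) = (\<integral>z. (\<Sum>i=1..N. g i (fst z) * indicator (A i) (snd z)) \<partial>\<gamma>)"
    using h by (intro Bochner_Integration.integral_cong) auto
  also have "\<dots> = (\<Sum>i=1..N. \<integral>z. g i (fst z) * indicator (A i) (snd z) \<partial>\<gamma>)"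
    using causal_pair_D[OF p]
    by (intro Bochner_Integration.integral_sum integrable_bounded[OF \<gamma>b] borel_measurable_rectangle bounded_indicator_times)
  also have "\<dots> = 0" using zero[OF p] by (intro sum.neutral) simp
  finally show ?thesis .
qed

lemma weak_duality: "causal_dual I BE BS c \<eta> \<nu> \<le> causal_primal I BE BS c \<eta> \<nu>"
  unfolding causal_dual_def causal_primal_def
proof (intro SUP_least INF_greatest, clarify)
  fix g h \<gamma> assume g: "g \<in> bcontfun" and h: "h \<in> test_functions"
    and le: "\<forall>x y. ereal (g y + h (x, y)) \<le> c (x, y)" and \<gamma>: "\<gamma> \<in> causal_plans I BE BS \<eta> \<nu>"
  have \<gamma>t: "\<gamma> \<in> transference_plans \<eta> \<nu>" using \<gamma> by (simp add: causal_plans_def)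
  have \<gamma>b: "\<gamma> \<in> borel_probs" using \<gamma>t by (rule transference_plans_D)
  have gm: "g \<in> borel_measurable borel" "bounded (range g)"
    using g by (auto simp: bcontfun_def intro: borel_measurable_continuous_onI)
  have ig: "integrable \<gamma> (\<lambda>z. g (snd z))"
    using measurable_compose[OF borel_measurable_snd gm(1)] bounded_compose[OF gm(2)] by (rule integrable_bounded[OF \<gamma>b])
  have ih: "integrable \<gamma> h" using test_functions_bounded[OF h] by (rule integrable_bounded[OF \<gamma>b])
  define f where "f z = g (snd z) + h z" for z
  have f: "integrable \<gamma> f" unfolding f_def using ig ih by simp
  have "(\<integral>y. g y \<partial>\<nu>) = (\<integral>z. f z \<partial>\<gamma>)"
    using transference_plans_D(3)[OF \<gamma>t gm(1)] causal_plan_integral_zero[OF \<gamma> h] ig ih by (simp add: f_def)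
  \<comment> \<open>The cost is integrated as an \<open>ennreal\<close> function, so
    \<open>f\<close> is replaced by its positive part, which is still below \<open>c\<close> because
    \<open>c\<close> is nonnegative.\<close>
  also have "\<dots> \<le> (\<integral>z. max 0 (f z) \<partial>\<gamma>)" using f by (intro integral_mono) auto
  finally have "ereal (\<integral>y. g y \<partial>\<nu>) \<le> ereal (\<integral>z. max 0 (f z) \<partial>\<gamma>)" by simp
  also have "\<dots> = enn2ereal (ennreal (\<integral>z. max 0 (f z) \<partial>\<gamma>))"
    by (simp add: enn2ereal_ennreal integral_nonneg_AE)
  also have "ennreal (\<integral>z. max 0 (f z) \<partial>\<gamma>) = (\<integral>\<^sup>+ z. ennreal (max 0 (f z)) \<partial>\<gamma>)"
    using f by (intro nn_integral_eq_integral[symmetric]) auto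
  also have "enn2ereal \<dots> \<le> enn2ereal (\<integral>\<^sup>+ z. e2ennreal (c z) \<partial>\<gamma>)"
  proof -
    have "ennreal (max 0 (f z)) \<le> e2ennreal (c z)" for z
    proof -
      have "ereal (max 0 (f z)) \<le> c z"
        using le[rule_format, of "snd z" "fst z"] c_nonneg[of z] by (simp add: f_def max_def zero_ereal_def)
      then have "e2ennreal (ereal (max 0 (f z))) \<le> e2ennreal (c z)" by (rule e2ennreal_mono)
      then show ?thesis unfolding e2ennreal_ereal .
    qed
    then show ?thesis unfolding less_eq_ennreal.rep_eq[symmetric] by (intro nn_integral_mono)
  qed
  finally show "ereal (\<integral>y. g y \<partial>\<nu>) \<le> enn2ereal (\<integral>\<^sup>+ z. e2ennreal (c z) \<partial>\<gamma>)" .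
qed

lemma causal_dual_ge:
  assumes "g \<in> bcontfun" "h \<in> test_functions" "\<And>x y. ereal (g y + h (x, y)) \<le> c (x, y)"
  shows "ereal (\<integral>y. g y \<partial>\<nu>) \<le> causal_dual I BE BS c \<eta> \<nu>"
  unfolding causal_dual_def by (rule SUP_upper2[of "(g, h)"]) (use assms in auto)

text \<open>The infimum over \<open>x\<close> of \<open>C(x, y) + h(x, y)\<close> is Lipschitz in \<open>y\<close> away from the null frontiers
  of the sets defining \<open>h\<close>, so its Lipschitz minorants converge to it almost everywhere. This is why
  continuous potentials suffice in the dual problem.\<close>

lemma causal_dual_ge_bounded:
  assumes u: "u \<in> borel_measurable borel" "bounded (range u)" and h: "h \<in> test_functions"
    and C: "bounded (range C)" "\<And>z. ereal (C z) \<le> c z" "\<And>x y z. \<bar>C (x, y) - C (x, z)\<bar> \<le> K * dist y z"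
    and le: "\<And>x y. u y \<le> C (x, y) + h (x, y)"
  shows "ereal (\<integral>y. u y \<partial>\<nu>) \<le> causal_dual I BE BS c \<eta> \<nu>"
proof -
  obtain b1 where b1: "\<And>z. \<bar>C z\<bar> \<le> b1" using C(1) by (auto simp: bounded_iff)
  obtain b2 where b2: "\<And>z. \<bar>h z\<bar> \<le> b2" using test_functions_bounded(2)[OF h] by (auto simp: bounded_iff)
  obtain b3 where b3: "\<And>y. \<bar>u y\<bar> \<le> b3" using u(2) by (auto simp: bounded_iff)
  define b where "b = b1 + b2"
  have b: "- b \<le> C z + h z" "C z + h z \<le> b" for z
    using b1[of z] b2[of z] unfolding b_def by linarith+
  \<comment> \<open>\<open>G\<close> is the largest function of \<open>y\<close> alone below
    \<open>C + h\<close>. Hence \<open>u \<le> G\<close>, and each bounded continuous minorant of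
    \<open>G\<close> is an admissible potential together with the test function
    \<open>- h\<close>.\<close>
  define G where "G y = (INF x. C (x, y) + h (x, y))" for y
  have G_le: "G y \<le> C (x, y) + h (x, y)" for x y
    unfolding G_def by (rule cINF_lower[OF bdd_belowI2[OF b(1)]]) simp
  have G_ge: "a \<le> G y" if "\<And>x. a \<le> C (x, y) + h (x, y)" for a y
    unfolding G_def by (rule cINF_greatest) (use that in auto)
  have Gb: "- b \<le> G y" for y using b(1) by (intro G_ge)
  define p where "p n = lipschitz_minorant G (real n)" for n
  have p_le: "p n y \<le> G y" for n y unfolding p_def using Gb by (intro lipschitz_minorant_le[of _ b]) auto
  have p_low: "- b \<le> p n y" for n y unfolding p_def using Gb by (intro lipschitz_minorant_lower) auto
  have p_bd: "\<bar>p n y\<bar> \<le> b" for n y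
    using p_low[of n y] p_le[of n y] G_le[of y undefined] b(2)[of "(undefined, y)"] by linarith
  have p_cont: "continuous_on UNIV (p n)" for n
    unfolding p_def using Gb by (intro lipschitz_minorant_continuous[of _ b]) auto
  have p_bc: "p n \<in> bcontfun" for n
    unfolding bcontfun_def using p_cont p_bd by (auto intro!: boundedI[of _ b])
  have pm: "p n \<in> borel_measurable borel" for n using p_cont by (rule borel_measurable_continuous_onI)
  have pb: "bounded (range (p n))" for n using p_bd by (auto intro!: boundedI[of _ b])
  have p_dual: "ereal (\<integral>y. p n y \<partial>\<nu>) \<le> causal_dual I BE BS c \<eta> \<nu>" for n
  proof (rule causal_dual_ge[OF p_bc test_functions_scale[OF h, of "-1"]])
    fix x y
    have "p n y + - 1 * h (x, y) \<le> C (x, y)" using p_le[of n y] G_le[of y x] by linarith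
    then show "ereal (p n y + - 1 * h (x, y)) \<le> c (x, y)" using C(2)[of "(x, y)"] by (metis ereal_less_eq(3) order_trans)
  qed
  obtain N :: nat and g A where hN: "\<And>x y. h (x, y) = (\<Sum>i=1..N. g i x * indicator (A i) y)"
    and pr: "\<And>i. i \<in> {1..N} \<Longrightarrow> causal_pair (g i) (A i)" using h unfolding test_functions_iff by blast
  \<comment> \<open>Near such a \<open>y\<close> the value \<open>h (x, z)\<close> does not change
    with \<open>z\<close>, uniformly in \<open>x\<close> because the radius depends only on the sets
    \<open>A i\<close>. So \<open>G\<close> drops by at most \<open>K * dist y z\<close> there, and
    for large \<open>n\<close> its minorant touches it at \<open>y\<close>.\<close>
  have ev: "\<forall>\<^sub>F n in sequentially. G y \<le> p n y" if y: "\<And>i. i \<in> {1..N} \<Longrightarrow> y \<notin> frontier (A i)" for y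
  proof -
    have "\<forall>\<^sub>F z in nhds y. \<forall>i\<in>{1..N}. z \<in> A i \<longleftrightarrow> y \<in> A i"
      using y by (intro eventually_ball_finite ballI eventually_indicator_eq) auto
    then obtain r where r: "0 < r" "\<And>z i. dist z y < r \<Longrightarrow> i \<in> {1..N} \<Longrightarrow> z \<in> A i \<longleftrightarrow> y \<in> A i"
      unfolding eventually_nhds_metric by blast
    have near: "G y \<le> G z + K * dist y z" if z: "dist y z < r" for z
    proof -
      have hz: "h (x, z) = h (x, y)" for x
        unfolding hN using r(2)[of z] z by (intro sum.cong) (auto simp: dist_commute indicator_def)
      have "G y - K * dist y z \<le> G z"
      proof (rule G_ge)
        fix x
        show "G y - K * dist y z \<le> C (x, z) + h (x, z)"
          using G_le[of y x] C(3)[of x y z] hz[of x] by linarith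
      qed
      then show ?thesis by linarith
    qed
    have "G y \<le> p n y" if n: "K \<le> real n" "(G y + b) / r \<le> real n" for n
      unfolding p_def
    proof (rule lipschitz_minorant_ge[of _ b _ _ r])
      show "G y + b \<le> real n * r" using n(2) r(1) by (simp add: divide_le_eq)
      fix z assume "dist y z < r"
      then show "G y \<le> G z + real n * dist y z"
        using near[of z] mult_right_mono[OF n(1) zero_le_dist[of y z]] by linarith
    qed (use Gb in auto)
    moreover have "\<forall>\<^sub>F n in sequentially. K \<le> real n \<and> (G y + b) / r \<le> real n"
      using filterlim_real_sequentially by (simp add: filterlim_at_top eventually_conj)
    ultimately show ?thesis by (auto elim!: eventually_mono)
  qed
  have AEy: "AE y in \<nu>. \<forall>i\<in>{1..N}. y \<notin> frontier (A i)"
  proof (intro AE_finite_allI)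
    fix i assume "i \<in> {1..N}"
    then have "emeasure \<nu> (frontier (A i)) = 0" using causal_pair_D(2)[OF pr] by blast
    then have "frontier (A i) \<in> null_sets \<nu>"
      using \<nu> by (auto simp: null_sets_def borel_probs_D)
    then show "AE y in \<nu>. y \<notin> frontier (A i)" by (rule AE_not_in)
  qed simp
  \<comment> \<open>The minimum with \<open>u\<close> avoids integrating \<open>G\<close>, an
    infimum over all \<open>x\<close> whose measurability is unclear. At almost every
    \<open>y\<close> these minima eventually equal \<open>u y\<close>.\<close>
  have "(\<lambda>n. \<integral>y. min (p n y) (u y) \<partial>\<nu>) \<longlonglongrightarrow> (\<integral>y. u y \<partial>\<nu>)"
  proof (rule integral_dominated_convergence[where w="\<lambda>_. b + b3"])
    show "AE y in \<nu>. (\<lambda>n. min (p n y) (u y)) \<longlonglongrightarrow> u y"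
      using AEy
    proof eventually_elim
      case (elim y)
      have uG: "u y \<le> G y" using le by (intro G_ge)
      have "\<forall>\<^sub>F n in sequentially. min (p n y) (u y) = u y"
        using ev[of y] elim uG by (auto elim!: eventually_mono)
      then show ?case by (rule tendsto_eventually)
    qed
    show "AE y in \<nu>. norm (min (p n y) (u y)) \<le> b + b3" for n
    proof (rule AE_I2)
      fix y show "norm (min (p n y) (u y)) \<le> b + b3"
        using p_bd[of n y] b3[of y] by (auto simp: min_def)
    qed
    show "integrable \<nu> (\<lambda>_. b + b3)" by (intro integrable_bounded[OF \<nu>]) auto
  qed (use u(1) pm \<nu> in \<open>auto simp: borel_probs_D\<close>)
  then have lim: "(\<lambda>n. ereal (\<integral>y. min (p n y) (u y) \<partial>\<nu>)) \<longlonglongrightarrow> ereal (\<integral>y. u y \<partial>\<nu>)" by simp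
  have "ereal (\<integral>y. min (p n y) (u y) \<partial>\<nu>) \<le> causal_dual I BE BS c \<eta> \<nu>" for n
  proof -
    have ip: "integrable \<nu> (p n)" using pm pb by (rule integrable_bounded[OF \<nu>])
    have "integrable \<nu> u" using u by (rule integrable_bounded[OF \<nu>])
    with ip have "(\<integral>y. min (p n y) (u y) \<partial>\<nu>) \<le> (\<integral>y. p n y \<partial>\<nu>)"
      by (intro integral_mono integrable_min) auto
    then show ?thesis using p_dual[of n] by (metis ereal_less_eq(3) order_trans)
  qed
  then show ?thesis by (intro LIMSEQ_le_const2[OF lim]) auto
qed

end

section \<open>Strong duality\<close>

lemma functional_sum:
  fixes L :: "('a \<Rightarrow> real) \<Rightarrow> real"
  assumes Ladd: "\<And>f g. bounded (range f) \<Longrightarrow> bounded (range g) \<Longrightarrow> L (\<lambda>z. f z + g z) = L f + L g"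
    and Lscale: "\<And>a f. bounded (range f) \<Longrightarrow> L (\<lambda>z. a * f z) = a * L f"
    and bd: "\<And>j. bounded (range (\<phi> j))"
  shows "bounded (range (\<lambda>z. \<Sum>j<N. \<phi> j z)) \<and> L (\<lambda>z. \<Sum>j<(N::nat). \<phi> j z) = (\<Sum>j<N. L (\<phi> j))"
proof (induction N)
  case 0
  then show ?case using Lscale[of "\<lambda>z. 0" 0] by simp
next
  case (Suc N)
  then show ?case using Ladd[OF conjunct1[OF Suc] bd[of N]] bounded_plus_comp[OF conjunct1[OF Suc] bd[of N]] by simp
qed

text \<open>Slicing \<open>S\<close> into countably many pieces of small diameter approximates \<open>C\<close> by functions
  \<open>f(x) 1\<^sub>A(y)\<close>, on which the functional and the measure agree.\<close>

lemma integral_le_functional: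
  fixes L :: "('e::topological_space \<times> 's::{metric_space, second_countable_topology} \<Rightarrow> real) \<Rightarrow> real"
  assumes \<gamma>: "\<gamma> \<in> borel_probs"
    and Ladd: "\<And>f g. bounded (range f) \<Longrightarrow> bounded (range g) \<Longrightarrow> L (\<lambda>z. f z + g z) = L f + L g"
    and Lscale: "\<And>a f. bounded (range f) \<Longrightarrow> L (\<lambda>z. a * f z) = a * L f"
    and Lmono: "\<And>f g. bounded (range f) \<Longrightarrow> bounded (range g) \<Longrightarrow> (\<And>z. f z \<le> g z) \<Longrightarrow> L f \<le> L g"
    and Lone: "L (\<lambda>z. 1) = 1"
    and L: "\<And>f A. f \<in> borel_measurable borel \<Longrightarrow> bounded (range f) \<Longrightarrow> A \<in> sets borel \<Longrightarrow>
      L (\<lambda>z. f (fst z) * indicator A (snd z)) = (\<integral>z. f (fst z) * indicator A (snd z) \<partial>\<gamma>)"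
    and C: "C \<in> borel_measurable borel" "bounded (range C)" "\<And>z. 0 \<le> C z"
      "\<And>y. (\<lambda>x. C (x, y)) \<in> borel_measurable borel"
      "\<And>x y z. \<bar>C (x, y) - C (x, z)\<bar> \<le> K * dist y z"
  shows "(\<integral>z. C z \<partial>\<gamma>) \<le> L C"
proof (rule field_le_epsilon)
  fix d :: real assume d: "0 < d"
  interpret prob_space \<gamma> using \<gamma> by (rule borel_probs_D)
  \<comment> \<open>Each of the two comparisons with a step function loses
    \<open>\<bar>K\<bar> * e\<close>, so together they lose at most \<open>d\<close>; the
    \<open>+ 1\<close> covers \<open>K = 0\<close>.\<close>
  define e where "e = d / (2 * (\<bar>K\<bar> + 1))"
  have e: "0 < e" using d by (simp add: e_def)
  have Ke: "2 * (\<bar>K\<bar> * e) \<le> d"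
  proof -
    have "2 * (\<bar>K\<bar> * e) \<le> 2 * ((\<bar>K\<bar> + 1) * e)" using e by simp
    also have "\<dots> = d" unfolding e_def by (simp add: field_simps)
    finally show ?thesis .
  qed
  define k where "k = \<bar>K\<bar> * e"
  have k: "0 \<le> k" using e by (simp add: k_def)
  obtain D :: "'s set" where D: "countable D" "\<And>X. open X \<Longrightarrow> X \<noteq> {} \<Longrightarrow> \<exists>d\<in>D. d \<in> X"
    using countable_dense_exists by blast
  have Dne: "D \<noteq> {}" using D(2)[of UNIV] by auto
  define y where "y = from_nat_into D"
  define B where "B n = ball (y n) e" for n
  \<comment> \<open>Balls around a dense sequence cover the space; made disjoint, they form a
    partition on whose pieces \<open>C\<close> stays within \<open>k\<close> of its value at the
    centre.\<close>
  define A where "A = disjointed B"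
  have Ab: "A n \<in> sets borel" for n
  proof -
    have "range B \<subseteq> sets borel" by (auto simp: B_def)
    then show ?thesis unfolding A_def using sets.range_disjointed_sets by blast
  qed
  have Adisj: "disjoint_family A" unfolding A_def by (rule disjoint_family_disjointed)
  have Acov: "\<exists>n. z \<in> A n" for z
  proof -
    obtain w where "w \<in> D" "w \<in> ball z e" using D(2)[of "ball z e"] e by auto
    then obtain n where "y n = w" using from_nat_into_surj[OF D(1)] by (auto simp: y_def)
    then have "z \<in> B n" using \<open>w \<in> ball z e\<close> by (simp add: B_def dist_commute)
    then have "z \<in> (\<Union>n. A n)" unfolding A_def UN_disjointed_eq by blast
    then show ?thesis by blast
  qed
  have near: "\<bar>C (x, z) - C (x, y n)\<bar> \<le> k" if "z \<in> A n" for x z n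
  proof -
    have "z \<in> B n" using that disjointed_subset[of B n] by (auto simp: A_def)
    then have "dist z (y n) \<le> e" by (simp add: B_def dist_commute)
    have "\<bar>C (x, z) - C (x, y n)\<bar> \<le> K * dist z (y n)" by (rule C(5))
    also have "\<dots> \<le> \<bar>K\<bar> * e" using \<open>dist z (y n) \<le> e\<close> by (intro mult_mono) auto
    finally show ?thesis by (simp add: k_def)
  qed
  define \<phi> where "\<phi> n z = C (fst z, y n) * indicator (A n) (snd z)" for n z
  have Cy: "(\<lambda>x. C (x, y n)) \<in> borel_measurable borel" "bounded (range (\<lambda>x. C (x, y n)))" for n
    using C(4) bounded_compose[OF C(2)] by auto
  have \<phi>b: "bounded (range (\<phi> n))" for n
    unfolding \<phi>_def using Cy(2) by (rule bounded_indicator_times)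
  have \<phi>m: "\<phi> n \<in> borel_measurable borel" for n
    unfolding \<phi>_def using Cy(1) Ab by (rule borel_measurable_rectangle)
  note \<phi>i = integrable_bounded[OF \<gamma> \<phi>m \<phi>b]
  define \<psi> where "\<psi> N z = (\<Sum>j<N. \<phi> j z)" for N :: nat and z
  have \<psi>: "bounded (range (\<psi> N))" "L (\<psi> N) = (\<integral>z. \<psi> N z \<partial>\<gamma>)" for N
  proof -
    note s = functional_sum[of L \<phi> N, OF Ladd Lscale \<phi>b]
    show "bounded (range (\<psi> N))" unfolding \<psi>_def[abs_def] by (rule conjunct1[OF s])
    have L\<phi>: "L (\<phi> j) = (\<integral>z. \<phi> j z \<partial>\<gamma>)" for j
      unfolding \<phi>_def by (rule L[OF Cy Ab])
    have "L (\<psi> N) = (\<Sum>j<N. L (\<phi> j))" unfolding \<psi>_def[abs_def] by (rule conjunct2[OF s])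
    also have "\<dots> = (\<Sum>j<N. \<integral>z. \<phi> j z \<partial>\<gamma>)" by (simp only: L\<phi>)
    also have "\<dots> = (\<integral>z. \<psi> N z \<partial>\<gamma>)"
      unfolding \<psi>_def by (rule Bochner_Integration.integral_sum[symmetric]) (rule \<phi>i)
    finally show "L (\<psi> N) = (\<integral>z. \<psi> N z \<partial>\<gamma>)" .
  qed
  have \<psi>i: "integrable \<gamma> (\<psi> N)" for N unfolding \<psi>_def[abs_def] using \<phi>i by simp
  have \<psi>_in: "\<psi> N z = C (fst z, y n)" if "n < N" "snd z \<in> A n" for N n z
  proof -
    have "snd z \<notin> A j" if "j \<noteq> n" for j
      using disjoint_family_onD[OF Adisj, of j n] that \<open>snd z \<in> A n\<close> by auto
    then have "\<psi> N z = (\<Sum>j<N. if j = n then C (fst z, y n) else 0)"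
      unfolding \<psi>_def \<phi>_def using that by (intro sum.cong) auto
    then show ?thesis using that by simp
  qed
  have \<psi>_out: "\<psi> N z = 0" if "\<And>n. n < N \<Longrightarrow> snd z \<notin> A n" for N z
    unfolding \<psi>_def \<phi>_def using that by simp
  have up: "\<psi> N z \<le> C z + k" for N z
  proof (cases "\<exists>n<N. snd z \<in> A n")
    case True
    then obtain n where n: "n < N" "snd z \<in> A n" by blast
    then show ?thesis using \<psi>_in[OF n] near[OF n(2), of "fst z"] by simp
  next
    case False
    then show ?thesis using \<psi>_out[of N z] C(3)[of z] k by auto
  qed
  have low: "C z * indicator (\<Union>n<N. A n) (snd z) \<le> \<psi> N z + k" for N z
  proof (cases "\<exists>n<N. snd z \<in> A n")
    case True
    then obtain n where n: "n < N" "snd z \<in> A n" by blast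
    then have "snd z \<in> (\<Union>n<N. A n)" by blast
    then show ?thesis using \<psi>_in[OF n] near[OF n(2), of "fst z"] by simp
  next
    case False
    then show ?thesis using \<psi>_out[of N z] k by auto
  qed
  have kb: "bounded (range (\<lambda>z::'e \<times> 's. k))" by simp
  have Lk: "L (\<lambda>z. k) = k" using Lscale[of "\<lambda>z. 1" k] Lone by simp
  have Ci: "integrable \<gamma> C" using C(1,2) by (rule integrable_bounded[OF \<gamma>])
  have Um: "(\<Union>n<N. A n) \<in> sets borel" for N using Ab by (intro sets.finite_UN) auto
  have Im: "(\<lambda>z. indicator (\<Union>n<N. A n) (snd z) :: real) \<in> borel_measurable (borel :: ('e \<times> 's) measure)" for N
    using measurable_compose[OF borel_measurable_snd borel_measurable_indicator[OF Um]] .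
  have CIm: "(\<lambda>z. C z * indicator (\<Union>n<N. A n) (snd z)) \<in> borel_measurable borel" for N
    using C(1) Im by (rule borel_measurable_times)
  \<comment> \<open>Only finitely many pieces can be handed to a finitely additive \<open>L\<close>.
    The bound does not depend on \<open>N\<close>, so the limit is taken on the side of the measure
    \<open>\<gamma>\<close>.\<close>
  have "(\<integral>z. C z * indicator (\<Union>n<N. A n) (snd z) \<partial>\<gamma>) \<le> L C + d" for N
  proof -
    have "(\<integral>z. C z * indicator (\<Union>n<N. A n) (snd z) \<partial>\<gamma>) \<le> (\<integral>z. \<psi> N z + k \<partial>\<gamma>)"
    proof (rule integral_mono)
      show "integrable \<gamma> (\<lambda>z. C z * indicator (\<Union>n<N. A n) (snd z))"
        using Ci by (rule Bochner_Integration.integrable_bound)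
          (use CIm \<gamma> in \<open>auto simp: borel_probs_D indicator_def\<close>)
    qed (use low \<psi>i in auto)
    also have "\<dots> = L (\<psi> N) + k" using \<psi>i \<psi>(2) prob_space by simp
    also have "L (\<psi> N) \<le> L (\<lambda>z. C z + k)"
      using \<psi>(1) bounded_plus_comp[OF C(2) kb] up by (rule Lmono)
    also have "L (\<lambda>z. C z + k) = L C + k" using Ladd[OF C(2) kb] Lk by simp
    finally show ?thesis using Ke unfolding k_def by linarith
  qed
  moreover have "(\<lambda>N. \<integral>z. C z * indicator (\<Union>n<N. A n) (snd z) \<partial>\<gamma>) \<longlonglongrightarrow> (\<integral>z. C z \<partial>\<gamma>)"
  proof (rule integral_dominated_convergence[OF _ _ Ci])
    show "AE z in \<gamma>. (\<lambda>N. C z * indicator (\<Union>n<N. A n) (snd z)) \<longlonglongrightarrow> C z"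
    proof (rule AE_I2)
      fix z :: "'e \<times> 's"
      obtain n where n: "snd z \<in> A n" using Acov by blast
      have "C z * indicator (\<Union>n<N. A n) (snd z) = C z" if "N \<ge> Suc n" for N
      proof -
        have "snd z \<in> (\<Union>n<N. A n)" using n that by (intro UN_I[of n]) auto
        then show ?thesis by simp
      qed
      then show "(\<lambda>N. C z * indicator (\<Union>n<N. A n) (snd z)) \<longlonglongrightarrow> C z"
        by (intro tendsto_eventually eventually_sequentiallyI)
    qed
  qed (use C CIm \<gamma> in \<open>auto simp: borel_probs_D indicator_def\<close>)
  ultimately show "(\<integral>z. C z \<partial>\<gamma>) \<le> L C + d" by (intro LIMSEQ_le_const2) auto
qed

section \<open>The dual cone and the optimal plan\<close>

context causal_problem
begin

text \<open>In the dual cone, \<open>scaled_minorant s C\<close> says that \<open>C\<close> is \<open>s\<close> times an admissible Lipschitz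
  function below \<open>c\<close>; keeping the factor \<open>s\<close> implicit makes the cone visibly convex.\<close>

definition scaled_minorant :: "real \<Rightarrow> ('e \<times> 's \<Rightarrow> real) \<Rightarrow> bool" where
  "scaled_minorant s C \<longleftrightarrow> bounded (range C) \<and> (\<forall>z. ereal (C z) \<le> ereal s * c z) \<and>
     (\<exists>K. \<forall>x y z. \<bar>C (x, y) - C (x, z)\<bar> \<le> K * dist y z)"

lemma scaled_minorant_le: "scaled_minorant s C \<Longrightarrow> ereal (C z) \<le> ereal s * c z"
  unfolding scaled_minorant_def by blast

lemma scaled_minorant_bounded: "scaled_minorant s C \<Longrightarrow> bounded (range C)"
  unfolding scaled_minorant_def by blast

lemma scaled_minorant_add:
  assumes "0 \<le> s" "0 \<le> t" "scaled_minorant s C" "scaled_minorant t D"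
  shows "scaled_minorant (s + t) (\<lambda>z. C z + D z)"
proof -
  obtain K where K: "\<And>x y z. \<bar>C (x, y) - C (x, z)\<bar> \<le> K * dist y z"
    using assms(3) unfolding scaled_minorant_def by blast
  obtain K' where K': "\<And>x y z. \<bar>D (x, y) - D (x, z)\<bar> \<le> K' * dist y z"
    using assms(4) unfolding scaled_minorant_def by blast
  have "\<bar>C (x, y) + D (x, y) - (C (x, z) + D (x, z))\<bar> \<le> (K + K') * dist y z" for x y z
    using K[of x y z] K'[of x y z] by (simp add: distrib_right abs_le_iff)
  moreover have "ereal (C z + D z) \<le> ereal (s + t) * c z" for z
  proof -
    have "ereal (C z + D z) \<le> ereal s * c z + ereal t * c z"
      using add_mono[OF scaled_minorant_le[OF assms(3)] scaled_minorant_le[OF assms(4)], of z z] by simp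
    also have "\<dots> = (ereal s + ereal t) * c z"
      using assms(1,2) by (intro ereal_left_distrib[symmetric]) simp_all
    finally show ?thesis by simp
  qed
  moreover have "bounded (range (\<lambda>z. C z + D z))"
    using assms(3,4)[THEN scaled_minorant_bounded] by (rule bounded_plus_comp)
  ultimately show ?thesis unfolding scaled_minorant_def by blast
qed

lemma scaled_minorant_scale:
  assumes "0 \<le> a" "scaled_minorant s C"
  shows "scaled_minorant (a * s) (\<lambda>z. a * C z)"
proof -
  obtain K where K: "\<And>x y z. \<bar>C (x, y) - C (x, z)\<bar> \<le> K * dist y z"
    using assms(2) unfolding scaled_minorant_def by blast
  have "\<bar>a * C (x, y) - a * C (x, z)\<bar> \<le> (a * K) * dist y z" for x y z
    using mult_left_mono[OF K[of x y z] assms(1)] assms(1)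
    by (simp add: abs_mult mult.assoc flip: right_diff_distrib)
  moreover have "ereal (a * C z) \<le> ereal (a * s) * c z" for z
    using ereal_mult_left_mono[OF scaled_minorant_le[OF assms(2)], of "ereal a" z] assms(1)
    by (simp add: mult.assoc flip: times_ereal.simps(1))
  moreover have "bounded (range (\<lambda>z. a * C z))"
    using bounded_scaling[OF scaled_minorant_bounded[OF assms(2)], of a] by (simp add: image_image)
  ultimately show ?thesis unfolding scaled_minorant_def by blast
qed

text \<open>Since \<open>c\<close> is nonnegative, the scale 0 may be raised to a positive one, by
  which the whole inequality can then be divided.\<close>

lemma scaled_minorant_mono:
  assumes "s \<le> t" "scaled_minorant s C"
  shows "scaled_minorant t C"
proof -
  have "ereal (C z) \<le> ereal t * c z" for z
    using scaled_minorant_le[OF assms(2), of z] ereal_mult_right_mono[of "ereal s" "ereal t" "c z"] assms(1) c_nonneg[of z]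
    by (simp add: order_trans)
  then show ?thesis using assms(2) by (simp add: scaled_minorant_def)
qed

text \<open>Division by a scale \<open>t > 0\<close> turns \<open>- u / t\<close> into a bounded
  Borel competitor for the dual problem, whose integral is therefore at most \<open>m\<close>. As
  \<open>s\<close> itself may be 0, the inequality is proved for positive \<open>t \<ge> s\<close>
  and passed to the limit.\<close>

lemma dual_cone_nonneg:
  assumes m: "causal_dual I BE BS c \<eta> \<nu> \<le> ereal m"
    and u: "u \<in> borel_measurable borel" "bounded (range u)" and h: "h \<in> test_functions"
    and s: "0 \<le> s" and C: "scaled_minorant s C"
    and pos: "\<And>z. 0 \<le> u (snd z) + C z + h z"
  shows "0 \<le> (\<integral>y. u y \<partial>\<nu>) + s * m"
proof -
  have *: "0 \<le> (\<integral>y. u y \<partial>\<nu>) + t * m" if t: "s \<le> t" "0 < t" for t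
  proof -
    have "scaled_minorant (1 / t * t) (\<lambda>z. 1 / t * C z)"
      using t by (intro scaled_minorant_scale scaled_minorant_mono[OF t(1) C]) simp
    then have C': "scaled_minorant 1 (\<lambda>z. 1 / t * C z)" using t by simp
    then obtain K where "\<And>x y z. \<bar>1 / t * C (x, y) - 1 / t * C (x, z)\<bar> \<le> K * dist y z"
      unfolding scaled_minorant_def by blast
    moreover have "- (1 / t) * u y \<le> 1 / t * C (x, y) + 1 / t * h (x, y)" for x y
      using mult_left_mono[OF pos[of "(x, y)"], of "1 / t"] t(2) by (simp add: algebra_simps)
    moreover have "bounded (range (\<lambda>y. - (1 / t) * u y))"
      using bounded_scaling[OF u(2), of "- (1 / t)"] by (simp add: image_image)
    ultimately have "ereal (\<integral>y. - (1 / t) * u y \<partial>\<nu>) \<le> causal_dual I BE BS c \<eta> \<nu>"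
      using u(1) C' by (intro causal_dual_ge_bounded[OF _ _ test_functions_scale[OF h, of "1 / t"]])
        (use scaled_minorant_le[OF C'] scaled_minorant_bounded[OF C'] in \<open>simp_all add: one_ereal_def[symmetric]\<close>)
    then have "ereal (\<integral>y. - (1 / t) * u y \<partial>\<nu>) \<le> ereal m" using m by (rule order_trans)
    then have "- (1 / t) * (\<integral>y. u y \<partial>\<nu>) \<le> m" by simp
    then have "t * (- (1 / t) * (\<integral>y. u y \<partial>\<nu>)) \<le> t * m" using t(2) by (intro mult_left_mono) auto
    then show ?thesis using t(2) by simp
  qed
  have "((\<lambda>t. (\<integral>y. u y \<partial>\<nu>) + t * m) \<longlongrightarrow> (\<integral>y. u y \<partial>\<nu>) + s * m) (at_right s)"
    by (intro tendsto_intros)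
  moreover have "\<forall>\<^sub>F t in at_right s. 0 \<le> (\<integral>y. u y \<partial>\<nu>) + t * m"
    using eventually_at_right_less[of s] by eventually_elim (use * s in auto)
  ultimately show ?thesis by (intro tendsto_lowerbound) auto
qed

lemma cost_lipschitz_approx:
  obtains C :: "nat \<Rightarrow> 'e \<times> 's \<Rightarrow> real"
  where "\<And>n. scaled_minorant 1 (C n)" "\<And>n z. 0 \<le> C n z" "\<And>n. continuous_on UNIV (C n)"
    "\<And>n x y z. \<bar>C n (x, y) - C n (x, z)\<bar> \<le> real n * dist y z"
    "\<And>z a. ereal a < c z \<Longrightarrow> \<forall>\<^sub>F n in sequentially. a \<le> C n z"
proof -
  \<comment> \<open>Truncation at \<open>n\<close> makes the cost real-valued and bounded before its
    Lipschitz minorant is taken.\<close>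
  define f where "f n z = real_of_ereal (min (c z) (ereal (real n)))" for n :: nat and z
  have f: "ereal (f n z) = min (c z) (ereal (real n))" for n z
    unfolding f_def using c_nonneg[of z] by (intro ereal_real') (auto simp: min_def)
  have f0: "- 0 \<le> f n z" for n z using c_nonneg[of z] by (simp add: f_def real_of_ereal_pos)
  have fn: "f n z \<le> real n" for n z using f[of n z] by (metis ereal_less_eq(3) min.cobounded2)
  have fc: "ereal (f n z) \<le> c z" for n z by (simp add: f)
  define C where "C n = lipschitz_minorant (f n) (real n)" for n
  have n0: "0 \<le> real n" for n by simp
  have C0: "0 \<le> C n z" for n z
    using lipschitz_minorant_lower[OF n0[of n] f0[of n], where y = z] by (simp add: C_def)
  have Cf: "C n z \<le> f n z" for n z unfolding C_def by (rule lipschitz_minorant_le[OF n0 f0])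
  have Clip: "\<bar>C n (x, y) - C n (x, z)\<bar> \<le> real n * dist y z" for n x y z
    using lipschitz_minorant_lipschitz[OF n0[of n] f0[of n], where y = "(x, y)" and z = "(x, z)"] by (simp add: C_def dist_Pair_Pair)
  have "scaled_minorant 1 (C n)" for n
    unfolding scaled_minorant_def
  proof (intro conjI exI allI)
    show "bounded (range (C n))"
      using C0 order_trans[OF Cf fn] by (intro boundedI[of _ "real n"]) auto
    show "ereal (C n z) \<le> ereal 1 * c z" for z
      using order_trans[OF _ fc, of "ereal (C n z)" n z] Cf[of n z] by (simp add: one_ereal_def[symmetric])
  qed (rule Clip)
  moreover have "continuous_on UNIV (C n)" for n
    unfolding C_def by (rule lipschitz_minorant_continuous[OF n0 f0])
  moreover have "\<forall>\<^sub>F n in sequentially. a \<le> C n z" if a: "ereal a < c z" for z a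
  proof -
    have "open {w. ereal a < c w}" using c_lsc by (simp add: lower_semicont_def)
    then obtain r where r: "0 < r" "ball z r \<subseteq> {w. ereal a < c w}"
      using a unfolding open_contains_ball by blast
    \<comment> \<open>\<open>a \<le> real n\<close> keeps the truncated cost above \<open>a\<close>
      on the ball given by lower semicontinuity; \<open>a / r \<le> real n\<close> lets the penalty
      achieve the same outside it.\<close>
    have "a \<le> C n z" if n: "a \<le> real n" "a / r \<le> real n" for n
      unfolding C_def
    proof (rule lipschitz_minorant_ge[OF n0 f0])
      show "a + 0 \<le> real n * r" using n(2) r(1) by (simp add: divide_le_eq)
      fix w assume "dist z w < r"
      then have "ereal a < c w" using r(2) by (auto simp: ball_def)
      then have "ereal a \<le> ereal (f n w)" unfolding f using n(1) by simp
      then have "a \<le> f n w" by simp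
      then show "a \<le> f n w + real n * dist z w" by (simp add: add_increasing2)
    qed
    moreover have "\<forall>\<^sub>F n in sequentially. a \<le> real n \<and> a / r \<le> real n"
      using filterlim_real_sequentially by (simp add: filterlim_at_top eventually_conj)
    ultimately show ?thesis by (auto elim!: eventually_mono)
  qed
  ultimately show ?thesis using C0 Clip by (intro that[of C])
qed

text \<open>No limit of nearly optimal plans is taken: the separating functional itself produces a
  plan of cost at most \<open>m\<close>.\<close>

lemma exists_causal_plan:
  assumes m: "causal_dual I BE BS c \<eta> \<nu> \<le> ereal m"
  shows "\<exists>\<gamma>\<in>causal_plans I BE BS \<eta> \<nu>. (\<integral>\<^sup>+ z. e2ennreal (c z) \<partial>\<gamma>) \<le> ennreal m"
proof -
  \<comment> \<open>The potentials \<open>u\<close> range over all bounded Borel functions;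
    continuous ones would prescribe the second marginal of \<open>L\<close> on continuous functions
    only. The dual value controls the larger class through
    \<open>causal_dual_ge_bounded\<close>.\<close>
  define Q where "Q = {((\<lambda>z. u (snd z) + C z + h z), (\<integral>y. u y \<partial>\<nu>) + s * m) | u s C h.
    u \<in> borel_measurable borel \<and> bounded (range u) \<and> 0 \<le> s \<and> scaled_minorant s C \<and> h \<in> test_functions}"
  have QI: "(w, r) \<in> Q" if "u \<in> borel_measurable borel" "bounded (range u)" "0 \<le> s" "scaled_minorant s C"
    "h \<in> test_functions" "\<And>z. w z = u (snd z) + C z + h z" "r = (\<integral>y. u y \<partial>\<nu>) + s * m" for w r u s C h
  proof -
    have "w = (\<lambda>z. u (snd z) + C z + h z)" using that(6) by blast
    then show ?thesis unfolding Q_def mem_Collect_eq using that by blast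
  qed
  have QE: "\<exists>u s C h. u \<in> borel_measurable borel \<and> bounded (range u) \<and> 0 \<le> s \<and> scaled_minorant s C \<and>
    h \<in> test_functions \<and> (\<forall>z. w z = u (snd z) + C z + h z) \<and> r = (\<integral>y. u y \<partial>\<nu>) + s * m" if "(w, r) \<in> Q" for w r
    using that unfolding Q_def by blast
  have sm0: "scaled_minorant s (\<lambda>z. 0)" if "0 \<le> s" for s
  proof -
    have "ereal 0 \<le> ereal s * c z" for z
      unfolding zero_ereal_def[symmetric] using that c_nonneg[of z] by (intro ereal_0_le_mult) simp_all
    then show ?thesis unfolding scaled_minorant_def by (intro conjI allI exI[of _ 0]) simp_all
  qed
  have Qadd: "(\<lambda>z. v z + w z, r + r') \<in> Q" if vr: "(v, r) \<in> Q" and wr: "(w, r') \<in> Q" for v r w r'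
  proof -
    obtain u s C h where 1: "u \<in> borel_measurable borel" "bounded (range u)" "0 \<le> s" "scaled_minorant s C"
      "h \<in> test_functions" "\<forall>z. v z = u (snd z) + C z + h z" "r = (\<integral>y. u y \<partial>\<nu>) + s * m"
      using QE[OF vr] by (elim exE conjE)
    obtain u' s' C' h' where 2: "u' \<in> borel_measurable borel" "bounded (range u')" "0 \<le> s'" "scaled_minorant s' C'"
      "h' \<in> test_functions" "\<forall>z. w z = u' (snd z) + C' z + h' z" "r' = (\<integral>y. u' y \<partial>\<nu>) + s' * m"
      using QE[OF wr] by (elim exE conjE)
    show ?thesis
    proof (rule QI)
      show "(\<lambda>y. u y + u' y) \<in> borel_measurable borel" using 1(1) 2(1) by simp
      show "bounded (range (\<lambda>y. u y + u' y))" using 1(2) 2(2) by (rule bounded_plus_comp)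
      show "scaled_minorant (s + s') (\<lambda>z. C z + C' z)" using 1(3) 2(3) 1(4) 2(4) by (rule scaled_minorant_add)
      show "(\<lambda>z. h z + h' z) \<in> test_functions" using 1(5) 2(5) by (rule test_functions_add)
      show "r + r' = (\<integral>y. u y + u' y \<partial>\<nu>) + (s + s') * m"
        using integrable_bounded[OF \<nu> 1(1,2)] integrable_bounded[OF \<nu> 2(1,2)]
        by (simp add: 1(7) 2(7) distrib_right)
    qed (use 1(3) 2(3) spec[OF 1(6)] spec[OF 2(6)] in simp_all)
  qed
  have Qscale: "(\<lambda>z. a * v z, a * r) \<in> Q" if a: "0 \<le> a" and vr: "(v, r) \<in> Q" for a v r
  proof -
    obtain u s C h where 1: "u \<in> borel_measurable borel" "bounded (range u)" "0 \<le> s" "scaled_minorant s C"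
      "h \<in> test_functions" "\<forall>z. v z = u (snd z) + C z + h z" "r = (\<integral>y. u y \<partial>\<nu>) + s * m"
      using QE[OF vr] by (elim exE conjE)
    show ?thesis
    proof (rule QI)
      show "(\<lambda>y. a * u y) \<in> borel_measurable borel" using 1(1) by simp
      show "bounded (range (\<lambda>y. a * u y))" using bounded_scaling[OF 1(2), of a] by (simp add: image_image)
      show "scaled_minorant (a * s) (\<lambda>z. a * C z)" using a 1(4) by (rule scaled_minorant_scale)
      show "(\<lambda>z. a * h z) \<in> test_functions" using 1(5) by (rule test_functions_scale)
      show "a * r = (\<integral>y. a * u y \<partial>\<nu>) + a * s * m" by (simp add: 1(7) distrib_left mult.assoc)
    qed (use 1(3) spec[OF 1(6)] a in \<open>simp_all add: distrib_left\<close>)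
  qed
  have Qu: "(\<lambda>z. u (snd z), \<integral>y. u y \<partial>\<nu>) \<in> Q" if "u \<in> borel_measurable borel" "bounded (range u)" for u
    using that by (rule QI[OF _ _ _ sm0 test_functions_zero, of _ 0]) simp_all
  have Qh: "(h, 0) \<in> Q" if "h \<in> test_functions" for h
    by (rule QI[OF _ _ _ sm0 that, of "\<lambda>_. 0" 0]) simp_all
  have QC: "(C, m) \<in> Q" if "scaled_minorant 1 C" for C
    by (rule QI[OF _ _ _ that test_functions_zero, of "\<lambda>_. 0"]) simp_all
  interpret S: prob_space \<nu> using \<nu> by (rule borel_probs_D)
  have Qone: "(\<lambda>z. 1, 1) \<in> Q" using Qu[of "\<lambda>_. 1"] S.prob_space by simp
  have Qpos: "0 \<le> r" if vr: "(v, r) \<in> Q" and pos: "\<And>z. 0 \<le> v z" for v r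
  proof -
    obtain u s C h where 1: "u \<in> borel_measurable borel" "bounded (range u)" "0 \<le> s" "scaled_minorant s C"
      "h \<in> test_functions" "\<forall>z. v z = u (snd z) + C z + h z" "r = (\<integral>y. u y \<partial>\<nu>) + s * m"
      using QE[OF vr] by (elim exE conjE)
    show ?thesis unfolding 1(7)
      using pos spec[OF 1(6)] by (intro dual_cone_nonneg[OF m 1(1,2,5,3,4)]) simp
  qed
  show ?thesis
  proof (rule cone_positive_linear_functional[of Q, OF Qadd Qscale Qone Qpos])
    fix L :: "('e \<times> 's \<Rightarrow> real) \<Rightarrow> real"
    assume Ladd: "\<And>f g. bounded (range f) \<Longrightarrow> bounded (range g) \<Longrightarrow> L (\<lambda>z. f z + g z) = L f + L g"
      and Lscale: "\<And>a f. bounded (range f) \<Longrightarrow> L (\<lambda>z. a * f z) = a * L f"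
      and Lmono: "\<And>f g. bounded (range f) \<Longrightarrow> bounded (range g) \<Longrightarrow> (\<And>z. f z \<le> g z) \<Longrightarrow> L f \<le> L g"
      and LQ: "\<And>w r. (w, r) \<in> Q \<Longrightarrow> bounded (range w) \<Longrightarrow> L w \<le> r"
    \<comment> \<open>Prices bound \<open>L\<close> only from above, but the cone contains
      \<open>u\<close> and \<open>- u\<close> at opposite prices, which forces equality.\<close>
    have Lsnd: "L (\<lambda>z. u (snd z)) = (\<integral>y. u y \<partial>\<nu>)" if u: "u \<in> borel_measurable borel" "bounded (range u)" for u
    proof (rule antisym)
      have b: "bounded (range (\<lambda>z. u (snd z)))" using u(2) by (rule bounded_compose)
      show "L (\<lambda>z. u (snd z)) \<le> (\<integral>y. u y \<partial>\<nu>)" using Qu[OF u] b by (rule LQ)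
      have "bounded (range (\<lambda>y. - 1 * u y))" using bounded_scaling[OF u(2), of "-1"] by (simp add: image_image)
      then have "L (\<lambda>z. - 1 * u (snd z)) \<le> (\<integral>y. - 1 * u y \<partial>\<nu>)"
        using u(1) by (intro LQ Qu bounded_compose[of "\<lambda>y. - 1 * u y" snd]) simp_all
      then show "(\<integral>y. u y \<partial>\<nu>) \<le> L (\<lambda>z. u (snd z))" using Lscale[OF b, of "-1"] by simp
    qed
    have Lone: "L (\<lambda>z. 1) = 1" using Lsnd[of "\<lambda>_. 1"] S.prob_space by simp
    have Lh: "L h = 0" if h: "h \<in> test_functions" for h
    proof -
      note hb = test_functions_bounded(2)[OF h]
      note h' = test_functions_scale[OF h, of "-1"]
      have "L (\<lambda>z. - 1 * h z) \<le> 0" using Qh[OF h'] test_functions_bounded(2)[OF h'] by (rule LQ)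
      moreover have "L h \<le> 0" using Qh[OF h] hb by (rule LQ)
      ultimately show ?thesis using Lscale[OF hb, of "-1"] by simp
    qed
    have Lfst: "L (\<lambda>z. f (fst z)) = (\<integral>x. f x \<partial>\<eta>)"
      if f: "f \<in> borel_measurable borel" "bounded (range f)" for f
    proof -
      define k where "k = (\<integral>x. f x \<partial>\<eta>)"
      have "L (\<lambda>z. f (fst z) + - k * 1) = 0"
        using Lh[OF test_functions_pair[OF causal_pair_UNIV[OF f]]] by (simp add: k_def)
      then show ?thesis
        using Ladd[OF bounded_compose[OF f(2), of fst], of "\<lambda>z. - k * 1"] Lscale[of "\<lambda>z. 1" "- k"] Lone by (simp add: k_def)
    qed
    have "\<exists>\<gamma>\<in>transference_plans \<eta> \<nu>. \<exists>\<Theta>. is_kernel \<eta> \<gamma> \<Theta> \<and>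
      (\<forall>f\<in>borel_measurable borel. bounded (range f) \<longrightarrow> (\<forall>A\<in>sets borel.
        L (\<lambda>z. f (fst z) * indicator A (snd z)) = (\<integral>z. f (fst z) * indicator A (snd z) \<partial>\<gamma>)))"
      by (intro plan_of_functional \<eta> \<nu> Ladd Lscale Lmono Lfst Lsnd) simp_all
    then obtain \<gamma> \<Theta> where \<gamma>: "\<gamma> \<in> transference_plans \<eta> \<nu>" and \<Theta>: "is_kernel \<eta> \<gamma> \<Theta>"
      and L\<gamma>': "\<forall>f\<in>borel_measurable borel. bounded (range f) \<longrightarrow> (\<forall>A\<in>sets borel.
        L (\<lambda>z. f (fst z) * indicator A (snd z)) = (\<integral>z. f (fst z) * indicator A (snd z) \<partial>\<gamma>))"
      by (elim bexE exE conjE)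
    have L\<gamma>: "L (\<lambda>z. f (fst z) * indicator A (snd z)) = (\<integral>z. f (fst z) * indicator A (snd z) \<partial>\<gamma>)"
      if "f \<in> borel_measurable borel" "bounded (range f)" "A \<in> sets borel" for f A
      using L\<gamma>' that by blast
    have \<gamma>b: "\<gamma> \<in> borel_probs" using \<gamma> by (rule transference_plans_D)
    \<comment> \<open>The kernel mass \<open>X = measure (\<Theta> x) A\<close> is its own witness:
      its residual \<open>g\<close> paired with \<open>A\<close> is a test function, so
      \<open>L\<close> annihilates it. This says that the residual is orthogonal to
      \<open>X\<close>, and \<open>X\<close> is measurable for the completed field.\<close>
    have "sets (kernel_field \<eta> \<nu> (BS t) \<Theta>) \<subseteq> sets (completed \<eta> (BE t))" if t: "t \<in> I" for t
      unfolding kernel_field_subset_iff[OF \<eta>]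
    proof (intro ballI impI)
      fix A assume A: "A \<in> sets (BS t)" "emeasure \<nu> (frontier A) = 0"
      have t': "Some t \<in> insert None (Some ` I)" using t by simp
      have ext: "extended_filtration BE (Some t) = BE t" "extended_filtration BS (Some t) = BS t"
        by (simp_all add: extended_filtration_def)
      have sub: "subalgebra borel (BE t)" "subalgebra borel (BS t)"
        using subalgebra_extended[OF t'] by (simp_all only: ext)
      have Ab: "A \<in> sets borel" using A(1) sub(2) by (auto simp: subalgebra_def)
      have \<theta>: "(\<lambda>x. measure (\<Theta> x) A) \<in> borel_measurable borel" using \<Theta> Ab by (simp add: is_kernel_def)
      note \<theta>b = kernel_bounded[OF \<Theta>, of A]
      obtain g where g: "g \<in> borel_measurable borel" "bounded (range g)"
        "AE x in \<eta>. g x = measure (\<Theta> x) A - real_cond_exp (completion \<eta>) (completed \<eta> (BE t)) (\<lambda>x. measure (\<Theta> x) A) x"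
        by (rule cond_exp_residual_exists[OF \<eta> sub(1) \<theta> \<theta>b])
      obtain k where "\<And>x. \<bar>measure (\<Theta> x) A\<bar> \<le> k" using \<theta>b by (auto simp: bounded_iff)
      then have k: "AE x in \<eta>. \<bar>measure (\<Theta> x) A\<bar> \<le> k" by (intro AE_I2)
      have "causal_pair g A"
        unfolding causal_pair_def using A g \<theta> k
        by (intro bexI[of _ "Some t"] conjI bexI[of _ "\<lambda>x. measure (\<Theta> x) A"] exI[of _ k] t') (simp_all only: ext)
      then have "(\<integral>z. g (fst z) * indicator A (snd z) \<partial>\<gamma>) = 0"
        using L\<gamma>[OF g(1,2) Ab] Lh[OF test_functions_pair] by simp
      then have "(\<integral>x. g x * measure (\<Theta> x) A \<partial>\<eta>) = 0" using integral_kernel[OF \<eta> \<gamma> \<Theta> g(1,2) Ab] by simp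
      then show "(\<lambda>x. measure (\<Theta> x) A) \<in> borel_measurable (completed \<eta> (BE t))"
        by (rule cond_exp_residual_self_orthogonal[OF \<eta> sub(1) \<theta> \<theta>b g])
    qed
    then have "\<gamma> \<in> causal_plans I BE BS \<eta> \<nu>" using \<gamma> \<Theta> unfolding causal_plans_def by blast
    moreover have "(\<integral>\<^sup>+ z. e2ennreal (c z) \<partial>\<gamma>) \<le> ennreal m"
    proof (rule cost_lipschitz_approx)
      fix C :: "nat \<Rightarrow> 'e \<times> 's \<Rightarrow> real"
      assume C: "\<And>n. scaled_minorant 1 (C n)" "\<And>n z. 0 \<le> C n z" "\<And>n. continuous_on UNIV (C n)"
        "\<And>n x y z. \<bar>C n (x, y) - C n (x, z)\<bar> \<le> real n * dist y z"
        "\<And>z a. ereal a < c z \<Longrightarrow> \<forall>\<^sub>F n in sequentially. a \<le> C n z"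
      have Cb: "bounded (range (C n))" for n using C(1) by (rule scaled_minorant_bounded)
      have Cm: "C n \<in> borel_measurable borel" for n using C(3) by (rule borel_measurable_continuous_onI)
      have int: "(\<integral>z. C n z \<partial>\<gamma>) \<le> m" for n
      proof -
        have xm: "(\<lambda>x. C n (x, y)) \<in> borel_measurable borel" for y
          using continuous_on_compose2[OF C(3)[of n], of UNIV "\<lambda>x. (x, y)"]
          by (intro borel_measurable_continuous_onI) (simp add: continuous_on_Pair)
        have "(\<integral>z. C n z \<partial>\<gamma>) \<le> L (C n)"
          by (intro integral_le_functional[where K = "real n"] \<gamma>b Ladd Lscale Lmono Lone L\<gamma> Cm Cb C(2) xm C(4)) simp_all
        also have "\<dots> \<le> m" using QC[OF C(1)] Cb by (rule LQ)
        finally show ?thesis .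
      qed
      \<comment> \<open>The pointwise approximation in the form needed for Fatou's lemma. The
        intermediate \<open>w\<close> is finite, being strictly below another value, so it is a real
        number \<open>a\<close> to which the approximation applies.\<close>
      have lim: "e2ennreal (c z) \<le> liminf (\<lambda>n. ennreal (C n z))" for z
        unfolding le_Liminf_iff
      proof (intro allI impI)
        fix y assume y: "y < e2ennreal (c z)"
        then obtain w where w: "y < w" "w < e2ennreal (c z)" using dense by blast
        then obtain a where a: "0 \<le> a" "w = ennreal a" by (cases w) auto
        have "enn2ereal w < c z"
          using w(2) c_nonneg[of z] by (simp add: less_ennreal.rep_eq enn2ereal_e2ennreal)
        then have "ereal a < c z" using a by (simp add: enn2ereal_ennreal)
        from C(5)[OF this] show "\<forall>\<^sub>F n in sequentially. y < ennreal (C n z)"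
        proof eventually_elim
          case (elim n)
          then have "w \<le> ennreal (C n z)" using a by (simp add: ennreal_leI)
          then show ?case using w(1) by (rule less_le_trans[rotated])
        qed
      qed
      have "(\<integral>\<^sup>+ z. e2ennreal (c z) \<partial>\<gamma>) \<le> (\<integral>\<^sup>+ z. liminf (\<lambda>n. ennreal (C n z)) \<partial>\<gamma>)"
        using lim by (rule nn_integral_mono)
      also have "\<dots> \<le> liminf (\<lambda>n. \<integral>\<^sup>+ z. ennreal (C n z) \<partial>\<gamma>)"
        using Cm \<gamma>b by (intro nn_integral_liminf) (simp add: borel_probs_D)
      also have "\<dots> \<le> ennreal m"
      proof (rule Liminf_le)
        have "(\<integral>\<^sup>+ z. ennreal (C n z) \<partial>\<gamma>) = ennreal (\<integral>z. C n z \<partial>\<gamma>)" for n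
          using integrable_bounded[OF \<gamma>b Cm Cb] C(2) by (intro nn_integral_eq_integral) auto
        then show "\<forall>\<^sub>F n in sequentially. (\<integral>\<^sup>+ z. ennreal (C n z) \<partial>\<gamma>) \<le> ennreal m"
          using int by (simp add: ennreal_leI)
      qed simp
      finally show ?thesis .
    qed
    ultimately show ?thesis by blast
  qed
qed

lemma causal_dual_nonneg: "0 \<le> causal_dual I BE BS c \<eta> \<nu>"
proof -
  have "ereal (\<integral>y. 0 \<partial>\<nu>) \<le> causal_dual I BE BS c \<eta> \<nu>"
    using c_nonneg by (intro causal_dual_ge[OF _ test_functions_zero]) (auto simp: zero_ereal_def[symmetric] bcontfun_def)
  then show ?thesis by (simp add: zero_ereal_def)
qed

lemma strong_duality: "causal_primal I BE BS c \<eta> \<nu> \<le> causal_dual I BE BS c \<eta> \<nu>"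
proof (cases "causal_dual I BE BS c \<eta> \<nu>")
  case (real m)
  then have m: "0 \<le> m" using causal_dual_nonneg by simp
  obtain \<gamma> where \<gamma>: "\<gamma> \<in> causal_plans I BE BS \<eta> \<nu>" "(\<integral>\<^sup>+ z. e2ennreal (c z) \<partial>\<gamma>) \<le> ennreal m"
    using exists_causal_plan[of m] real by auto
  have "causal_primal I BE BS c \<eta> \<nu> \<le> enn2ereal (\<integral>\<^sup>+ z. e2ennreal (c z) \<partial>\<gamma>)"
    unfolding causal_primal_def by (rule INF_lower[OF \<gamma>(1)])
  also have "\<dots> \<le> enn2ereal (ennreal m)" using \<gamma>(2) by (simp add: less_eq_ennreal.rep_eq)
  also have "\<dots> = causal_dual I BE BS c \<eta> \<nu>" using real m by (simp add: enn2ereal_ennreal)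
  finally show ?thesis .
\<comment> \<open>A dual value of plus infinity leaves nothing to prove, and minus infinity is
  excluded by nonnegativity.\<close>
qed (use causal_dual_nonneg in simp_all)

end

theorem theorem2:
  fixes I :: "'i::linorder set"
    and BE :: "'i \<Rightarrow> 'e::polish_space measure"
    and BS :: "'i \<Rightarrow> 's::polish_space measure"
    and c :: "'e \<times> 's \<Rightarrow> ereal"
    and \<eta> :: "'e measure" and \<nu> :: "'s measure"
  assumes "borel_filtration I BE" and "borel_filtration I BS"
    and "\<And>z. 0 \<le> c z" and "lower_semicont c"
    and "\<eta> \<in> borel_probs" and "\<nu> \<in> borel_probs"
  shows "causal_primal I BE BS c \<eta> \<nu> = causal_dual I BE BS c \<eta> \<nu>"
proof -
  interpret causal_problem I BE BS c \<eta> \<nu>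
    using assms by unfold_locales
  show ?thesis using strong_duality weak_duality by (rule antisym)
qed

end
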